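(* Neither of the Dirichlet series $$F^{\pm}(s) = \sum_{\substack{[K:\mathbb{Q}] = 3 \\ \pm \mathrm{Disc}(K) > 0}} |\mathrm{Disc}(K)|^{-s}$$ counting cubic fields can be represented as a finite sum of Euler products. That is, for each choice of sign $\pm$, if $a^{\pm}(n)$ denotes the number of cubic fields $K$ with $\mathrm{Disc}(K) = \pm n$, there do not exist a positive integer $k$, real numbers $c_1, \dots, c_k$, and multiplicative functions $b_1, \dots, b_k$ on the positive integers such that $a^{\pm}(n) = \sum_{i=1}^k c_i b_i(n)$ for all $n \geq 1$.
   Context: Cubic fields are degree $3$ extensions $K$ of $\mathbb{Q}$, counted up to isomorphism, and $\mathrm{Disc}(K)$ is the (signed) discriminant of $K$. A multiplicative function is a (complex-valued) function $b$ on the positive integers with $b(1) = 1$ and $b(mn) = b(m)b(n)$ whenever $\gcd(m,n)=1$. *)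

theory Defs
  imports "HOL-Analysis.Analysis" "HOL-Algebra.Algebraic_Closure_Type"
begin

text \<open>
  Every number field embeds into the complex numbers, so cubic fields up to isomorphism are
  rendered as isomorphism classes of subfields of the complex numbers (of degree 3 over the
  rationals).  As a vector space over the rationals, the complex numbers carry the scaling below.
\<close>

global_interpretation ratvs: vector_space "\<lambda>(q::rat) (x::complex). of_rat q * x"
  by unfold_locales (simp_all add: algebra_simps of_rat_add of_rat_mult)

abbreviation complex_field :: "complex ring" where
  "complex_field \<equiv> ring_of_type_algebra"

definition cubic_fields :: "complex set set" where
  "cubic_fields = {K. subfield K complex_field \<and> ratvs.dim K = 3}"

definition cubic_field_iso :: "(complex set \<times> complex set) set" where
  "cubic_field_iso = {(K, L). K \<in> cubic_fields \<and> L \<in> cubic_fields \<and>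
     complex_field\<lparr>carrier := K\<rparr> \<simeq> complex_field\<lparr>carrier := L\<rparr>}"

definition ring_of_integers :: "complex set \<Rightarrow> complex set" where
  "ring_of_integers K = {x \<in> K. algebraic_int x}"

text \<open>
  The trace of multiplication by \<open>x\<close> on \<open>K\<close>: the sum of the diagonal entries of its matrix with
  respect to a rational basis of \<open>K\<close> (of which the value is independent).
\<close>

definition field_trace :: "complex set \<Rightarrow> complex \<Rightarrow> rat" where
  "field_trace K x =
     (let B = (SOME B. ratvs.independent B \<and> ratvs.span B = K)
      in \<Sum>b\<in>B. ratvs.representation B (x * b) b)"

definition integral_basis :: "complex set \<Rightarrow> complex ^ 'n \<Rightarrow> bool" where
  "integral_basis K w \<longleftrightarrow>
     bij_betw (\<lambda>c :: int ^ 'n. \<Sum>i\<in>UNIV. of_int (c $ i) * w $ i) UNIV (ring_of_integers K)"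

text \<open>The (signed) discriminant of a cubic field, which does not depend on the integral basis.\<close>

definition cubic_disc :: "complex set \<Rightarrow> int" where
  "cubic_disc K = (THE d. \<exists>w :: complex ^ 3. integral_basis K w \<and>
     of_int d = det (\<chi> i j. field_trace K (w $ i * w $ j)))"

definition num_cubic_fields :: "int \<Rightarrow> nat" where
  "num_cubic_fields d = card ({K \<in> cubic_fields. cubic_disc K = d} // cubic_field_iso)"

text \<open>A multiplicative function on the positive integers; the value at 0 is irrelevant.\<close>

definition multiplicative :: "(nat \<Rightarrow> complex) \<Rightarrow> bool" where
  "multiplicative b \<longleftrightarrow> b 1 = 1 \<and>
     (\<forall>m n. m > 0 \<longrightarrow> n > 0 \<longrightarrow> coprime m n \<longrightarrow> b (m * n) = b m * b n)"

end

theory Submission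
  imports Defs "Jordan_Normal_Form.Char_Poly" "HOL-Number_Theory.Residues"
begin

text \<open>
  A finite linear combination \<open>a\<close> of \<open>k\<close> multiplicative functions has a rank restriction: if every
  \<open>m\<^sub>i\<close> is coprime to every \<open>n\<^sub>j\<close>, then \<open>a (m\<^sub>i n\<^sub>j) = (\<Sum>l. c\<^sub>l b\<^sub>l(m\<^sub>i) b\<^sub>l(n\<^sub>j))\<close>, so the matrix of
  these values has rank at most \<open>k\<close>. For the numbers of cubic fields there is a triangular matrix
  of this kind, of any given size, with non-zero diagonal, and this is the contradiction.

  The zeros of the matrix come from a quadratic residue condition that couples the two factors.
  If \<open>q > 3\<close> is a prime and a cubic field has discriminant \<open>q\<^sup>2 e\<close>, then \<open>- 3 e\<close> is a square modulo
  \<open>q\<close> (\<open>cubic_disc_square_factor\<close>). Indeed, the ring of integers has a basis \<open>1, \<omega>, \<theta>\<close> whose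
  multiplication table is given by a binary cubic form with the same discriminant (Delone and
  Faddeev; \<open>form_basis_exists\<close>, \<open>cubic_disc_form_basis\<close>). Since the ring is maximal and the square
  of \<open>q\<close> divides the discriminant, the form is a unit times a cube of a linear form modulo \<open>q\<close>;
  for a form \<open>(a, b, c, d)\<close> with \<open>b\<close>, \<open>c\<close>, \<open>d\<close> divisible by \<open>q\<close> the discriminant is
  \<open>- 27 a\<^sup>2 d\<^sup>2\<close> modulo \<open>q\<^sup>3\<close>.

  For the non-zero diagonal take distinct primes \<open>q\<^sub>0, q\<^sub>1, \<dots>\<close> congruent to 3 modulo 4 and greater than 3, let
  \<open>f\<^sub>i\<close> be the product of the \<open>q\<^sub>l\<close> with \<open>l < i\<close>, and consider a root of \<open>x\<^sup>3 + a x + b\<close>, where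
  \<open>a = - 3 f\<^sub>i\<^sup>2 M\<^sup>2\<close>, \<open>b\<close> is \<open>N\<close> times the product of all the \<open>q\<^sub>l\<close> in use, and \<open>M\<close>, \<open>N\<close> are powers of 2 that
  adjust the sign of the discriminant (\<open>cubic_field_prescribed\<close>). The polynomial is an Eisenstein
  polynomial at the prime factors of \<open>f\<^sub>i\<close>, so that the index of the generated order is prime to
  them and the field has discriminant \<open>D\<^sub>i f\<^sub>i\<^sup>2\<close> with \<open>D\<^sub>i\<close> prime to all the \<open>q\<^sub>l\<close> in use. Moreover \<open>- 3 D\<^sub>i\<close> is a
  non-residue modulo \<open>q\<^sub>i\<close>, because up to squares it is \<open>- 1\<close> there. For \<open>i < j\<close> the prime \<open>q\<^sub>i\<close> divides
  \<open>f\<^sub>j\<close>, whence no cubic field has discriminant \<open>D\<^sub>i f\<^sub>j\<^sup>2\<close>.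

  Because a cardinality is 0 for infinite sets, the diagonal entries are non-zero only since there
  are finitely many cubic fields of given discriminant (\<open>finite_cubic_fields_disc\<close>). The squared
  distances between the conjugates of an integer form a positive definite binary quadratic form
  on the ring of integers modulo \<open>\<int>\<close>, whose determinant is 3 times the absolute discriminant; a
  small value of it yields an irrational algebraic integer with bounded characteristic polynomial,
  which generates the field.
\<close>

unbundle no fps_syntax
no_notation fps_nth (infixl "$" 75)
no_notation vec_index (infixl "$" 100)
no_notation scalar_prod (infix "\<bullet>" 70)
hide_const (open) up_ring.coeff Polynomials.lead_coeff Polynomials.degree Determinant.det
  Matrix.vec Matrix.mat Divisibility.prime
hide_fact (open) Matrix.mat_def Matrix.vec_eq_iff
declare ratvs.scale_scale [simp del]

section \<open>Algebraic integers\<close>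

text \<open>
  The characteristic polynomial of an integer matrix is monic with integer coefficients, and an
  eigenvalue is a root of it.
\<close>

lemma algebraic_int_if_integer_eigenvalue:
  fixes x :: complex and v :: "nat \<Rightarrow> complex" and A :: "nat \<Rightarrow> nat \<Rightarrow> int"
  assumes eq: "\<And>j. j < n \<Longrightarrow> x * v j = (\<Sum>i<n. of_int (A j i) * v i)"
    and k: "k < n" "v k \<noteq> 0"
  shows "algebraic_int x"
proof -
  define M where "M = Matrix.mat n n (\<lambda>(j,i). A j i)"
  define V where "V = Matrix.vec n v"
  have M: "M \<in> carrier_mat n n" by (simp add: M_def)
  define C where "C = map_mat (of_int :: int \<Rightarrow> complex) M"
  have C: "C \<in> carrier_mat n n" by (simp add: C_def M)
  have "C *\<^sub>v V = x \<cdot>\<^sub>v V"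
  proof (rule eq_vecI)
    show "dim_vec (C *\<^sub>v V) = dim_vec (x \<cdot>\<^sub>v V)" by (simp add: C_def M_def V_def)
    fix j assume "j < dim_vec (x \<cdot>\<^sub>v V)"
    then have j: "j < n" by (simp add: V_def)
    have "vec_index (C *\<^sub>v V) j = (\<Sum>i<n. of_int (A j i) * v i)"
      using j by (simp add: C_def M_def V_def scalar_prod_def lessThan_atLeast0)
    also have "\<dots> = vec_index (x \<cdot>\<^sub>v V) j" using eq[OF j] j by (simp add: V_def)
    finally show "vec_index (C *\<^sub>v V) j = vec_index (x \<cdot>\<^sub>v V) j" .
  qed
  moreover have "V \<noteq> 0\<^sub>v n"
  proof
    assume "V = 0\<^sub>v n"
    then have "vec_index V k = 0" using k by simp
    then show False using k by (simp add: V_def)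
  qed
  moreover have "V \<in> carrier_vec n" by (simp add: V_def)
  ultimately have "eigenvalue C x"
    unfolding eigenvalue_def eigenvector_def using C by (intro exI[of _ V]) auto
  then have root: "poly (char_poly C) x = 0" using eigenvalue_root_char_poly[OF C] by simp
  have "char_poly C = map_poly of_int (char_poly M)"
    unfolding C_def by (rule of_int_hom.char_poly_hom[OF M])
  then have "poly (map_poly of_int (char_poly M)) x = 0" using root by simp
  moreover have "lead_coeff (char_poly M) = 1" using degree_monic_char_poly[OF M] by simp
  ultimately show ?thesis unfolding algebraic_int_altdef_ipoly by blast
qed

global_interpretation zmod: Modules.module "\<lambda>(c::int) (x::complex). of_int c * x"
  by unfold_locales (simp_all add: algebra_simps)

declare zmod.scale_scale [simp del]

lemma algebraic_int_if_mult_span: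
  assumes fin: "finite S" and s: "s \<in> S" "s \<noteq> 0"
    and mult: "\<And>y. y \<in> S \<Longrightarrow> x * y \<in> zmod.span S"
  shows "algebraic_int x"
proof -
  obtain v n where S: "S = v ` {i::nat. i < n}" "inj_on v {i. i < n}"
    using finite_imp_nat_seg_image_inj_on[OF fin] by blast
  have "\<exists>c. x * v j = (\<Sum>i<n. of_int (c i) * v i)" if "j < n" for j
  proof -
    have "x * v j \<in> zmod.span S" using mult S that by auto
    then obtain u where "x * v j = (\<Sum>y\<in>S. of_int (u y) * y)"
      unfolding zmod.span_finite[OF fin] by auto
    also have "\<dots> = (\<Sum>i\<in>{i. i < n}. of_int (u (v i)) * v i)"
      unfolding S(1) by (rule sum.reindex_cong[OF S(2)]) auto
    finally show ?thesis by (intro exI[of _ "\<lambda>i. u (v i)"]) (simp add: lessThan_def)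
  qed
  then obtain A where A: "\<And>j. j < n \<Longrightarrow> x * v j = (\<Sum>i<n. of_int (A j i) * v i)" by metis
  obtain k where "k < n" "v k = s" using s S by auto
  then show ?thesis using algebraic_int_if_integer_eigenvalue[OF A] s by auto
qed

lemma algebraic_int_power_expansion:
  fixes x :: complex
  assumes "algebraic_int x"
  obtains m a where "m > 0" "x ^ m = (\<Sum>i<m. of_int (a i) * x ^ i)"
proof -
  obtain p :: "int poly" where p: "lead_coeff p = 1" "poly (map_poly of_int p) x = 0"
    using assms unfolding algebraic_int_altdef_ipoly by auto
  define m where "m = degree p"
  have "m > 0"
  proof (rule ccontr)
    assume "\<not> m > 0"
    then have "p = [:1:]" using p(1) by (metis degree_0_id gr0I m_def of_nat_1 pCons_one of_int_1 degree_eq_zeroE lead_coeff_pCons(2) coeff_pCons_0 degree_pCons_0)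
    then show False using p(2) by simp
  qed
  have dm: "degree (map_poly (of_int :: int \<Rightarrow> complex) p) = m" by (simp add: m_def degree_map_poly)
  have "0 = (\<Sum>i\<le>m. of_int (coeff p i) * x ^ i)"
    using p(2) unfolding poly_altdef dm by (simp add: coeff_map_poly)
  also have "\<dots> = x ^ m + (\<Sum>i<m. of_int (coeff p i) * x ^ i)"
    using p(1) by (simp add: m_def lessThan_Suc_atMost[symmetric])
  finally have "x ^ m = (\<Sum>i<m. of_int (- coeff p i) * x ^ i)"
    unfolding of_int_minus mult_minus_left sum_negf eq_neg_iff_add_eq_0 by simp
  with \<open>m > 0\<close> show ?thesis by (rule that)
qed

text \<open>
  Sums and products of algebraic integers are algebraic integers: both stabilise the additive
  group generated by the finitely many monomials in the two numbers, so the integer matrix of the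
  action has them as eigenvalues.
\<close>

lemma algebraic_int_module:
  fixes x y :: complex
  assumes "algebraic_int x" "algebraic_int y"
  obtains S where "finite S" "1 \<in> S" "\<And>s. s \<in> zmod.span S \<Longrightarrow> x * s \<in> zmod.span S"
    "\<And>s. s \<in> zmod.span S \<Longrightarrow> y * s \<in> zmod.span S"
proof -
  obtain m a where m: "m > 0" "x ^ m = (\<Sum>i<m. of_int (a i) * x ^ i)"
    using algebraic_int_power_expansion[OF assms(1)] .
  obtain n b where n: "n > 0" "y ^ n = (\<Sum>i<n. of_int (b i) * y ^ i)"
    using algebraic_int_power_expansion[OF assms(2)] .
  define S where "S = (\<lambda>(i,j). x ^ i * y ^ j) ` ({..<m} \<times> {..<n})"
  have mem: "x ^ i * y ^ j \<in> zmod.span S" if "i < m" "j < n" for i j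
    by (rule zmod.span_base) (use that in \<open>auto simp: S_def\<close>)
  have X: "x * s \<in> zmod.span S" if "s \<in> S" for s
  proof -
    obtain i j where s: "s = x ^ i * y ^ j" "i < m" "j < n" using \<open>s \<in> S\<close> by (auto simp: S_def)
    show ?thesis
    proof (cases "Suc i < m")
      case True
      then show ?thesis using mem[OF True s(3)] s(1) by (simp add: mult_ac)
    next
      case False
      then have "Suc i = m" using s by simp
      then have "x * s = x ^ m * y ^ j" using s(1) by (auto simp: mult_ac)
      also have "\<dots> = (\<Sum>i<m. of_int (a i) * (x ^ i * y ^ j))"
        unfolding m(2) by (simp add: sum_distrib_left sum_distrib_right mult_ac)
      also have "\<dots> \<in> zmod.span S"
        by (intro zmod.span_sum zmod.span_scale mem) (use s in auto)
      finally show ?thesis .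
    qed
  qed
  have Y: "y * s \<in> zmod.span S" if "s \<in> S" for s
  proof -
    obtain i j where s: "s = x ^ i * y ^ j" "i < m" "j < n" using \<open>s \<in> S\<close> by (auto simp: S_def)
    show ?thesis
    proof (cases "Suc j < n")
      case True
      then show ?thesis using mem[OF s(2) True] s(1) by (simp add: mult_ac)
    next
      case False
      then have "Suc j = n" using s by simp
      then have "y * s = x ^ i * y ^ n" using s(1) by (auto simp: mult_ac)
      also have "\<dots> = (\<Sum>j<n. of_int (b j) * (x ^ i * y ^ j))"
        unfolding n(2) by (simp add: sum_distrib_left mult_ac)
      also have "\<dots> \<in> zmod.span S"
        by (intro zmod.span_sum zmod.span_scale mem) (use s in auto)
      finally show ?thesis .
    qed
  qed
  have ext: "z * s \<in> zmod.span S"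
    if "\<And>s. s \<in> S \<Longrightarrow> z * s \<in> zmod.span S" "s \<in> zmod.span S" for z s
    using that(2)
  proof (induction rule: zmod.span_induct_alt)
    case base
    then show ?case by (simp add: zmod.span_zero)
  next
    case (step c t u)
    have "z * (of_int c * t + u) = of_int c * (z * t) + z * u" by (simp add: algebra_simps)
    then show ?case using that(1)[of t] step by (simp add: zmod.span_add zmod.span_scale)
  qed
  show ?thesis
  proof (rule that[of S])
    show "finite S" by (simp add: S_def)
    have "(\<lambda>(i,j). x ^ i * y ^ j) (0,0) \<in> S" unfolding S_def by (rule imageI) (use m n in auto)
    then show "1 \<in> S" by simp
  qed (use ext X Y in auto)
qed

lemma algebraic_int_plus:
  fixes x y :: complex
  assumes "algebraic_int x" "algebraic_int y"
  shows "algebraic_int (x + y)"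
proof -
  obtain S where S: "finite S" "1 \<in> S" "\<And>s. s \<in> zmod.span S \<Longrightarrow> x * s \<in> zmod.span S"
    "\<And>s. s \<in> zmod.span S \<Longrightarrow> y * s \<in> zmod.span S"
    using algebraic_int_module[OF assms] by blast
  show ?thesis
    by (rule algebraic_int_if_mult_span[OF S(1,2)])
      (auto simp: ring_distribs intro: zmod.span_add S zmod.span_base)
qed

lemma algebraic_int_times:
  fixes x y :: complex
  assumes "algebraic_int x" "algebraic_int y"
  shows "algebraic_int (x * y)"
proof -
  obtain S where S: "finite S" "1 \<in> S" "\<And>s. s \<in> zmod.span S \<Longrightarrow> x * s \<in> zmod.span S"
    "\<And>s. s \<in> zmod.span S \<Longrightarrow> y * s \<in> zmod.span S"
    using algebraic_int_module[OF assms] by blast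
  show ?thesis
    by (rule algebraic_int_if_mult_span[OF S(1,2)])
      (auto simp: mult.assoc intro: S zmod.span_base)
qed

lemma algebraic_int_of_int: "algebraic_int (of_int n :: complex)"
  by (rule int_imp_algebraic_int) simp

lemma algebraic_int_diff:
  fixes x y :: complex
  assumes "algebraic_int x" "algebraic_int y"
  shows "algebraic_int (x - y)"
  using algebraic_int_plus[OF assms(1), of "- y"] assms(2) by simp

lemma algebraic_int_sum:
  fixes f :: "'a \<Rightarrow> complex"
  assumes "\<And>i. i \<in> I \<Longrightarrow> algebraic_int (f i)"
  shows "algebraic_int (\<Sum>i\<in>I. f i)"
  using assms by (induction I rule: infinite_finite_induct) (auto intro: algebraic_int_plus)

lemma algebraic_int_of_rat:
  assumes "algebraic_int (of_rat r :: complex)"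
  obtains n where "r = of_int n"
proof -
  have "(of_rat r :: complex) \<in> \<int>" using rational_algebraic_int_is_int[OF assms] by simp
  then obtain n where "(of_rat r :: complex) = of_int n" by (auto elim: Ints_cases)
  also have "\<dots> = of_rat (of_int n)" by simp
  finally have "r = of_int n" by (simp only: of_rat_eq_iff)
  then show ?thesis by (rule that)
qed

lemma algebraic_int_cubic:
  fixes x :: complex and p q r :: int
  assumes "x^3 + of_int p * x^2 + of_int q * x + of_int r = 0"
  shows "algebraic_int x"
proof -
  have "poly (map_poly of_int [:r, q, p, 1:]) x = 0"
    using assms by (simp add: map_poly_pCons algebra_simps power3_eq_cube power2_eq_square)
  moreover have "lead_coeff [:r, q, p, 1:] = 1" by simp
  ultimately show ?thesis unfolding algebraic_int_altdef_ipoly by blast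
qed

section \<open>Cubic fields generated by an algebraic integer\<close>

text \<open>
  Elements of a cubic field are written in the power basis of a generator \<open>t\<close>. Keeping the
  generator as the last argument makes the embeddings of the field the substitutions of the
  other roots for it.
\<close>

definition quad :: "rat \<Rightarrow> rat \<Rightarrow> rat \<Rightarrow> complex \<Rightarrow> complex" where
  "quad a b c t = of_rat a + of_rat b * t + of_rat c * t^2"

lemma quad_add: "quad a b c t + quad a' b' c' t = quad (a + a') (b + b') (c + c') t"
  by (simp add: quad_def of_rat_add algebra_simps)

lemma quad_scale: "of_rat s * quad a b c t = quad (s * a) (s * b) (s * c) t"
  by (simp add: quad_def of_rat_mult algebra_simps)

lemma quad_diff: "quad a b c t - quad a' b' c' t = quad (a - a') (b - b') (c - c') t"
  by (simp add: quad_def of_rat_diff algebra_simps)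

lemma quad_mult:
  assumes "t^3 + of_int p * t^2 + of_int q * t + of_int r = 0"
  shows "quad a b c t * quad a' b' c' t =
    quad (a * a' - of_int r * (b * c' + c * b') + of_int (p * r) * (c * c'))
         (a * b' + b * a' - of_int q * (b * c' + c * b') + of_int (p * q - r) * (c * c'))
         (a * c' + b * b' + c * a' - of_int p * (b * c' + c * b') + of_int (p * p - q) * (c * c')) t"
proof -
  have t: "t^3 = - of_int p * t^2 - of_int q * t - of_int r"
    using assms by (simp add: algebra_simps eq_neg_iff_add_eq_0)
  have "t^4 = (of_int p * of_int p - of_int q) * t^2 + (of_int p * of_int q - of_int r) * t + of_int p * of_int r"
    using t by Groebner_Basis.algebra
  then have t4: "t^4 = of_int (p*p - q) * t^2 + of_int (p*q - r) * t + of_int (p*r)" by simp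
  define A where "A = (of_rat a :: complex)" define B where "B = (of_rat b :: complex)"
  define C where "C = (of_rat c :: complex)"
  define A' where "A' = (of_rat a' :: complex)" define B' where "B' = (of_rat b' :: complex)"
  define C' where "C' = (of_rat c' :: complex)"
  note df = A_def[symmetric] B_def[symmetric] C_def[symmetric] A'_def[symmetric] B'_def[symmetric] C'_def[symmetric]
  have "(A + B * t + C * t^2) * (A' + B' * t + C' * t^2)
    = A * A' + (A * B' + B * A') * t + (A * C' + B * B' + C * A') * t^2 + (B * C' + C * B') * t^3 + C * C' * t^4"
    by (simp add: algebra_simps power_numeral_reduce)
  then show ?thesis unfolding t t4 quad_def
    by (simp add: of_rat_add of_rat_mult of_rat_diff of_rat_minus df) (simp add: algebra_simps)
qed

definition qfield :: "complex \<Rightarrow> complex set" where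
  "qfield \<alpha> = {quad a b c \<alpha> | a b c. True}"

lemma qfieldE: assumes "x \<in> qfield \<alpha>" obtains a b c where "x = quad a b c \<alpha>"
  using assms by (auto simp: qfield_def)

lemma qfieldI: "quad a b c \<alpha> \<in> qfield \<alpha>" by (auto simp: qfield_def)

lemma qfield_add: "x \<in> qfield \<alpha> \<Longrightarrow> y \<in> qfield \<alpha> \<Longrightarrow> x + y \<in> qfield \<alpha>"
  by (auto elim!: qfieldE simp: quad_add intro: qfieldI)

lemma qfield_diff: "x \<in> qfield \<alpha> \<Longrightarrow> y \<in> qfield \<alpha> \<Longrightarrow> x - y \<in> qfield \<alpha>"
  by (auto elim!: qfieldE simp: quad_diff intro: qfieldI)

lemma qfield_scale: "x \<in> qfield \<alpha> \<Longrightarrow> of_rat s * x \<in> qfield \<alpha>"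
  by (auto elim!: qfieldE simp: quad_scale intro: qfieldI)

lemma qfield_of_rat: "of_rat s \<in> qfield \<alpha>"
  using qfieldI[of s 0 0 \<alpha>] by (simp add: quad_def)

lemma qfield_of_int: "of_int n \<in> qfield \<alpha>"
  using qfield_of_rat[of "of_int n" \<alpha>] by simp

lemma qfield_scale_int: "x \<in> qfield \<alpha> \<Longrightarrow> of_int s * x \<in> qfield \<alpha>"
  using qfield_scale[of x \<alpha> "of_int s"] by simp

lemma qfield_1: "1 \<in> qfield \<alpha>" and qfield_0: "0 \<in> qfield \<alpha>"
  using qfield_of_rat[of 1 \<alpha>] qfield_of_rat[of 0 \<alpha>] by simp_all

lemma qfield_gen: "\<alpha> \<in> qfield \<alpha>" "\<alpha>^2 \<in> qfield \<alpha>"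
  using qfieldI[of 0 1 0 \<alpha>] qfieldI[of 0 0 1 \<alpha>] by (simp_all add: quad_def)

lemma qfield_sum: "(\<And>i. i \<in> I \<Longrightarrow> f i \<in> qfield \<alpha>) \<Longrightarrow> (\<Sum>i\<in>I. f i) \<in> qfield \<alpha>"
  by (induction I rule: infinite_finite_induct) (auto intro: qfield_add qfield_0)

text \<open>
  Triples of complex numbers are transformed by rational matrices whose rows hold the coordinates
  of the new members.
\<close>

definition comb :: "rat^3 \<Rightarrow> complex^3 \<Rightarrow> complex" where
  "comb c w = (\<Sum>j\<in>UNIV. of_rat (c $ j) * w $ j)"

definition combm :: "rat^3^3 \<Rightarrow> complex^3 \<Rightarrow> complex^3" where
  "combm A w = (\<chi> j. comb (A $ j) w)"

definition ratm :: "rat^3^3 \<Rightarrow> complex^3^3" where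
  "ratm A = (\<chi> i j. of_rat (A $ i $ j))"

lemma det_ratm: "det (ratm A) = of_rat (det A)"
  by (simp add: det_3 ratm_def of_rat_add of_rat_diff of_rat_mult)

lemma comb_combm: "comb c (combm A w) = comb (c v* A) w"
proof -
  have "comb c (combm A w) = (\<Sum>j\<in>UNIV. \<Sum>k\<in>UNIV. of_rat (c $ j) * (of_rat (A $ j $ k) * w $ k))"
    by (simp add: comb_def combm_def sum_distrib_left)
  also have "\<dots> = (\<Sum>k\<in>UNIV. \<Sum>j\<in>UNIV. of_rat (c $ j) * (of_rat (A $ j $ k) * w $ k))"
    by (rule sum.swap)
  also have "\<dots> = comb (c v* A) w"
    by (simp add: comb_def vector_matrix_mult_def of_rat_sum of_rat_mult sum_distrib_left sum_distrib_right mult_ac)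
  finally show ?thesis .
qed

lemma combm_combm: "combm B (combm A w) = combm (B ** A) w"
  by (simp add: combm_def[of B] comb_combm) (simp add: combm_def vec_eq_iff comb_def 
      vector_matrix_mult_def matrix_matrix_mult_def mult.commute)

lemma combm_mat_1: "combm (mat 1) w = w"
  by (simp add: combm_def comb_def vec_eq_iff mat_def if_distrib[of of_rat] if_distrib[of "\<lambda>x. x * _"] cong: if_cong)

lemma quad_in_span: "quad a b c \<alpha> \<in> ratvs.span {1, \<alpha>, \<alpha>^2}"
proof -
  have "of_rat a * 1 + of_rat b * \<alpha> + of_rat c * \<alpha>^2 \<in> ratvs.span {1, \<alpha>, \<alpha>^2}"
    by (intro ratvs.span_add ratvs.span_scale ratvs.span_base) auto
  then show ?thesis by (simp add: quad_def)
qed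

lemma powers_independent:
  assumes quad_0: "\<And>a b c. quad a b c \<alpha> = 0 \<Longrightarrow> a = 0 \<and> b = 0 \<and> c = 0"
  shows "1 \<noteq> \<alpha>" "1 \<noteq> \<alpha>^2" "\<alpha> \<noteq> \<alpha>^2" "ratvs.independent {1, \<alpha>, \<alpha>^2}"
proof -
  show d: "1 \<noteq> \<alpha>" "1 \<noteq> \<alpha>^2" "\<alpha> \<noteq> \<alpha>^2"
    using quad_0[of 1 "-1" 0] quad_0[of 1 0 "-1"] quad_0[of 0 1 "-1"] by (auto simp: quad_def of_rat_minus)
  show "ratvs.independent {1, \<alpha>, \<alpha>^2}"
  proof (rule ratvs.independent_if_scalars_zero)
    fix f x assume 0: "(\<Sum>x\<in>{1, \<alpha>, \<alpha>\<^sup>2}. of_rat (f x) * x) = 0" and x: "x \<in> {1, \<alpha>, \<alpha>\<^sup>2}"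
    have "quad (f 1) (f \<alpha>) (f (\<alpha>^2)) \<alpha> = 0" using 0 d by (simp add: quad_def add.assoc)
    then show "f x = 0" using quad_0 x by auto
  qed simp
qed

lemma irrational_linear_relation:
  assumes "\<alpha> \<notin> \<rat>" "of_rat x + of_rat y * \<alpha> = (0 :: complex)"
  shows "x = 0 \<and> y = 0"
proof (cases "y = 0")
  case True
  then show ?thesis using assms(2) by simp
next
  case False
  then have "\<alpha> = of_rat (- x / y)" using assms(2)
    by (simp add: of_rat_divide of_rat_minus field_simps add_eq_0_iff)
  then show ?thesis using assms(1) by simp
qed

lemma quad_0_square:
  assumes "quad a b c \<alpha> = 0" "c \<noteq> 0"
  shows "\<alpha>^2 = of_rat (- a / c) + of_rat (- b / c) * \<alpha>"
  using assms by (simp add: quad_def of_rat_divide of_rat_minus field_simps) (simp add: add_eq_0_iff)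

text \<open>
  A cubic field with an integral generator, given together with the roots of the minimal
  polynomial of the generator. The assumption \<open>quad_0\<close> says that the degree is 3, that is,
  the polynomial is irreducible.
\<close>

locale cubic_gen =
  fixes \<alpha> :: complex and p q r :: int and \<rho> :: "complex^3"
  assumes gen: "\<alpha>^3 + of_int p * \<alpha>^2 + of_int q * \<alpha> + of_int r = 0"
    and quad_0: "\<And>a b c. quad a b c \<alpha> = 0 \<Longrightarrow> a = 0 \<and> b = 0 \<and> c = 0"
    and roots: "\<And>x. x^3 + of_int p * x^2 + of_int q * x + of_int r = (x - \<rho>$1) * (x - \<rho>$2) * (x - \<rho>$3)"
begin

abbreviation "K \<equiv> qfield \<alpha>"

lemma quad_inj: "quad a b c \<alpha> = quad a' b' c' \<alpha> \<longleftrightarrow> a = a' \<and> b = b' \<and> c = c'"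
  using quad_0[of "a - a'" "b - b'" "c - c'"] by (auto simp: quad_diff[symmetric])

lemma root: "(\<rho>$i)^3 + of_int p * (\<rho>$i)^2 + of_int q * \<rho>$i + of_int r = 0"
  unfolding roots using exhaust_3[of i] by auto

lemma K_mult: "x \<in> K \<Longrightarrow> y \<in> K \<Longrightarrow> x * y \<in> K"
  by (auto elim!: qfieldE simp: quad_mult[OF gen] intro: qfieldI)

lemma K_power: "x \<in> K \<Longrightarrow> x ^ n \<in> K"
  by (induction n) (auto intro: K_mult qfield_1)

definition emb :: "complex \<Rightarrow> complex \<Rightarrow> complex" where
  "emb t x = (THE v. \<exists>a b c. x = quad a b c \<alpha> \<and> v = quad a b c t)"

lemma emb_quad: "emb t (quad a b c \<alpha>) = quad a b c t"
  unfolding emb_def by (rule the_equality) (auto simp: quad_inj)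

lemma emb_add: "x \<in> K \<Longrightarrow> y \<in> K \<Longrightarrow> emb t (x + y) = emb t x + emb t y"
  by (auto elim!: qfieldE simp: quad_add emb_quad)

lemma emb_diff: "x \<in> K \<Longrightarrow> y \<in> K \<Longrightarrow> emb t (x - y) = emb t x - emb t y"
  by (auto elim!: qfieldE simp: quad_diff emb_quad)

lemma emb_scale: "x \<in> K \<Longrightarrow> emb t (of_rat s * x) = of_rat s * emb t x"
  by (auto elim!: qfieldE simp: quad_scale emb_quad)

lemma emb_of_rat: "emb t (of_rat s) = of_rat s"
  using emb_quad[of t s 0 0] by (simp add: quad_def)

lemma emb_of_int: "emb t (of_int s) = of_int s"
  using emb_of_rat[of t "of_int s"] by simp

lemma emb_1: "emb t 1 = 1" and emb_0: "emb t 0 = 0"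
  using emb_of_rat[of t 1] emb_of_rat[of t 0] by simp_all

lemma emb_gen: "emb t \<alpha> = t" "emb t (\<alpha>^2) = t^2"
  using emb_quad[of t 0 1 0] emb_quad[of t 0 0 1] by (simp_all add: quad_def)

lemma emb_sum: "(\<And>i. i \<in> I \<Longrightarrow> f i \<in> K) \<Longrightarrow> emb t (\<Sum>i\<in>I. f i) = (\<Sum>i\<in>I. emb t (f i))"
  by (induction I rule: infinite_finite_induct) (auto simp: emb_0 emb_add qfield_sum)

lemma emb_mult: "x \<in> K \<Longrightarrow> y \<in> K \<Longrightarrow> emb (\<rho>$i) (x * y) = emb (\<rho>$i) x * emb (\<rho>$i) y"
  by (auto elim!: qfieldE simp: quad_mult[OF gen] quad_mult[OF root] emb_quad)

lemma emb_poly: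
  assumes "x \<in> K"
  shows "poly (map_poly of_int P) x \<in> K"
    "emb (\<rho>$i) (poly (map_poly of_int P) x) = poly (map_poly of_int P) (emb (\<rho>$i) x)"
proof (induction P)
  case 0
  { case 1 then show ?case by (simp add: qfield_0) }
  { case 2 then show ?case by (simp add: emb_0) }
next
  case (pCons a P)
  { case 1 then show ?case using pCons by (simp add: map_poly_pCons qfield_add K_mult assms qfield_of_int) }
  { case 2 then show ?case using pCons 
      by (simp add: map_poly_pCons emb_add emb_mult qfield_add K_mult assms qfield_of_int emb_of_int) }
qed

lemma emb_algebraic_int:
  assumes "x \<in> K" "algebraic_int x"
  shows "algebraic_int (emb (\<rho>$i) x)"
proof -
  obtain P where P: "poly (map_poly of_int P) x = 0" "lead_coeff P = (1::int)"
    using assms(2) unfolding algebraic_int_altdef_ipoly by blast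
  have "poly (map_poly of_int P) (emb (\<rho>$i) x) = 0"
    using emb_poly(2)[OF assms(1), of i P] P(1) by (simp add: emb_0)
  then show ?thesis using P(2) unfolding algebraic_int_altdef_ipoly by blast
qed

text \<open>
  A rational root would split off a linear factor, and the cofactor would be a quadratic relation
  for the generator.
\<close>

lemma no_rational_root:
  "(of_rat s :: complex)^3 + of_int p * of_rat s^2 + of_int q * of_rat s + of_int r \<noteq> 0"
proof
  assume 0: "(of_rat s :: complex)^3 + of_int p * of_rat s^2 + of_int q * of_rat s + of_int r = 0"
  have "quad (-s) 1 0 \<alpha> * quad (s^2 + of_int p * s + of_int q) (of_int p + s) 1 \<alpha> = 
      (\<alpha>^3 + of_int p * \<alpha>^2 + of_int q * \<alpha> + of_int r) 
      - ((of_rat s :: complex)^3 + of_int p * of_rat s^2 + of_int q * of_rat s + of_int r)"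
    unfolding quad_def
    by (simp add: of_rat_add of_rat_mult of_rat_power of_rat_minus algebra_simps power2_eq_square power3_eq_cube)
  also have "\<dots> = 0" using 0 gen by simp
  finally show False using quad_0[of "-s" 1 0] quad_0[of "s^2 + of_int p * s + of_int q" "of_int p + s" 1]
    by auto
qed

lemma root_ne_of_rat: "\<rho>$i \<noteq> of_rat s"
  using root[of i] no_rational_root[of s] by auto

lemma vieta:
  "\<rho>$1 + \<rho>$2 + \<rho>$3 = - of_int p"
  "\<rho>$1 * \<rho>$2 + \<rho>$1 * \<rho>$3 + \<rho>$2 * \<rho>$3 = of_int q"
  "\<rho>$1 * \<rho>$2 * \<rho>$3 = - of_int r"
proof -
  show r: "\<rho>$1 * \<rho>$2 * \<rho>$3 = - of_int r" 
  proof -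
    have "of_int r = - (\<rho>$1 * \<rho>$2 * \<rho>$3)" using roots[of 0] by simp
    then show ?thesis by simp
  qed
  have a: "1 + of_int p + of_int q + of_int r = (1 - \<rho>$1) * (1 - \<rho>$2) * (1 - \<rho>$3)"
    using roots[of 1] by simp
  have b: "- 1 + of_int p - of_int q + of_int r = (- 1 - \<rho>$1) * (- 1 - \<rho>$2) * (- 1 - \<rho>$3)"
    using roots[of "-1"] by simp
  have "2 * (\<rho>$1 + \<rho>$2 + \<rho>$3) = 2 * (- of_int p :: complex)" 
    using a b r by (simp add: algebra_simps) Groebner_Basis.algebra
  then show "\<rho>$1 + \<rho>$2 + \<rho>$3 = - of_int p" by (metis mult_left_cancel zero_neq_numeral)
  have "2 * (\<rho>$1 * \<rho>$2 + \<rho>$1 * \<rho>$3 + \<rho>$2 * \<rho>$3) = 2 * (of_int q :: complex)"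
    using a b r by (simp add: algebra_simps) Groebner_Basis.algebra
  then show "\<rho>$1 * \<rho>$2 + \<rho>$1 * \<rho>$3 + \<rho>$2 * \<rho>$3 = of_int q" by (metis mult_left_cancel zero_neq_numeral)
qed

text \<open>
  A repeated root of a rational cubic is a rational function of the coefficients, so an
  irreducible cubic has three distinct roots.
\<close>

lemma double_root_rational:
  fixes s t :: complex
  assumes "2 * s + t = - of_int p" "s^2 + 2 * s * t = of_int q" "s^2 * t = - of_int r"
  shows "\<exists>u. s = of_rat u"
proof (cases "s = t")
  case True
  then have "s = of_rat (- of_int p / 3)" using assms(1)
    by (simp add: of_rat_divide of_rat_minus field_simps)
  then show ?thesis by blast
next
  case False
  have d: "of_int (p^2 - 3 * q) = (s - t)^2"
    unfolding of_int_diff of_int_power of_int_mult assms(2)[symmetric] of_int_numeral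
    using assms(1) by Groebner_Basis.algebra
  have n: "of_int (9 * r - p * q) = 2 * s * (s - t)^2"
  proof -
    have "of_int (9 * r - p * q) = 9 * (of_int r::complex) - of_int p * of_int q" by simp
    also have "of_int r = - (s^2 * t)" using assms(3) by simp
    also have "of_int p = - (2 * s + t)" using assms(1) by simp
    also note assms(2)[symmetric]
    finally show ?thesis by (simp add: power2_eq_square algebra_simps)
  qed
  have "s = of_rat (of_int (9 * r - p * q) / (2 * of_int (p^2 - 3 * q)))"
    using False by (simp only: of_rat_divide of_rat_mult of_rat_of_int_eq d n) simp
  then show ?thesis by blast
qed

lemma roots_distinct: "\<rho>$1 \<noteq> \<rho>$2" "\<rho>$1 \<noteq> \<rho>$3" "\<rho>$2 \<noteq> \<rho>$3"
proof -
  have *: "s \<noteq> \<rho>$i" if "2 * s + t = - of_int p" "s^2 + 2 * s * t = of_int q" "s^2 * t = - of_int r" for s t i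
    using double_root_rational[OF that] root_ne_of_rat[of i] by metis
  show "\<rho>$1 \<noteq> \<rho>$2"
    using vieta *[of "\<rho>$1" "\<rho>$3" 2] by (auto simp: power2_eq_square algebra_simps)
  show "\<rho>$1 \<noteq> \<rho>$3"
    using vieta *[of "\<rho>$1" "\<rho>$2" 3] by (auto simp: power2_eq_square algebra_simps)
  show "\<rho>$2 \<noteq> \<rho>$3"
    using vieta *[of "\<rho>$2" "\<rho>$1" 3] by (auto simp: power2_eq_square algebra_simps)
qed

definition tr :: "complex \<Rightarrow> complex" where "tr x = (\<Sum>i\<in>UNIV. emb (\<rho>$i) x)"

text \<open>
  Column \<open>j\<close> consists of the conjugates of the \<open>j\<close>-th member. Rational changes of basis act on
  this matrix from the right, and multiplied by its transpose from the left it gives the matrix of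
  the trace form.
  Thus the discriminant is the square of its determinant.
\<close>

definition embm :: "complex^3 \<Rightarrow> complex^3^3" where
  "embm w = (\<chi> i j. emb (\<rho>$i) (w$j))"

definition inK :: "complex^3 \<Rightarrow> bool" where "inK w \<longleftrightarrow> (\<forall>j. w$j \<in> K)"

definition disc :: "complex^3 \<Rightarrow> complex" where "disc w = det (embm w) ^ 2"

definition E :: "complex^3" where "E = vector [1, \<alpha>, \<alpha>^2]"

lemma comb_E: "comb c E = quad (c$1) (c$2) (c$3) \<alpha>"
  by (simp add: comb_def E_def sum_3 quad_def)

lemma comb_K: "inK w \<Longrightarrow> comb c w \<in> K"
  by (auto simp: comb_def inK_def intro!: qfield_sum qfield_scale)

lemma inK_E: "inK E"
  by (simp add: inK_def forall_3 E_def qfield_1 qfield_gen)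

lemma emb_comb: "inK w \<Longrightarrow> emb t (comb c w) = (\<Sum>j\<in>UNIV. of_rat (c$j) * emb t (w$j))"
  by (simp add: comb_def emb_sum inK_def qfield_scale emb_scale)

lemma embm_combm: "inK w \<Longrightarrow> embm (combm A w) = embm w ** transpose (ratm A)"
  by (simp add: vec_eq_iff embm_def combm_def emb_comb matrix_matrix_mult_def transpose_def ratm_def mult_ac)

lemma det_combm: "inK w \<Longrightarrow> det (embm (combm A w)) = of_rat (det A) * det (embm w)"
  by (simp add: embm_combm Determinants.det_mul Determinants.det_transpose det_ratm mult.commute)

lemma disc_combm: "inK w \<Longrightarrow> disc (combm A w) = of_rat (det A)^2 * disc w"
  by (simp add: disc_def det_combm power_mult_distrib)

lemma det_E: "det (embm E) = (\<rho>$2 - \<rho>$1) * (\<rho>$3 - \<rho>$1) * (\<rho>$3 - \<rho>$2)"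
  by (simp add: det_3 embm_def E_def emb_1 emb_gen) (simp add: power2_eq_square algebra_simps)

lemma det_E_nonzero: "det (embm E) \<noteq> 0"
  using roots_distinct by (auto simp: det_E)

lemma K_comb_E: assumes "x \<in> K" obtains c where "x = comb c E"
proof -
  obtain a b c where "x = quad a b c \<alpha>" using assms by (rule qfieldE)
  then have "x = comb (vector [a,b,c]) E" by (simp add: comb_E)
  then show ?thesis by (rule that)
qed

lemma inK_combm_E: assumes "inK w" obtains A where "w = combm A E"
proof -
  have "\<exists>c. w$j = comb c E" for j using assms K_comb_E[of "w$j"] by (auto simp: inK_def)
  then obtain c where "\<And>j. w$j = comb (c j) E" by metis
  then have "w = combm (\<chi> j. c j) E" by (simp add: vec_eq_iff combm_def)
  then show ?thesis by (rule that)
qed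

lemma basis_spans:
  assumes w: "inK w" "det (embm w) \<noteq> 0" and x: "x \<in> K"
  obtains c where "x = comb c w"
proof -
  obtain A where A: "w = combm A E" using inK_combm_E[OF w(1)] .
  have "det A \<noteq> 0" using w(2) unfolding A by (auto simp: det_combm inK_E)
  then obtain B where B: "B ** A = mat 1" using invertible_det_nz[of A] by (auto simp: invertible_def)
  have E: "E = combm B w" unfolding A combm_combm B combm_mat_1 ..
  obtain c where "x = comb c E" using K_comb_E[OF x] .
  then have "x = comb (c v* B) w" unfolding E comb_combm .
  then show ?thesis by (rule that)
qed

lemma spanning_det_nonzero:
  assumes w: "inK w" and sp: "\<And>x. x \<in> K \<Longrightarrow> \<exists>c. x = comb c w"
  shows "det (embm w) \<noteq> 0"
proof -
  have "\<exists>c. E$j = comb c w" for j using sp inK_E by (auto simp: inK_def)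
  then obtain c where "\<And>j. E$j = comb (c j) w" by metis
  then have "E = combm (\<chi> j. c j) w" by (simp add: vec_eq_iff combm_def)
  then have "det (embm E) = of_rat (det (\<chi> j. c j)) * det (embm w)" using det_combm[OF w] by simp
  then show ?thesis using det_E_nonzero by auto
qed

text \<open>
  The matrix of conjugates diagonalises multiplication by \<open>x\<close>, so the trace of the multiplication
  is the sum of the conjugates, whatever the basis.
\<close>

lemma trace_matrix:
  assumes w: "inK w" "det (embm w) \<noteq> 0" and x: "x \<in> K"
    and M: "\<And>j. x * w$j = comb (M$j) w"
  shows "tr x = of_rat (\<Sum>j\<in>UNIV. M$j$j)"
proof -
  define S where "S = embm w"
  \<comment> \<open>the diagonal matrix of the conjugates of \<open>x\<close>\<close>
  define Dg where "Dg = (\<chi> i j. if i = j then emb (\<rho>$i) x else 0)"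
  obtain S' where S': "S ** S' = mat 1" "S' ** S = mat 1"
    using w(2) invertible_det_nz[of S] by (auto simp: S_def invertible_def)
  have "Dg ** S = S ** transpose (ratm M)"
  proof -
    have "(Dg ** S) $ i $ j = (S ** transpose (ratm M)) $ i $ j" for i j
    proof -
      have "(Dg ** S) $ i $ j = emb (\<rho>$i) x * emb (\<rho>$i) (w$j)"
        by (simp add: Dg_def S_def matrix_matrix_mult_def embm_def if_distrib[of "\<lambda>x. x * _"] cong: if_cong)
      also have "\<dots> = emb (\<rho>$i) (comb (M$j) w)"
        using emb_mult[OF x, of "w$j" i] w(1) by (simp add: M[symmetric] inK_def)
      also have "\<dots> = (S ** transpose (ratm M)) $ i $ j"
        by (simp add: emb_comb w S_def matrix_matrix_mult_def embm_def transpose_def ratm_def mult_ac)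
      finally show ?thesis .
    qed
    then show ?thesis by (simp add: vec_eq_iff)
  qed
  then have "S' ** (Dg ** S) = transpose (ratm M)" by (simp add: matrix_mul_assoc S')
  then have "trace (transpose (ratm M)) = trace (S' ** (Dg ** S))" by simp
  also have "\<dots> = trace (Dg ** (S ** S'))" by (subst trace_mul_sym) (simp add: matrix_mul_assoc)
  also have "\<dots> = tr x" by (simp add: S' trace_def Dg_def tr_def)
  finally show ?thesis by (simp add: trace_def transpose_def ratm_def of_rat_sum)
qed

lemma trace_form: "inK w \<Longrightarrow> (\<chi> i j. tr (w$i * w$j)) = transpose (embm w) ** embm w"
  by (simp add: vec_eq_iff tr_def matrix_matrix_mult_def transpose_def embm_def emb_mult inK_def)

lemma disc_trace: "inK w \<Longrightarrow> disc w = det (\<chi> i j. tr (w$i * w$j))"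
  by (simp add: trace_form Determinants.det_mul Determinants.det_transpose disc_def power2_eq_square)

lemma K_subspace: "ratvs.subspace K"
  by (auto simp: ratvs.subspace_def qfield_0 qfield_add qfield_scale)

lemma span_E: "ratvs.span {1, \<alpha>, \<alpha>^2} = K"
proof (rule ratvs.span_subspace)
  show "{1, \<alpha>, \<alpha>^2} \<subseteq> K" by (simp add: qfield_1 qfield_gen)
  show "ratvs.subspace K" by (rule K_subspace)
  show "K \<subseteq> ratvs.span {1, \<alpha>, \<alpha>^2}" by (auto elim!: qfieldE intro: quad_in_span)
qed

lemmas E_distinct = powers_independent(1-3)[of \<alpha>, OF quad_0]
  and independent_E = powers_independent(4)[of \<alpha>, OF quad_0]

lemma dim_K: "ratvs.dim K = 3"
  using ratvs.dim_span_eq_card_independent[OF independent_E] E_distinct by (simp add: span_E)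

lemma field_trace_eq:
  assumes x: "x \<in> K"
  shows "of_rat (field_trace K x) = tr x"
proof -
  define B where "B = (SOME B. ratvs.independent B \<and> ratvs.span B = K)"
  have B: "ratvs.independent B \<and> ratvs.span B = K"
    unfolding B_def by (rule someI[of _ "{1, \<alpha>, \<alpha>^2}"]) (simp add: independent_E span_E)
  have "card B = 3" using ratvs.dim_span_eq_card_independent[of B] B dim_K by simp
  then obtain u v w where uvw: "B = {u,v,w}" "u \<noteq> v" "v \<noteq> w" "u \<noteq> w" by (auto simp: card_3_iff)
  define W where "W = (vector [u,v,w] :: complex^3)"
  have rep: "y = comb (vector [ratvs.representation B y u, ratvs.representation B y v, ratvs.representation B y w]) W"
    if "y \<in> K" for y
  proof -
    have "y = (\<Sum>b\<in>B. of_rat (ratvs.representation B y b) * b)"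
      using ratvs.sum_representation_eq[of B y B] B that uvw by auto
    then show ?thesis using uvw by (simp add: comb_def sum_3 W_def add.assoc)
  qed
  have "B \<subseteq> K" using B ratvs.span_superset by auto
  then have W: "inK W" by (simp add: inK_def forall_3 W_def uvw)
  have nz: "det (embm W) \<noteq> 0" by (rule spanning_det_nonzero[OF W]) (use rep in blast)
  define R where "R y = (vector [ratvs.representation B y u, ratvs.representation B y v, ratvs.representation B y w] :: rat^3)" for y
  have "tr x = of_rat (\<Sum>j\<in>UNIV. (\<chi> j. R (x * W$j)) $ j $ j)"
  proof (rule trace_matrix[OF W nz x])
    fix j
    have "x * W$j \<in> K" using W x by (simp add: inK_def K_mult)
    then show "x * W$j = comb ((\<chi> j. R (x * W$j)) $ j) W" using rep by (simp add: R_def)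
  qed
  also have "(\<Sum>j\<in>UNIV. (\<chi> j. R (x * W$j)) $ j $ j) = (\<Sum>b\<in>B. ratvs.representation B (x * b) b)"
    using uvw by (simp add: sum_3 R_def W_def add.assoc)
  also have "\<dots> = field_trace K x" by (simp add: field_trace_def B_def Let_def)
  finally show ?thesis by simp
qed

end

section \<open>Integral bases and binary cubic forms\<close>

text \<open>
  The discriminant of the binary cubic form \<open>a x\<^sup>3 + b x\<^sup>2 y + c x y\<^sup>2 + d y\<^sup>3\<close>.
\<close>

definition form_disc :: "int \<Rightarrow> int \<Rightarrow> int \<Rightarrow> int \<Rightarrow> int" where
  "form_disc a b c d = b^2 * c^2 - 4 * a * c^3 - 4 * b^3 * d - 27 * a^2 * d^2 + 18 * a * b * c * d"

lemma det_of_int_matrix: "det (\<chi> i j. of_int (A$i$j)) = (of_int (det (A :: int^3^3)) :: rat)"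
  by (simp add: det_3)

context cubic_gen
begin

abbreviation "\<O> \<equiv> ring_of_integers K"

definition inO :: "complex^3 \<Rightarrow> bool" where "inO w \<longleftrightarrow> (\<forall>j. w$j \<in> \<O>)"

lemma OD: "x \<in> \<O> \<Longrightarrow> x \<in> K" "x \<in> \<O> \<Longrightarrow> algebraic_int x"
  by (auto simp: ring_of_integers_def)

lemma inO_inK: "inO w \<Longrightarrow> inK w" by (simp add: inO_def inK_def OD)

lemma O_add: "x \<in> \<O> \<Longrightarrow> y \<in> \<O> \<Longrightarrow> x + y \<in> \<O>"
  by (simp add: ring_of_integers_def qfield_add algebraic_int_plus)

lemma O_diff: "x \<in> \<O> \<Longrightarrow> y \<in> \<O> \<Longrightarrow> x - y \<in> \<O>"
  by (simp add: ring_of_integers_def qfield_diff algebraic_int_diff)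

lemma O_mult: "x \<in> \<O> \<Longrightarrow> y \<in> \<O> \<Longrightarrow> x * y \<in> \<O>"
  by (simp add: ring_of_integers_def K_mult algebraic_int_times)

lemma O_of_int: "of_int n \<in> \<O>"
  by (simp add: ring_of_integers_def qfield_of_int algebraic_int_of_int)

lemma O_1: "1 \<in> \<O>" using O_of_int[of 1] by simp

lemma O_power: "x \<in> \<O> \<Longrightarrow> x ^ n \<in> \<O>"
  by (induction n) (auto intro: O_mult O_1)

lemma O_gen: "\<alpha> \<in> \<O>"
  using algebraic_int_cubic[OF gen] qfield_gen by (simp add: ring_of_integers_def)

lemma inO_E: "inO E"
  by (simp add: inO_def forall_3 E_def O_1 O_gen O_power)

lemma tr_add: "x \<in> K \<Longrightarrow> y \<in> K \<Longrightarrow> tr (x + y) = tr x + tr y"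
  by (simp add: tr_def emb_add sum.distrib)

lemma tr_scale: "x \<in> K \<Longrightarrow> tr (of_int n * x) = of_int n * tr x"
  using emb_scale[of x _ "of_int n"] by (simp add: tr_def sum_distrib_left)

lemma tr_of_int: "tr (of_int n) = 3 * of_int n"
  by (simp add: tr_def emb_of_int)

text \<open>
  The trace is rational as a diagonal sum of a rational matrix, and an algebraic integer as a sum of conjugates.
\<close>

lemma tr_integer: assumes "x \<in> \<O>" shows "tr x \<in> \<int>"
proof -
  have "algebraic_int (tr x)" unfolding tr_def
    by (intro algebraic_int_sum emb_algebraic_int) (use assms OD in auto)
  then have "algebraic_int (of_rat (field_trace K x) :: complex)"
    using field_trace_eq[OF OD(1)[OF assms]] by simp
  then obtain n where "field_trace K x = of_int n" by (rule algebraic_int_of_rat)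
  then show ?thesis using field_trace_eq[OF OD(1)[OF assms]] by (metis Ints_of_int of_rat_of_int_eq)
qed

lemma disc_integer: assumes "inO w" shows "disc w \<in> \<int>"
proof -
  have *: "tr (w$i * w$j) \<in> \<int>" for i j
    using assms by (intro tr_integer O_mult) (auto simp: inO_def)
  show ?thesis unfolding disc_trace[OF inO_inK[OF assms]]
    by (auto simp: det_3 intro!: Ints_diff Ints_add Ints_mult *)
qed

lemma emb_comb_0:
  assumes w: "inK w" "det (embm w) \<noteq> 0" and 0: "\<And>i. emb (\<rho>$i) (comb c w) = 0"
  shows "c = 0"
proof -
  define v :: "complex^3" where "v = (\<chi> j. of_rat (c$j))"
  obtain S' where S': "S' ** embm w = mat 1"
    using w(2) invertible_det_nz[of "embm w"] by (auto simp: invertible_def)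
  have "(embm w *v v) $ i = 0" for i
    using emb_comb[OF w(1), of "\<rho>$i" c] 0[of i]
    by (simp add: matrix_vector_mult_def embm_def v_def mult.commute)
  then have "embm w *v v = 0" by (simp add: vec_eq_iff)
  then have "S' *v (embm w *v v) = 0" by simp
  then have "v = 0" by (simp add: matrix_vector_mul_assoc S')
  then show ?thesis by (simp add: v_def vec_eq_iff)
qed

lemma comb_0:
  assumes "inK w" "det (embm w) \<noteq> 0" "comb c w = 0"
  shows "c = 0"
  using emb_comb_0[OF assms(1,2), of c] assms(3) by (simp add: emb_0)

lemma emb_0_imp_0:
  assumes "x \<in> K" "\<And>i. emb (\<rho>$i) x = 0"
  shows "x = 0"
proof -
  obtain c where c: "x = comb c E" using K_comb_E[OF assms(1)] .
  then have "c = 0" using emb_comb_0[OF inK_E det_E_nonzero] assms(2) by simp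
  then show ?thesis by (simp add: c comb_def)
qed

text \<open>
  Among the triples of integers of the field beginning with 1 and linearly independent over the
  rationals, one whose discriminant has least absolute value is an integral basis: a non-integral
  coordinate of an integer of the field could be replaced by its fractional part, which would
  shrink the discriminant.
\<close>

lemma integral_basis_1_exists:
  obtains w where "w$1 = 1" "inO w" "det (embm w) \<noteq> 0"
    "\<And>x. x \<in> \<O> \<Longrightarrow> \<exists>k l m::int. x = of_int k + of_int l * w$2 + of_int m * w$3"
proof -
  define P where "P w \<longleftrightarrow> w$1 = 1 \<and> inO w \<and> det (embm w) \<noteq> 0" for w
  define m where "m w = nat \<lfloor>cmod (disc w)\<rfloor>" for w
  have "P E" by (simp add: P_def inO_E det_E_nonzero) (simp add: E_def)
  then obtain w where w: "P w" "\<And>v. P v \<Longrightarrow> m w \<le> m v"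
    using ex_has_least_nat[of P E m] by blast
  have wK: "inK w" using w(1) inO_inK by (simp add: P_def)
  have frac0: "c$k \<in> \<int>" if x: "x \<in> \<O>" "x = comb c w" and k: "k = 2 \<or> k = 3" for x c k
  proof (rule ccontr)
    assume nZ: "c$k \<notin> \<int>"
    define A :: "rat^3^3" where
      "A = (\<chi> i j. if i = k then c$j - (if j = k then of_int \<lfloor>c$k\<rfloor> else 0) else if i = j then 1 else 0)"
    have detA: "det A = frac (c$k)"
      using k by (auto simp: det_3 A_def frac_def)
    have f: "0 < frac (c$k)" "frac (c$k) < 1" using nZ by (simp_all add: frac_gt_0_iff frac_lt_1)
    have f2: "frac (c$k) ^ 2 < 1" using f by (simp add: abs_square_less_1)
    have other: "combm A w $ i = w$i" if "i \<noteq> k" for i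
      using that by (simp add: combm_def comb_def A_def if_distrib[of of_rat] if_distrib[of "\<lambda>x. x * _"] cong: if_cong)
    have kth: "combm A w $ k = x - of_int \<lfloor>c$k\<rfloor> * w$k"
      unfolding x(2) by (simp add: combm_def comb_def A_def of_rat_diff left_diff_distrib sum_subtractf
          if_distrib[of of_rat] if_distrib[of "\<lambda>x. x * _"] cong: if_cong)
    have "combm A w $ i \<in> \<O>" for i
      using w(1) other[of i] kth x(1) by (cases "i = k") (auto simp: P_def inO_def intro!: O_diff O_mult O_of_int)
    moreover have "det (embm (combm A w)) \<noteq> 0"
      using f w(1) by (simp add: det_combm wK detA P_def)
    ultimately have PA: "P (combm A w)" using other[of 1] k w(1) by (auto simp: P_def inO_def)
    obtain n where n: "disc w = of_int n" using disc_integer w(1) by (auto simp: P_def elim: Ints_cases)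
    obtain n' where n': "disc (combm A w) = of_int n'" using disc_integer PA by (auto simp: P_def elim: Ints_cases)
    have "disc w \<noteq> 0" using w(1) by (simp add: P_def disc_def)
    then have n0: "n \<noteq> 0" using n by auto
    have "of_rat (of_int n') = (of_rat (frac (c$k) ^ 2 * of_int n) :: complex)"
      using disc_combm[OF wK, of A] n n' by (simp add: detA of_rat_mult of_rat_power)
    then have "(of_int n' :: rat) = frac (c$k) ^ 2 * of_int n" by (simp only: of_rat_eq_iff)
    then have "\<bar>of_int n' :: rat\<bar> = frac (c$k)^2 * \<bar>of_int n\<bar>" by (simp add: abs_mult)
    also have "\<dots> < 1 * \<bar>of_int n\<bar>"
      using f2 n0 by (intro mult_strict_right_mono) auto
    finally have "\<bar>n'\<bar> < \<bar>n\<bar>" by linarith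
    moreover have "m w = nat \<bar>n\<bar>" "m (combm A w) = nat \<bar>n'\<bar>"
      unfolding m_def n n' norm_of_int by (simp_all flip: of_int_abs)
    ultimately show False using w(2)[OF PA] by auto
  qed
  show ?thesis
  proof (rule that[of w])
    show "w$1 = 1" "inO w" "det (embm w) \<noteq> 0" using w(1) by (auto simp: P_def)
    fix x assume x: "x \<in> \<O>"
    obtain c where c: "x = comb c w" using basis_spans[OF wK _ OD(1)[OF x]] w(1) by (auto simp: P_def)
    obtain l m where lm: "c$2 = of_int l" "c$3 = of_int m"
      using frac0[OF x c] by (metis Ints_cases)
    have xc: "x = of_rat (c$1) + of_int l * w$2 + of_int m * w$3"
      unfolding c comb_def using lm w(1) by (simp add: sum_3 P_def)
    then have "of_rat (c$1) = x - of_int l * w$2 - of_int m * w$3" by simp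
    also have "\<dots> \<in> \<O>" using w(1) x by (intro O_diff O_mult O_of_int) (auto simp: P_def inO_def)
    finally obtain k where "c$1 = of_int k" using algebraic_int_of_rat OD(2) by blast
    then show "\<exists>k l m::int. x = of_int k + of_int l * w$2 + of_int m * w$3"
      using xc by (metis of_rat_of_int_eq)
  qed
qed

definition bas :: "complex \<Rightarrow> complex \<Rightarrow> complex^3" where "bas \<omega> \<theta> = vector [1, \<omega>, \<theta>]"

text \<open>
  The correspondence of Delone and Faddeev: \<open>1, \<omega>, \<theta>\<close> is an integral basis whose
  multiplication table is described by a binary cubic form. Changes of basis become substitutions
  in the form, and the form has the discriminant of the field.
\<close>

definition form_basis :: "complex \<Rightarrow> complex \<Rightarrow> int \<Rightarrow> int \<Rightarrow> int \<Rightarrow> int \<Rightarrow> bool" where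
  "form_basis \<omega> \<theta> a b c d \<longleftrightarrow> \<omega> \<in> \<O> \<and> \<theta> \<in> \<O> \<and> det (embm (bas \<omega> \<theta>)) \<noteq> 0 \<and>
     (\<forall>x\<in>\<O>. \<exists>k l m::int. x = of_int k + of_int l * \<omega> + of_int m * \<theta>) \<and>
     \<omega> * \<theta> = - of_int (a * d) \<and>
     \<omega>^2 = - of_int (a * c) - of_int b * \<omega> + of_int a * \<theta> \<and>
     \<theta>^2 = - of_int (b * d) - of_int d * \<omega> + of_int c * \<theta>"

lemma inK_bas: "\<omega> \<in> K \<Longrightarrow> \<theta> \<in> K \<Longrightarrow> inK (bas \<omega> \<theta>)"
  by (simp add: inK_def forall_3 bas_def qfield_1)

lemma bas_0:
  assumes "\<omega> \<in> K" "\<theta> \<in> K" "det (embm (bas \<omega> \<theta>)) \<noteq> 0"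
    "of_rat k + of_rat l * \<omega> + of_rat m * \<theta> = 0"
  shows "k = 0 \<and> l = 0 \<and> m = 0"
proof -
  have "comb (vector [k,l,m]) (bas \<omega> \<theta>) = 0" using assms(4) by (simp add: comb_def sum_3 bas_def)
  then have "(vector [k,l,m] :: rat^3) = 0" using comb_0[OF inK_bas] assms by blast
  then show ?thesis by (simp add: vec_eq_iff forall_3)
qed

lemma bas_0_int:
  assumes "\<omega> \<in> K" "\<theta> \<in> K" "det (embm (bas \<omega> \<theta>)) \<noteq> 0"
    "of_int k + of_int l * \<omega> + of_int m * \<theta> = 0"
  shows "k = 0 \<and> l = 0 \<and> m = 0"
  using bas_0[OF assms(1-3), of "of_int k" "of_int l" "of_int m"] assms(4) by simp

lemma det_bas_translate:
  assumes "\<omega> \<in> K" "\<theta> \<in> K"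
  shows "det (embm (bas (\<omega> + of_int u) (\<theta> + of_int t * \<omega> + of_int v))) = det (embm (bas \<omega> \<theta>))"
proof -
  have tw: "of_int t * \<omega> \<in> K" using assms qfield_scale_int by auto
  have e: "emb s (of_int t * \<omega>) = of_int t * emb s \<omega>" for s using emb_scale[OF assms(1), of s "of_int t"] by simp
  show ?thesis
    by (simp add: det_3 embm_def bas_def emb_1 emb_add assms tw qfield_add qfield_of_int emb_of_int e)
      (simp add: algebra_simps)
qed

text \<open>
  Given any integral basis beginning with 1, integers can be subtracted from the other two members
  to make their product an integer.
\<close>

lemma form_basis_exists: obtains \<omega> \<theta> a b c d where "form_basis \<omega> \<theta> a b c d"
proof -
  obtain w where w: "w$1 = 1" "inO w" "det (embm w) \<noteq> 0"
    "\<And>x. x \<in> \<O> \<Longrightarrow> \<exists>k l m::int. x = of_int k + of_int l * w$2 + of_int m * w$3"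
    using integral_basis_1_exists by blast
  define \<omega>' \<theta>' where "\<omega>' = w$2" and "\<theta>' = w$3"
  have O': "\<omega>' \<in> \<O>" "\<theta>' \<in> \<O>" using w(2) by (auto simp: \<omega>'_def \<theta>'_def inO_def)
  have "w = bas \<omega>' \<theta>'" by (simp add: Finite_Cartesian_Product.vec_eq_iff forall_3 bas_def \<omega>'_def \<theta>'_def w)
  then have det': "det (embm (bas \<omega>' \<theta>')) \<noteq> 0" using w(3) by simp
  obtain e f g where efg: "\<omega>' * \<theta>' = of_int e + of_int f * \<omega>' + of_int g * \<theta>'"
    using w(4)[OF O_mult[OF O']] by (auto simp: \<omega>'_def \<theta>'_def)
  define \<omega> \<theta> where "\<omega> = \<omega>' - of_int g" and "\<theta> = \<theta>' - of_int f"
  have O: "\<omega> \<in> \<O>" "\<theta> \<in> \<O>" using O' by (auto simp: \<omega>_def \<theta>_def intro: O_diff O_of_int)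
  have det: "det (embm (bas \<omega> \<theta>)) \<noteq> 0"
    using det_bas_translate[OF OD(1)[OF O'(1)] OD(1)[OF O'(2)], of "-g" 0 "-f"] det' by (simp add: \<omega>_def \<theta>_def)
  have sp: "\<exists>k l m::int. x = of_int k + of_int l * \<omega> + of_int m * \<theta>" if "x \<in> \<O>" for x
  proof -
    obtain k l m where "x = of_int k + of_int l * \<omega>' + of_int m * \<theta>'" using w(4)[OF \<open>x \<in> \<O>\<close>] by (auto simp: \<omega>'_def \<theta>'_def)
    then have "x = of_int (k + l * g + m * f) + of_int l * \<omega> + of_int m * \<theta>"
      by (simp add: \<omega>_def \<theta>_def algebra_simps)
    then show ?thesis by blast
  qed
  define n where "n = e + f * g"
  have n: "\<omega> * \<theta> = of_int n" using efg by (simp add: \<omega>_def \<theta>_def n_def algebra_simps)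
  obtain m b a where ww: "\<omega>^2 = of_int m + of_int b * \<omega> + of_int a * \<theta>" using sp[OF O_power[OF O(1)]] by blast
  obtain l d c where tt: "\<theta>^2 = of_int l + of_int d * \<omega> + of_int c * \<theta>" using sp[OF O_power[OF O(2)]] by blast
  note z = bas_0_int[OF OD(1)[OF O(1)] OD(1)[OF O(2)] det]
  \<comment> \<open>The relations between the coefficients express that the multiplication is associative.\<close>
  have "\<omega>^2 * \<theta> = of_int n * \<omega>" using n by (simp add: power2_eq_square mult_ac)
  moreover have "\<omega>^2 * \<theta> = of_int m * \<theta> + of_int b * of_int n + of_int a * \<theta>^2"
    unfolding ww n[symmetric] by (simp add: algebra_simps power2_eq_square)
  ultimately have "of_int (b * n + a * l) + of_int (a * d - n) * \<omega> + of_int (m + a * c) * \<theta> = 0"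
    unfolding tt by (simp add: algebra_simps)
  from z[OF this] have 1: "a * d = n" "m = - (a * c)" by auto
  have "\<theta>^2 * \<omega> = of_int n * \<theta>" using n by (simp add: power2_eq_square mult_ac)
  moreover have "\<theta>^2 * \<omega> = of_int l * \<omega> + of_int d * \<omega>^2 + of_int c * of_int n"
    unfolding tt n[symmetric] by (simp add: algebra_simps power2_eq_square)
  ultimately have "of_int (d * m + c * n) + of_int (l + d * b) * \<omega> + of_int (d * a - n) * \<theta> = 0"
    unfolding ww by (simp add: algebra_simps)
  from z[OF this] have 2: "l = - (d * b)" by auto
  have "form_basis \<omega> \<theta> a (- b) c (- d)"
    unfolding form_basis_def using O det sp n ww tt 1 2 by (auto simp: mult_ac)
  then show ?thesis by (rule that)
qed

lemma form_basisD:
  assumes "form_basis \<omega> \<theta> a b c d"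
  shows "\<omega> \<in> \<O>" "\<theta> \<in> \<O>" "\<omega> \<in> K" "\<theta> \<in> K" "det (embm (bas \<omega> \<theta>)) \<noteq> 0"
    "\<And>x. x \<in> \<O> \<Longrightarrow> \<exists>k l m::int. x = of_int k + of_int l * \<omega> + of_int m * \<theta>"
    "\<omega> * \<theta> = - of_int (a * d)"
    "\<omega>^2 = - of_int (a * c) - of_int b * \<omega> + of_int a * \<theta>"
    "\<theta>^2 = - of_int (b * d) - of_int d * \<omega> + of_int c * \<theta>"
  using assms OD by (auto simp: form_basis_def)

text \<open>Exchanging \<open>\<omega>\<close> and \<open>\<theta>\<close> corresponds to \<open>F(x,y) \<mapsto> - F(y,x)\<close>.\<close>

lemma form_basis_swap:
  assumes F: "form_basis \<omega> \<theta> a b c d"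
  shows "form_basis \<theta> \<omega> (-d) (-c) (-b) (-a)"
proof -
  note D = form_basisD[OF F]
  have "det (embm (bas \<theta> \<omega>)) = - det (embm (bas \<omega> \<theta>))"
    by (simp add: det_3 embm_def bas_def algebra_simps)
  moreover have "\<exists>k l m::int. x = of_int k + of_int l * \<theta> + of_int m * \<omega>" if "x \<in> \<O>" for x
    using D(6)[OF that] by (metis add.assoc add.commute)
  ultimately show ?thesis using D by (auto simp: form_basis_def mult_ac)
qed

text \<open>This is the effect of the substitution \<open>F(x,y) \<mapsto> F(x + t y, y)\<close> on the basis.\<close>

lemma form_basis_translate:
  assumes F: "form_basis \<omega> \<theta> a b c d"
  shows "\<exists>\<omega>' \<theta>'. form_basis \<omega>' \<theta>' a (3*a*t + b) (3*a*t^2 + 2*b*t + c) (a*t^3 + b*t^2 + c*t + d)"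
proof -
  note D = form_basisD[OF F]
  define \<omega>' \<theta>' where "\<omega>' = \<omega> + of_int (- a * t)" and "\<theta>' = \<theta> + of_int t * \<omega> + of_int (a*t^2 + b*t)"
  have "\<omega>' \<in> \<O>" "\<theta>' \<in> \<O>" unfolding \<omega>'_def \<theta>'_def by (intro O_add O_mult O_of_int D(1,2))+
  moreover have "det (embm (bas \<omega>' \<theta>')) \<noteq> 0"
    unfolding \<omega>'_def \<theta>'_def det_bas_translate[OF D(3,4)] by (rule D)
  moreover have "\<exists>k l m::int. x = of_int k + of_int l * \<omega>' + of_int m * \<theta>'" if "x \<in> \<O>" for x
  proof -
    obtain k l m where "x = of_int k + of_int l * \<omega> + of_int m * \<theta>" using D(6)[OF \<open>x \<in> \<O>\<close>] by auto
    then have "x = of_int (k + (l - m * t) * (a * t) - m * (a*t^2 + b*t)) + of_int (l - m * t) * \<omega>' + of_int m * \<theta>'"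
      by (simp add: \<omega>'_def \<theta>'_def algebra_simps)
    then show ?thesis by blast
  qed
  moreover have "\<omega>' * \<theta>' = - of_int (a * (a*t^3 + b*t^2 + c*t + d))"
    unfolding \<omega>'_def \<theta>'_def of_int_mult of_int_add of_int_power of_int_minus
    using D(7-9) unfolding of_int_mult by Groebner_Basis.algebra
  moreover have "\<omega>'^2 = - of_int (a * (3*a*t^2 + 2*b*t + c)) - of_int (3*a*t + b) * \<omega>' + of_int a * \<theta>'"
    unfolding \<omega>'_def \<theta>'_def of_int_mult of_int_add of_int_power of_int_minus of_int_numeral
    using D(7-9) unfolding of_int_mult by Groebner_Basis.algebra
  moreover have "\<theta>'^2 = - of_int ((3*a*t + b) * (a*t^3 + b*t^2 + c*t + d)) - of_int (a*t^3 + b*t^2 + c*t + d) * \<omega>'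
      + of_int (3*a*t^2 + 2*b*t + c) * \<theta>'"
    unfolding \<omega>'_def \<theta>'_def of_int_mult of_int_add of_int_power of_int_minus of_int_numeral
    using D(7-9) unfolding of_int_mult by Groebner_Basis.algebra
  ultimately show ?thesis unfolding form_basis_def by blast
qed

text \<open>
  The entries of the trace form can be read off from the multiplication table.
\<close>

lemma form_basis_disc:
  assumes F: "form_basis \<omega> \<theta> a b c d"
  shows "disc (bas \<omega> \<theta>) = of_int (form_disc a b c d)"
proof -
  note D = form_basisD[OF F]
  have K: "inK (bas \<omega> \<theta>)" using inK_bas D by blast
  have vec: "comb (vector [k,l,m]) (bas \<omega> \<theta>) = of_rat k + of_rat l * \<omega> + of_rat m * \<theta>" for k l m
    by (simp add: comb_def sum_3 bas_def)
  have tw: "tr \<omega> = - of_int b"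
  proof -
    have "tr \<omega> = of_rat (\<Sum>j\<in>UNIV. (vector [vector [0,1,0], vector [- of_int (a*c), - of_int b, of_int a], vector [- of_int (a*d),0,0]] :: rat^3^3)$j$j)"
    proof (rule trace_matrix[OF K D(5) D(3)])
      fix j :: 3
      show "\<omega> * bas \<omega> \<theta> $ j = comb ((vector [vector [0,1,0], vector [- of_int (a*c), - of_int b, of_int a], vector [- of_int (a*d),0,0]] :: rat^3^3)$j) (bas \<omega> \<theta>)"
        using exhaust_3[of j] D(7,8) by (auto simp: vec of_rat_minus of_rat_mult) (auto simp: bas_def power2_eq_square)
    qed
    then show ?thesis by (simp add: sum_3 of_rat_minus)
  qed
  have tt: "tr \<theta> = of_int c"
  proof -
    have "tr \<theta> = of_rat (\<Sum>j\<in>UNIV. (vector [vector [0,0,1], vector [- of_int (a*d),0,0], vector [- of_int (b*d), - of_int d, of_int c]] :: rat^3^3)$j$j)"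
    proof (rule trace_matrix[OF K D(5) D(4)])
      fix j :: 3
      show "\<theta> * bas \<omega> \<theta> $ j = comb ((vector [vector [0,0,1], vector [- of_int (a*d),0,0], vector [- of_int (b*d), - of_int d, of_int c]] :: rat^3^3)$j) (bas \<omega> \<theta>)"
        using exhaust_3[of j] D(7,9) by (auto simp: vec of_rat_minus of_rat_mult) (auto simp: bas_def power2_eq_square mult.commute)
    qed
    then show ?thesis by (simp add: sum_3 of_rat_minus)
  qed
  have lin: "tr (of_int k + of_int l * \<omega> + of_int m * \<theta>) = 3 * of_int k - of_int l * of_int b + of_int m * of_int c" for k l m
    using D(3,4) by (simp add: tr_add tr_scale tr_of_int qfield_add qfield_scale_int qfield_of_int tw tt)
  have ww: "tr (\<omega> * \<omega>) = of_int (b^2 - 2 * a * c)"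
    using lin[of "- (a*c)" "-b" a] D(8) by (simp add: power2_eq_square)
  have t2: "tr (\<theta> * \<theta>) = of_int (c^2 - 2 * b * d)"
    using lin[of "- (b*d)" "-d" c] D(9) by (simp add: power2_eq_square)
  have wt: "tr (\<omega> * \<theta>) = of_int (- 3 * a * d)" "tr (\<theta> * \<omega>) = of_int (- 3 * a * d)"
    using lin[of "- (a*d)" 0 0] D(7) by (simp_all add: mult.commute)
  have t1: "tr 1 = 3" using tr_of_int[of 1] by simp
  show ?thesis unfolding disc_trace[OF K]
    by (simp add: det_3) (simp add: bas_def tw tt ww t2 wt t1 form_disc_def, simp add: algebra_simps power2_eq_square power3_eq_cube)
qed

lemma disc_cubic_disc_det:
  assumes "inK w"
  shows "of_int d = det (\<chi> i j. field_trace K (w$i * w$j)) \<longleftrightarrow> of_int d = disc w"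
proof -
  have "of_rat (det (\<chi> i j. field_trace K (w$i * w$j))) = det (ratm (\<chi> i j. field_trace K (w$i * w$j)))"
    by (simp add: det_ratm)
  also have "\<dots> = disc w"
    unfolding disc_trace[OF assms]
    by (rule arg_cong[of _ _ det]) (use assms in \<open>simp add: ratm_def Finite_Cartesian_Product.vec_eq_iff field_trace_eq K_mult inK_def\<close>)
  finally have "of_int d = disc w \<longleftrightarrow>
      (of_rat (of_int d) :: complex) = of_rat (det (\<chi> i j. field_trace K (w$i * w$j)))" by simp
  then show ?thesis by (simp only: of_rat_eq_iff)
qed

lemma integral_basis_form_basis:
  assumes F: "form_basis \<omega> \<theta> a b c d"
  shows "integral_basis K (bas \<omega> \<theta>)"
proof -
  note D = form_basisD[OF F]
  have e: "(\<Sum>i\<in>UNIV. of_int (x$i) * bas \<omega> \<theta> $ i) = of_int (x$1) + of_int (x$2) * \<omega> + of_int (x$3) * \<theta>" for x :: "int^3"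
    by (simp add: sum_3 bas_def)
  show ?thesis unfolding integral_basis_def e
  proof (rule bij_betwI')
    fix x y :: "int^3"
    show "(of_int (x$1) + of_int (x$2) * \<omega> + of_int (x$3) * \<theta> = of_int (y$1) + of_int (y$2) * \<omega> + of_int (y$3) * \<theta>) \<longleftrightarrow> x = y"
    proof
      assume "of_int (x$1) + of_int (x$2) * \<omega> + of_int (x$3) * \<theta> = of_int (y$1) + of_int (y$2) * \<omega> + of_int (y$3) * \<theta>"
      then have "of_int (x$1 - y$1) + of_int (x$2 - y$2) * \<omega> + of_int (x$3 - y$3) * \<theta> = 0" by (simp add: algebra_simps)
      from bas_0_int[OF D(3,4,5) this] show "x = y" by (simp add: Finite_Cartesian_Product.vec_eq_iff forall_3)
    qed simp
  next
    fix x :: "int^3"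
    show "of_int (x$1) + of_int (x$2) * \<omega> + of_int (x$3) * \<theta> \<in> \<O>"
      using D by (intro O_add O_mult O_of_int) auto
  next
    fix y assume "y \<in> \<O>"
    then obtain k l m where "y = of_int k + of_int l * \<omega> + of_int m * \<theta>" using D(6) by blast
    then show "\<exists>x\<in>(UNIV :: (int^3) set). y = of_int (x$1) + of_int (x$2) * \<omega> + of_int (x$3) * \<theta>"
      by (intro bexI[of _ "vector [k,l,m] :: int^3"]) auto
  qed
qed

lemma integral_basis_combm:
  assumes w: "integral_basis K w" and v: "inO v"
  obtains A :: "int^3^3" where "v = combm (\<chi> i j. of_int (A$i$j)) w"
proof -
  have "\<exists>c :: int^3. v$j = (\<Sum>i\<in>UNIV. of_int (c $ i) * w $ i)" for j
  proof -
    have "range (\<lambda>c :: int^3. \<Sum>i\<in>UNIV. of_int (c $ i) * w $ i) = \<O>"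
      using w by (simp add: integral_basis_def bij_betw_def)
    then have "v$j \<in> range (\<lambda>c :: int^3. \<Sum>i\<in>UNIV. of_int (c $ i) * w $ i)"
      using v by (simp add: inO_def)
    then show ?thesis by blast
  qed
  then obtain c where "\<And>j. v$j = (\<Sum>i\<in>UNIV. of_int (c j $ i) * w $ i)" by metis
  then have "v = combm (\<chi> i j. of_int ((\<chi> i. c i)$i$j)) w"
    by (simp add: Finite_Cartesian_Product.vec_eq_iff combm_def comb_def)
  then show ?thesis by (rule that)
qed

lemma integral_basis_inO:
  assumes w: "integral_basis K w" shows "inO w"
proof -
  have "w$j = (\<Sum>i\<in>UNIV. of_int ((axis j 1 :: int^3) $ i) * w $ i)" for j
    by (simp add: axis_def if_distrib[of of_int] if_distrib[of "\<lambda>x. x * _"] cong: if_cong)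
  then have "w$j \<in> \<O>" for j using w unfolding integral_basis_def bij_betw_def by blast
  then show ?thesis by (simp add: inO_def)
qed

text \<open>
  Two integral bases are related by integer matrices in both directions, so the square of the
  determinant is 1.
\<close>

lemma disc_integral_basis_unique:
  assumes w: "integral_basis K w" and v: "integral_basis K v" and nz: "disc w \<noteq> 0"
  shows "disc v = disc w"
proof -
  note wO = integral_basis_inO[OF w] and vO = integral_basis_inO[OF v]
  obtain A :: "int^3^3" where A: "v = combm (\<chi> i j. of_int (A$i$j)) w" using integral_basis_combm[OF w vO] .
  obtain B :: "int^3^3" where B: "w = combm (\<chi> i j. of_int (B$i$j)) v" using integral_basis_combm[OF v wO] .
  have 1: "disc v = of_int (det A)^2 * disc w"
    unfolding A by (simp only: disc_combm[OF inO_inK[OF wO]] det_of_int_matrix of_rat_of_int_eq)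
  have 2: "disc w = of_int (det B)^2 * disc v"
    by (subst B) (simp only: disc_combm[OF inO_inK[OF vO]] det_of_int_matrix of_rat_of_int_eq)
  have "disc w = of_int (det B)^2 * (of_int (det A)^2 * disc w)" using 2 unfolding 1 .
  then have "disc w = of_int ((det B * det A)^2) * disc w" by (simp add: power_mult_distrib mult.assoc)
  then have "of_int ((det B * det A)^2) = (1::complex)" using nz by simp
  then have "(det B * det A)^2 = 1" by (simp only: of_int_eq_1_iff)
  then have "\<bar>det A\<bar> = 1" by (metis abs_mult abs_ge_zero abs_zmult_eq_1 mult.commute power2_eq_1_iff abs_1 abs_minus_cancel)
  then have "(det A)^2 = 1" by (metis power2_abs one_power2)
  then show ?thesis using 1 by (metis mult_1 of_int_1 of_int_power)
qed

lemma cubic_disc_form_basis: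
  assumes F: "form_basis \<omega> \<theta> a b c d"
  shows "cubic_disc K = form_disc a b c d"
proof -
  note D = form_basisD[OF F]
  have ib: "integral_basis K (bas \<omega> \<theta>)" by (rule integral_basis_form_basis[OF F])
  have nz: "disc (bas \<omega> \<theta>) \<noteq> 0" using D(5) by (simp add: disc_def)
  show ?thesis unfolding cubic_disc_def
  proof (rule the_equality)
    show "\<exists>w::complex^3. integral_basis K w \<and> of_int (form_disc a b c d) = det (\<chi> i j. field_trace K (w $ i * w $ j))"
      by (rule exI[of _ "bas \<omega> \<theta>"]) (simp add: ib form_basis_disc[OF F] disc_cubic_disc_det[OF inK_bas[OF D(3,4)]])
  next
    fix e assume "\<exists>w::complex^3. integral_basis K w \<and> of_int e = det (\<chi> i j. field_trace K (w $ i * w $ j))"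
    then obtain w :: "complex^3" where w: "integral_basis K w" "of_int e = det (\<chi> i j. field_trace K (w $ i * w $ j))" by blast
    have "of_int e = disc w" using w(2) disc_cubic_disc_det[OF inO_inK[OF integral_basis_inO[OF w(1)]]] by simp
    also have "\<dots> = of_int (form_disc a b c d)"
      using disc_integral_basis_unique[OF ib w(1) nz] form_basis_disc[OF F] by simp
    finally show "e = form_disc a b c d" by (simp only: of_int_eq_iff)
  qed
qed

end

section \<open>Primes whose square divides the discriminant\<close>

lemma prime_dvd_3:
  assumes "prime (q::int)" "q > 3" "q dvd 3 * x" shows "q dvd x"
proof -
  have "\<not> q dvd 3" using assms(2) zdvd_imp_le[of q 3] by auto
  then show ?thesis using assms(1,3) by (simp add: prime_dvd_mult_iff)
qed

lemma prime_not_dvd_small: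
  assumes "(q::int) > 3" shows "\<not> q dvd 2" "\<not> q dvd 3"
  using assms zdvd_imp_le[of q 2] zdvd_imp_le[of q 3] by auto

text \<open>
  The coefficients of the Hessian covariant decide the shape of the form modulo a prime: the
  discriminant of the Hessian is \<open>- 3\<close> times that of the form.
\<close>

lemma hessian_disc:
  "(b * c - 9 * a * d)^2 - 4 * (b^2 - 3 * a * c) * (c^2 - 3 * b * d) = - 3 * form_disc a b c d"
  by (simp add: form_disc_def algebra_simps power2_eq_square power3_eq_cube)

lemma form_disc_translate:
  "form_disc a (3*a*t + b) (3*a*t^2 + 2*b*t + c) (a*t^3 + b*t^2 + c*t + d) = form_disc a b c d"
  unfolding form_disc_def by Groebner_Basis.algebra

lemma form_disc_swap: "form_disc (-d) (-c) (-b) (-a) = form_disc a b c d"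
  unfolding form_disc_def by Groebner_Basis.algebra

lemma linear_congruence_solvable:
  assumes "prime (q::int)" "\<not> q dvd m"
  obtains t where "q dvd m * t + n"
proof -
  have "coprime m q" using assms prime_imp_coprime coprime_commute by blast
  then obtain x where "[m * x = 1] (mod q)" using cong_solve_coprime_int by blast
  then have "q dvd m * x - 1" by (simp add: cong_iff_dvd_diff)
  then have "q dvd (m * x - 1) * (- n)" by simp
  also have "(m * x - 1) * (- n) = m * (- n * x) + n" by (simp add: algebra_simps)
  finally show ?thesis by (rule that)
qed

text \<open>
  The Hessian is non-zero modulo \<open>q\<close> with a double zero at \<open>x = 0\<close>; this is also a double zero
  of the form, and as \<open>b\<close> is a unit, the term \<open>- 4 b\<^sup>3 d\<close> of the discriminant detects the
  divisibility of \<open>d\<close> by \<open>q\<^sup>2\<close>.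
\<close>

lemma double_root_square_dvd:
  assumes q: "prime (q::int)" "q > 3"
    and B: "q dvd b * c - 9 * a * d" and C: "q dvd c^2 - 3 * b * d" and A: "\<not> q dvd b^2 - 3 * a * c"
    and D: "q^2 dvd form_disc a b c d"
  shows "q dvd c" "q^2 dvd d"
proof -
  have "q dvd c * (b * c - 9 * a * d) - b * (c^2 - 3 * b * d)" using B C by simp
  also have "\<dots> = 3 * (d * (b^2 - 3 * a * c))" by (simp add: algebra_simps power2_eq_square)
  finally have "q dvd d * (b^2 - 3 * a * c)" using prime_dvd_3 q by blast
  then have d: "q dvd d" using q A by (simp add: prime_dvd_mult_iff)
  have "q dvd (c^2 - 3 * b * d) + 3 * b * d" using C d by (intro dvd_add) auto
  then have c: "q dvd c" using q prime_dvd_power by auto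
  show "q dvd c" by (rule c)
  obtain c' d' where cd: "c = q * c'" "d = q * d'" using c d by (auto elim!: dvdE)
  have b: "\<not> q dvd b"
  proof
    assume "q dvd b" then have "q dvd b^2 - 3 * a * c" using c by (simp add: power2_eq_square)
    with A show False by simp
  qed
  have "form_disc a b c d = q^2 * (b^2 * c'^2 - 4 * a * q * c'^3 - 27 * a^2 * d'^2 + 18 * a * b * c' * d') - 4 * b^3 * d"
    by (simp add: form_disc_def cd algebra_simps power2_eq_square power3_eq_cube)
  then have "4 * b^3 * d = q^2 * (b^2 * c'^2 - 4 * a * q * c'^3 - 27 * a^2 * d'^2 + 18 * a * b * c' * d') - form_disc a b c d"
    by simp
  also have "q^2 dvd \<dots>" using D by simp
  finally have 1: "q^2 dvd (4 * b^3) * d" by (simp add: mult.assoc)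
  have "\<not> q dvd 4 * b^3"
  proof
    assume "q dvd 4 * b^3"
    then have "q dvd 2 * 2 * b^3" by simp
    then show False using q b prime_not_dvd_small[OF q(2)] by (auto simp only: prime_dvd_mult_iff dest: prime_dvd_power)
  qed
  then have "coprime q (4 * b^3)" using q prime_imp_coprime by blast
  then have "coprime (q^2) (4 * b^3)" by (simp only: coprime_power_left_iff) simp
  with 1 show "q^2 dvd d" by (simp only: coprime_dvd_mult_right_iff)
qed

text \<open>
  All terms of the discriminant other than \<open>- 27 a\<^sup>2 d\<^sup>2\<close> are divisible by \<open>q\<^sup>3\<close>. The conclusion
  says that \<open>- 3 e\<close> is a square modulo \<open>q\<close>.
\<close>

lemma triple_root_square:
  assumes "q \<noteq> (0::int)" "q dvd b" "q dvd c" "q dvd d" "form_disc a b c d = q^2 * e"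
  shows "\<exists>t. q dvd 3 * e + t^2"
proof -
  obtain b' c' d' where bcd: "b = q * b'" "c = q * c'" "d = q * d'" using assms(2-4) by (auto elim!: dvdE)
  define r where "r = q * b'^2 * c'^2 - 4 * a * c'^3 - 4 * q * b'^3 * d' + 18 * a * b' * c' * d'"
  have "form_disc a b c d = q^2 * (q * r - 27 * a^2 * d'^2)"
    by (simp add: form_disc_def bcd r_def algebra_simps power2_eq_square power3_eq_cube)
  then have "e = q * r - 27 * a^2 * d'^2" using assms(1,5) by simp
  then have "3 * e + (9 * a * d')^2 = q * (3 * r)" by (simp add: algebra_simps power2_eq_square)
  then show ?thesis by (metis dvd_triv_left)
qed

context cubic_gen
begin

text \<open>
  Otherwise \<open>\<theta> / n\<close>, which is a root of \<open>y\<^sup>3 - (c/n) y\<^sup>2 + (b d/n\<^sup>2) y - a d\<^sup>2/n\<^sup>3\<close>, would be an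
  integer of the field outside the span of the basis.
\<close>

lemma form_basis_primitive:
  assumes F: "form_basis \<omega> \<theta> a b c d" and n: "n > (1::int)"
    and dv: "n dvd c" "n^2 dvd b * d" "n^3 dvd a * d^2"
  shows False
proof -
  note D = form_basisD[OF F]
  obtain c' e f where cef: "c = n * c'" "b * d = n^2 * e" "a * d^2 = n^3 * f"
    using dv by (auto elim!: dvdE)
  define y where "y = of_rat (1 / of_int n) * \<theta>"
  have y: "\<theta> = of_int n * y" using n by (simp add: y_def of_rat_divide)
  have yK: "y \<in> K" unfolding y_def by (rule qfield_scale) (rule D(4))
  have "\<theta>^3 - of_int c * \<theta>^2 + of_int (b * d) * \<theta> - of_int (a * d^2) = 0"
    unfolding of_int_mult of_int_power using D(7,9) unfolding of_int_mult by Groebner_Basis.algebra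
  then have "of_int n^3 * (y^3 + of_int (- c') * y^2 + of_int e * y + of_int (- f)) = 0"
    unfolding cef by (simp add: y algebra_simps power2_eq_square power3_eq_cube)
  then have "y^3 + of_int (- c') * y^2 + of_int e * y + of_int (- f) = 0" using n by simp
  then have "y \<in> \<O>" using algebraic_int_cubic[of y "- c'" e "- f"] yK by (simp add: ring_of_integers_def)
  then obtain k l m where "y = of_int k + of_int l * \<omega> + of_int m * \<theta>" using D(6) by blast
  then have "of_int n * y = of_int n * (of_int k + of_int l * \<omega> + of_int m * \<theta>)" by simp
  then have "of_int (n * k) + of_int (n * l) * \<omega> + of_int (n * m - 1) * \<theta> = 0"
    unfolding y[symmetric] by (simp add: algebra_simps)
  from bas_0_int[OF D(3-5) this] have "n * m = 1" by simp
  then show False using n zmult_eq_1_iff[of n m] by auto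
qed

lemma no_double_root:
  assumes F: "form_basis \<omega> \<theta> a b c d" and l: "prime l" "l > 3"
    and B: "l dvd b * c - 9 * a * d" and C: "l dvd c^2 - 3 * b * d" and A: "\<not> l dvd b^2 - 3 * a * c"
  shows "\<not> l^2 dvd form_disc a b c d"
proof
  assume "l^2 dvd form_disc a b c d"
  from double_root_square_dvd[OF l B C A this] have "l dvd c" "l^2 dvd d" by auto
  moreover from this obtain d' where "d = l^2 * d'" by (auto elim: dvdE)
  then have "a * d^2 = l^3 * (a * l * d'^2)" by (simp add: power2_eq_square power3_eq_cube)
  ultimately show False using form_basis_primitive[OF F, of l] l by auto
qed

text \<open>
  A form whose Hessian vanishes modulo \<open>q\<close> is a multiple of the cube of a linear form there. This is moved
  to the standard position of \<open>triple_root_square\<close>; a form that is zero modulo \<open>q\<close> falls under the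
  first case, whose conclusion holds for it as well.
\<close>

lemma hessian_zero_square:
  assumes F: "form_basis \<omega> \<theta> a b c d" and l: "prime l" "l > 3"
    and H: "l dvd b * c - 9 * a * d" "l dvd c^2 - 3 * b * d" "l dvd b^2 - 3 * a * c"
    and e: "form_disc a b c d = l^2 * e"
  shows "\<exists>t. l dvd 3 * e + t^2"
proof (cases "l dvd a")
  case True
  have "l dvd (b^2 - 3 * a * c) + 3 * a * c" using H(3) True by (intro dvd_add) auto
  then have b: "l dvd b" using l prime_dvd_power by auto
  have "l dvd (c^2 - 3 * b * d) + 3 * b * d" using H(2) b by (intro dvd_add) auto
  then have c: "l dvd c" using l prime_dvd_power by auto
  show ?thesis
    using triple_root_square[of l "-c" "-b" "-a" "-d" e] l True b c e by (auto simp: form_disc_swap)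
next
  case False
  have "\<not> l dvd 3 * a" using False prime_dvd_3 l by blast
  then obtain t where t: "l dvd (3 * a) * t + b" using linear_congruence_solvable[OF l(1)] by blast
  define b' c' d' where "b' = 3*a*t + b" and "c' = 3*a*t^2 + 2*b*t + c" and "d' = a*t^3 + b*t^2 + c*t + d"
  have b': "l dvd b'" using t by (simp add: b'_def)
  have "b'^2 - 3 * a * c' = b^2 - 3 * a * c"
    by (simp add: b'_def c'_def algebra_simps power2_eq_square)
  then have "l dvd b'^2 - (b^2 - 3 * a * c)" and eq: "3 * (a * c') = b'^2 - (b^2 - 3 * a * c)"
    using b' H(3) by (auto simp: power2_eq_square)
  then have "l dvd a * c'" using prime_dvd_3 l by metis
  then have c': "l dvd c'" using False l by (simp add: prime_dvd_mult_iff)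
  have "b' * c' - 9 * a * d' = (b * c - 9 * a * d) + 2 * (b^2 - 3 * a * c) * t"
    by (simp add: b'_def c'_def d'_def algebra_simps power2_eq_square power3_eq_cube)
  then have "3 * (3 * (a * d')) = b' * c' - ((b * c - 9 * a * d) + 2 * (b^2 - 3 * a * c) * t)" by simp
  moreover have "l dvd b' * c' - ((b * c - 9 * a * d) + 2 * (b^2 - 3 * a * c) * t)"
    by (intro dvd_diff dvd_add H(1) dvd_mult2[OF dvd_mult[OF H(3)]] dvd_mult2[OF b'])
  ultimately have "l dvd a * d'" using prime_dvd_3 l by metis
  then have d': "l dvd d'" using False l by (simp add: prime_dvd_mult_iff)
  have "form_disc a b' c' d' = l^2 * e" using e unfolding b'_def c'_def d'_def form_disc_translate .
  then show ?thesis using triple_root_square[OF _ b' c' d'] l by auto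
qed

text \<open>
  Modulo \<open>q\<close> the discriminant of the Hessian vanishes, so the Hessian is a multiple of the square of a linear
  form. A translation or an exchange of the variables takes that linear form to \<open>x\<close>. If the
  Hessian is not zero, then \<open>no_double_root\<close> contradicts the divisibility by \<open>q\<^sup>2\<close>.
\<close>

lemma cubic_disc_square_factor:
  assumes l: "prime l" "l > 3" and e: "cubic_disc K = l^2 * e"
  shows "\<exists>t. l dvd 3 * e + t^2"
proof -
  obtain \<omega> \<theta> a b c d where F: "form_basis \<omega> \<theta> a b c d" using form_basis_exists by blast
  have D: "form_disc a b c d = l^2 * e" using e cubic_disc_form_basis[OF F] by simp
  define A B C where "A = b^2 - 3 * a * c" and "B = b * c - 9 * a * d" and "C = c^2 - 3 * b * d"
  have disc: "B^2 - 4 * A * C = - 3 * (l^2 * e)" using hessian_disc[of b c a d] by (simp add: A_def B_def C_def D)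
  have qdisc: "l dvd B^2 - 4 * A * C" unfolding disc by (simp add: power2_eq_square)
  show ?thesis
  proof (cases "l dvd A")
    case False
    have "\<not> l dvd 2 * A" using False prime_not_dvd_small[OF l(2)] l by (simp add: prime_dvd_mult_iff)
    then obtain t where t: "l dvd (2 * A) * t + B" using linear_congruence_solvable[OF l(1)] by blast
    define b' c' d' where "b' = 3*a*t + b" and "c' = 3*a*t^2 + 2*b*t + c" and "d' = a*t^3 + b*t^2 + c*t + d"
    obtain \<omega>' \<theta>' where F': "form_basis \<omega>' \<theta>' a b' c' d'"
      using form_basis_translate[OF F, of t] unfolding b'_def c'_def d'_def by blast
    have A': "b'^2 - 3 * a * c' = A"
      by (simp add: A_def b'_def c'_def algebra_simps power2_eq_square)
    have B': "b' * c' - 9 * a * d' = 2 * A * t + B"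
      by (simp add: A_def B_def b'_def c'_def d'_def algebra_simps power2_eq_square power3_eq_cube)
    have D': "form_disc a b' c' d' = l^2 * e" using D unfolding b'_def c'_def d'_def form_disc_translate .
    have "2 * 2 * A * (c'^2 - 3 * b' * d') = (2 * A * t + B)^2 + 3 * (l^2 * e)"
      using hessian_disc[of b' c' a d'] unfolding A' B' D' by simp
    also have "l dvd \<dots>" using t by (simp add: power2_eq_square)
    finally have "l dvd c'^2 - 3 * b' * d'"
      using False prime_not_dvd_small[OF l(2)] l by (simp only: prime_dvd_mult_iff) auto
    then show ?thesis using no_double_root[OF F' l] t D' False by (simp add: A' B')
  next
    case True
    have "l dvd (B^2 - 4 * A * C) + 4 * A * C" using qdisc True by (intro dvd_add) auto
    then have B: "l dvd B" using l prime_dvd_power by auto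
    show ?thesis
    proof (cases "l dvd C")
      case True2: True
      show ?thesis using hessian_zero_square[OF F l] B True True2 D by (simp add: A_def B_def C_def)
    next
      case False
      have "l dvd (-c) * (-b) - 9 * (-d) * (-a)" using B by (simp add: B_def mult_ac)
      moreover have "l dvd (-b)^2 - 3 * (-c) * (-a)" using True by (simp add: A_def mult_ac)
      moreover have "\<not> l dvd (-c)^2 - 3 * (-d) * (-b)" using False by (simp add: C_def mult_ac)
      ultimately have "\<not> l^2 dvd form_disc (-d) (-c) (-b) (-a)"
        by (rule no_double_root[OF form_basis_swap[OF F] l])
      then show ?thesis using D by (simp add: form_disc_swap)
    qed
  qed
qed

end

section \<open>Elements with small conjugates\<close>

text \<open>
  A positive definite binary quadratic form takes a value at most a constant times the square root
  of its determinant: complete the square and approximate the ratio of its coefficients.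
\<close>

lemma binary_form_small_value:
  fixes A B C \<Delta> :: real
  assumes A: "A > 0" and \<Delta>: "\<Delta> > 0" "A * C - B^2 = \<Delta>"
  obtains x y :: int where "(x, y) \<noteq> (0, 0)"
    "A * of_int x^2 + 2 * B * of_int x * of_int y + C * of_int y^2 \<le> 5 * sqrt \<Delta>"
proof (cases "A < sqrt \<Delta>")
  case True
  then have "A \<le> 5 * sqrt \<Delta>" using A by simp
  then show ?thesis using that[of 1 0] by simp
next
  case False
  define s where "s = sqrt \<Delta>"
  have s: "s > 0" "s^2 = \<Delta>" "s \<le> A" using \<Delta> False by (auto simp: s_def)
  \<comment> \<open>The denominator bound \<open>N\<close> balances the two terms of \<open>A (x + (B/A) y)\<^sup>2 + (\<Delta>/A) y\<^sup>2\<close>.\<close>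
  define g where "g = sqrt (A / s)"
  have g: "g \<ge> 1" "g^2 = A / s" using s A by (auto simp: g_def)
  define N where "N = nat \<lceil>g\<rceil>"
  have N: "real N \<ge> g" "real N \<le> 2 * g" "N > 0" using g by (auto simp: N_def) linarith+
  obtain h k where hk: "0 < k" "k \<le> int N" "\<bar>of_int k * (B / A) - of_int h\<bar> < 1 / N"
    using Dirichlet_approx[OF N(3), of "B / A"] by blast
  define z where "z = of_int k * (B / A) - of_int h"
  have N2: "g^2 \<le> real N^2" "real N^2 \<le> (2 * g)^2" using N g by (intro power_mono; simp)+
  have "z^2 \<le> (1 / N)^2" using hk(3) by (subst abs_le_square_iff[symmetric]) (simp add: z_def)
  then have "A * z^2 \<le> A * (1 / N)^2" using A by simp
  also have "\<dots> = A / real N^2" by (simp add: power_divide)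
  also have "\<dots> \<le> A / g^2" by (rule divide_left_mono[OF N2(1)]) (use A N(3) g(1) in \<open>auto intro!: mult_pos_pos\<close>)
  also have "\<dots> = s" using g s A by simp
  finally have 1: "A * z^2 \<le> s" .
  have "real_of_int k^2 \<le> real N^2" using hk by (intro power_mono) linarith+
  then have "(\<Delta> / A) * of_int k^2 \<le> (\<Delta> / A) * real N^2" using A \<Delta> by (intro mult_left_mono) auto
  also have "\<dots> \<le> (\<Delta> / A) * (2 * g)^2" using A \<Delta> N2(2) by (intro mult_left_mono) auto
  also have "\<dots> = 4 * s" unfolding power_mult_distrib g(2) s(2)[symmetric] using s(1) A by (simp add: field_simps power2_eq_square)
  finally have 2: "(\<Delta> / A) * of_int k^2 \<le> 4 * s" .
  have "A * of_int (-h)^2 + 2 * B * of_int (-h) * of_int k + C * of_int k^2 = A * z^2 + (\<Delta> / A) * of_int k^2"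
    using A unfolding z_def \<Delta>(2)[symmetric] by (simp add: field_simps power2_eq_square)
  then show ?thesis using that[of "-h" k] hk(1) 1 2 by (simp add: s_def)
qed

lemma lagrange_identity_3:
  fixes u1 u2 u3 v1 v2 v3 :: complex
  shows "(cmod u1^2 + cmod u2^2 + cmod u3^2) * (cmod v1^2 + cmod v2^2 + cmod v3^2)
     - cmod (u1 * cnj v1 + u2 * cnj v2 + u3 * cnj v3)^2
     = cmod (u1 * v2 - u2 * v1)^2 + cmod (u1 * v3 - u3 * v1)^2 + cmod (u2 * v3 - u3 * v2)^2" (is "?l = ?r")
proof -
  have "complex_of_real ?l = complex_of_real ?r"
    unfolding of_real_add of_real_diff of_real_mult
    by (simp only: complex_norm_square complex_cnj_add complex_cnj_mult complex_cnj_diff complex_cnj_cnj)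
      (simp add: algebra_simps)
  then show ?thesis by (simp only: of_real_eq_iff)
qed

context cubic_gen
begin

lemma cnj_root: "\<exists>j. cnj (\<rho>$i) = \<rho>$j"
proof -
  have "cnj ((\<rho>$i)^3 + of_int p * (\<rho>$i)^2 + of_int q * \<rho>$i + of_int r) = 0" by (simp only: root complex_cnj_zero)
  then have "(cnj (\<rho>$i))^3 + of_int p * (cnj (\<rho>$i))^2 + of_int q * cnj (\<rho>$i) + of_int r = 0" by simp
  then show ?thesis unfolding roots by auto
qed

lemma emb_cnj: "x \<in> K \<Longrightarrow> cnj (emb t x) = emb (cnj t) x"
proof (elim qfieldE)
  fix a b c assume x: "x = quad a b c \<alpha>"
  have "cnj (of_rat u) = of_rat u" for u by (cases u) (simp add: of_rat_rat)
  then show ?thesis unfolding x by (simp add: emb_quad) (simp add: quad_def)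
qed

text \<open>
  Complex conjugation permutes the embeddings, so the Hermitian pairing of the conjugates of two
  elements is real.
\<close>

lemma pairing_real:
  assumes "x \<in> K" "y \<in> K"
  shows "(\<Sum>i\<in>UNIV. \<Sum>j\<in>UNIV. (emb (\<rho>$i) x - emb (\<rho>$j) x) * cnj (emb (\<rho>$i) y - emb (\<rho>$j) y)) \<in> \<real>"
proof -
  define f where "f i j = (emb (\<rho>$i) x - emb (\<rho>$j) x) * cnj (emb (\<rho>$i) y - emb (\<rho>$j) y)" for i j
  obtain \<pi> where \<pi>: "\<And>i. cnj (\<rho>$i) = \<rho>$(\<pi> i)" using cnj_root by metis
  have inj: "\<rho>$i = \<rho>$j \<Longrightarrow> i = j" for i j
    using roots_distinct exhaust_3[of i] exhaust_3[of j] by auto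
  have "\<pi> (\<pi> i) = i" for i using \<pi>[of i] \<pi>[of "\<pi> i"] inj by (metis complex_cnj_cnj)
  then have bij: "bij \<pi>" by (metis bij_betw_def inj_def surj_def)
  have "cnj (f i j) = f (\<pi> i) (\<pi> j)" for i j
    by (simp add: f_def emb_cnj assms \<pi>)
  then have "cnj (\<Sum>i\<in>UNIV. \<Sum>j\<in>UNIV. f i j) = (\<Sum>i\<in>UNIV. \<Sum>j\<in>UNIV. f (\<pi> i) (\<pi> j))" by simp
  also have "\<dots> = (\<Sum>i\<in>UNIV. \<Sum>j\<in>UNIV. f (\<pi> i) j)"
    by (intro sum.cong refl sum.reindex_bij_betw bij)
  also have "\<dots> = (\<Sum>i\<in>UNIV. \<Sum>j\<in>UNIV. f i j)"
    by (rule sum.reindex_bij_betw[OF bij])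
  finally show ?thesis unfolding f_def by (simp add: Reals_cnj_iff)
qed

text \<open>
  The other two coefficients of the characteristic polynomial, up to sign.
\<close>

definition tr2 :: "complex \<Rightarrow> complex" where
  "tr2 x = emb (\<rho>$1) x * emb (\<rho>$2) x + emb (\<rho>$1) x * emb (\<rho>$3) x + emb (\<rho>$2) x * emb (\<rho>$3) x"

definition nrm :: "complex \<Rightarrow> complex" where
  "nrm x = emb (\<rho>$1) x * emb (\<rho>$2) x * emb (\<rho>$3) x"

text \<open>
  Newton's identities express the coefficients rationally in traces of powers, so they are rational
  algebraic integers.
\<close>

lemma char_poly_root:
  assumes x: "x \<in> \<O>"
  obtains e1 e2 e3 :: int where "tr x = of_int e1" "tr2 x = of_int e2" "nrm x = of_int e3"
    "x^3 + of_int (- e1) * x^2 + of_int e2 * x + of_int (- e3) = 0"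
proof -
  have xK: "x \<in> K" using x OD by simp
  have sq: "tr (x^2) = tr x^2 - 2 * tr2 x"
    by (simp add: tr_def tr2_def sum_3 power2_eq_square emb_mult xK algebra_simps)
  have cb: "tr (x^3) = tr x * tr (x^2) - tr2 x * tr x + 3 * nrm x"
    by (simp add: tr_def tr2_def nrm_def sum_3 power2_eq_square power3_eq_cube emb_mult K_mult xK algebra_simps)
  have t: "tr x \<in> \<int>" "tr (x^2) \<in> \<int>" "tr (x^3) \<in> \<int>" using x by (auto intro: tr_integer O_power)
  have ai: "algebraic_int (emb (\<rho>$i) x)" for i using emb_algebraic_int xK x OD by blast
  have QI: "z \<in> \<rat>" if "z \<in> \<int>" for z :: complex using that Ints_subset_Rats by blast
  have "(tr x^2 - tr (x^2)) / 2 \<in> \<rat>" by (intro Rats_divide Rats_diff Rats_power QI t) auto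
  moreover have "tr2 x = (tr x^2 - tr (x^2)) / 2" using sq by simp
  ultimately have "tr2 x \<in> \<rat>" by (simp only:)
  moreover have "algebraic_int (tr2 x)" unfolding tr2_def by (intro algebraic_int_plus algebraic_int_times ai)
  ultimately have 2: "tr2 x \<in> \<int>" by (rule rational_algebraic_int_is_int[rotated])
  have "(tr (x^3) - tr x * tr (x^2) + tr2 x * tr x) / 3 \<in> \<rat>"
    by (intro Rats_divide Rats_diff Rats_add Rats_mult QI t 2) auto
  moreover have "nrm x = (tr (x^3) - tr x * tr (x^2) + tr2 x * tr x) / 3" using cb by simp
  ultimately have "nrm x \<in> \<rat>" by (simp only:)
  moreover have "algebraic_int (nrm x)" unfolding nrm_def by (intro algebraic_int_times ai)
  ultimately have 3: "nrm x \<in> \<int>" by (rule rational_algebraic_int_is_int[rotated])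
  obtain e1 e2 e3 where e: "tr x = of_int e1" "tr2 x = of_int e2" "nrm x = of_int e3"
    using t(1) 2 3 by (auto elim!: Ints_cases)
  have "x^3 + of_int (- e1) * x^2 + of_int e2 * x + of_int (- e3) = 0"
  proof (rule emb_0_imp_0)
    show "x^3 + of_int (- e1) * x^2 + of_int e2 * x + of_int (- e3) \<in> K"
      by (intro qfield_add K_mult K_power xK qfield_of_int)
    fix i :: 3
    define s where "s = emb (\<rho>$i) x"
    have "emb (\<rho>$i) (x^3 + of_int (- e1) * x^2 + of_int e2 * x + of_int (- e3))
        = s^3 - of_int e1 * s^2 + of_int e2 * s - of_int e3"
      unfolding power3_eq_cube power2_eq_square
      by (simp only: emb_add emb_mult emb_of_int qfield_add K_mult K_power xK qfield_of_int s_def) simp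
    also have "\<dots> = (s - emb (\<rho>$1) x) * (s - emb (\<rho>$2) x) * (s - emb (\<rho>$3) x)"
      unfolding e[symmetric] by (simp add: tr_def tr2_def nrm_def sum_3 algebra_simps power2_eq_square power3_eq_cube)
    also have "\<dots> = 0" using exhaust_3[of i] by (auto simp: s_def)
    finally show "emb (\<rho>$i) (x^3 + of_int (- e1) * x^2 + of_int e2 * x + of_int (- e3)) = 0" .
  qed
  with e show ?thesis by (rule that)
qed

definition spread :: "complex \<Rightarrow> real" where
  "spread x = cmod (emb (\<rho>$1) x - emb (\<rho>$2) x)^2 + cmod (emb (\<rho>$2) x - emb (\<rho>$3) x)^2
     + cmod (emb (\<rho>$3) x - emb (\<rho>$1) x)^2"

text \<open>
  By Lagrange's identity the determinant of the quadratic form \<open>spread\<close> on the plane spanned by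
  \<open>\<omega>\<close> and \<open>\<theta>\<close> is a sum of three squared absolute values of minors. All of these minors are, up to sign, the
  determinant of the conjugates of \<open>1, \<omega>, \<theta>\<close>.
\<close>

lemma small_spread:
  obtains x where "x \<in> \<O>" "x \<notin> \<rat>" "spread x \<le> 5 * sqrt (3 * \<bar>of_int (cubic_disc K)\<bar>)"
proof -
  obtain \<omega> \<theta> a b c d where F: "form_basis \<omega> \<theta> a b c d" using form_basis_exists by blast
  note D = form_basisD[OF F]
  define u1 u2 u3 where "u1 = emb (\<rho>$1) \<omega> - emb (\<rho>$2) \<omega>" and "u2 = emb (\<rho>$2) \<omega> - emb (\<rho>$3) \<omega>"
    and "u3 = emb (\<rho>$3) \<omega> - emb (\<rho>$1) \<omega>"
  define v1 v2 v3 where "v1 = emb (\<rho>$1) \<theta> - emb (\<rho>$2) \<theta>" and "v2 = emb (\<rho>$2) \<theta> - emb (\<rho>$3) \<theta>"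
    and "v3 = emb (\<rho>$3) \<theta> - emb (\<rho>$1) \<theta>"
  define \<delta> where "\<delta> = det (embm (bas \<omega> \<theta>))"
  have \<delta>: "u1 * v2 - u2 * v1 = \<delta>" "u1 * v3 - u3 * v1 = - \<delta>" "u2 * v3 - u3 * v2 = \<delta>"
    by (simp_all add: \<delta>_def det_3 embm_def bas_def emb_1 u1_def u2_def u3_def v1_def v2_def v3_def) (simp_all add: algebra_simps)
  have "\<delta>^2 = of_int (cubic_disc K)"
    using form_basis_disc[OF F] by (simp add: \<delta>_def disc_def cubic_disc_form_basis[OF F])
  then have \<delta>2: "cmod \<delta>^2 = \<bar>of_int (cubic_disc K)\<bar>" by (metis norm_of_int norm_power)
  have \<delta>0: "\<delta> \<noteq> 0" using D(5) by (simp add: \<delta>_def)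
  define A C where "A = cmod u1^2 + cmod u2^2 + cmod u3^2" and "C = cmod v1^2 + cmod v2^2 + cmod v3^2"
  define W where "W = u1 * cnj v1 + u2 * cnj v2 + u3 * cnj v3"
  define B where "B = Re W"
  have "2 * W \<in> \<real>" using pairing_real[OF D(3,4)]
    by (simp add: sum_3 W_def u1_def u2_def u3_def v1_def v2_def v3_def algebra_simps)
  then have "Im W = 0" by (simp add: complex_is_Real_iff)
  then have W: "W = of_real B" by (simp add: B_def complex_eq_iff)
  have det: "A * C - B^2 = 3 * \<bar>of_int (cubic_disc K)\<bar>"
    using lagrange_identity_3[of u1 u2 u3 v1 v2 v3] unfolding A_def[symmetric] C_def[symmetric] W_def[symmetric] \<delta>
    by (simp add: W \<delta>2)
  have "A \<noteq> 0"
  proof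
    assume "A = 0"
    then have "cmod u1^2 = 0" "cmod u2^2 = 0" unfolding A_def
      by (metis add_nonneg_eq_0_iff add_nonneg_nonneg zero_le_power2)+
    then show False using \<delta>(1) \<delta>0 by simp
  qed
  moreover have "A \<ge> 0" by (simp add: A_def)
  ultimately have A: "A > 0" by simp
  have pos: "3 * \<bar>real_of_int (cubic_disc K)\<bar> > 0" using \<delta>0 \<delta>2 by (metis abs_ge_zero mult_pos_pos norm_eq_zero order_le_less power_eq_0_iff zero_less_numeral zero_neq_numeral)
  obtain x y where xy: "(x, y) \<noteq> (0, 0)"
    "A * of_int x^2 + 2 * B * of_int x * of_int y + C * of_int y^2 \<le> 5 * sqrt (3 * \<bar>of_int (cubic_disc K)\<bar>)"
    using binary_form_small_value[OF A pos det] by blast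
  define z where "z = of_int x * \<omega> + of_int y * \<theta>"
  have zO: "z \<in> \<O>" unfolding z_def using D by (intro O_add O_mult O_of_int) auto
  have ez: "emb t z = of_int x * emb t \<omega> + of_int y * emb t \<theta>" for t
    using emb_scale[OF D(3), of t "of_int x"] emb_scale[OF D(4), of t "of_int y"] D(3,4)
    by (simp add: z_def emb_add qfield_scale_int)
  have "z \<notin> \<rat>"
  proof
    assume "z \<in> \<rat>"
    then obtain s where "z = of_rat s" by (auto elim: Rats_cases)
    then have "of_rat (- s) + of_rat (of_int x) * \<omega> + of_rat (of_int y) * \<theta> = 0"
      by (simp add: z_def of_rat_minus algebra_simps)
    from bas_0[OF D(3-5) this] show False using xy(1) by simp
  qed
  moreover have "spread z = A * of_int x^2 + 2 * B * of_int x * of_int y + C * of_int y^2"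
  proof -
    have s: "spread z = cmod (of_int x * u1 + of_int y * v1)^2 + cmod (of_int x * u2 + of_int y * v2)^2
        + cmod (of_int x * u3 + of_int y * v3)^2"
      by (simp add: spread_def ez u1_def u2_def u3_def v1_def v2_def v3_def algebra_simps)
    have q: "cmod (of_int x * u + of_int y * v)^2 = cmod u^2 * of_int x^2 + 2 * Re (u * cnj v) * of_int x * of_int y + cmod v^2 * of_int y^2" for u v
      unfolding cmod_power2 by (simp add: algebra_simps power2_eq_square)
    show ?thesis unfolding s q by (simp add: A_def B_def C_def W_def algebra_simps)
  qed
  ultimately show ?thesis using that[of z] zO xy(2) by simp
qed

text \<open>
  Subtracting a rational integer makes the trace small, so that all conjugates, and with them the
  coefficients of the characteristic polynomial, are bounded in terms of the discriminant.
\<close>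

lemma bounded_element:
  obtains x and e1 e2 e3 :: int where "x \<in> K" "x \<notin> \<rat>"
    "x^3 + of_int e1 * x^2 + of_int e2 * x + of_int e3 = 0"
    "let L = 1 + sqrt (5 * sqrt (3 * \<bar>of_int (cubic_disc K)\<bar>)) in
      \<bar>of_int e1\<bar> \<le> 3 * L \<and> \<bar>of_int e2\<bar> \<le> 3 * L^2 \<and> \<bar>of_int e3\<bar> \<le> L^3"
proof -
  define M where "M = sqrt (5 * sqrt (3 * \<bar>of_int (cubic_disc K)\<bar>))"
  obtain z where z: "z \<in> \<O>" "z \<notin> \<rat>" "spread z \<le> 5 * sqrt (3 * \<bar>of_int (cubic_disc K)\<bar>)"
    using small_spread by blast
  have M: "cmod (emb (\<rho>$1) z - emb (\<rho>$2) z) \<le> M" "cmod (emb (\<rho>$2) z - emb (\<rho>$3) z) \<le> M"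
    "cmod (emb (\<rho>$3) z - emb (\<rho>$1) z) \<le> M"
    unfolding M_def using z(3) by (intro real_le_rsqrt; simp add: spread_def; smt (verit) zero_le_power2)+
  obtain T where T: "tr z = of_int T" using tr_integer[OF z(1)] by (auto elim: Ints_cases)
  define x where "x = z - of_int (T div 3)"
  have zK: "z \<in> K" using z(1) OD by blast
  have xO: "x \<in> \<O>" unfolding x_def by (intro O_diff O_of_int z(1))
  have xQ: "x \<notin> \<rat>" using z(2) unfolding x_def by (metis Rats_add Rats_of_int diff_add_cancel)
  have ex: "emb t x = emb t z - of_int (T div 3)" for t
    unfolding x_def by (simp add: emb_diff zK qfield_of_int emb_of_int)
  have trx: "tr x = of_int (T mod 3)"
  proof -
    have "tr x = tr z - 3 * of_int (T div 3)" by (simp add: tr_def ex sum_3)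
    also have "\<dots> = of_int (T - 3 * (T div 3))" by (simp add: T)
    also have "T - 3 * (T div 3) = T mod 3" by (simp add: minus_mult_div_eq_mod)
    finally show ?thesis .
  qed
  have trb: "cmod (tr x) \<le> 3" unfolding trx norm_of_int
    using pos_mod_bound[of 3 T] pos_mod_sign[of 3 T] by linarith
  have M': "cmod (emb (\<rho>$1) x - emb (\<rho>$2) x) \<le> M" "cmod (emb (\<rho>$2) x - emb (\<rho>$3) x) \<le> M"
    "cmod (emb (\<rho>$3) x - emb (\<rho>$1) x) \<le> M"
    using M by (simp_all add: ex)
  have tri: "cmod s \<le> 1 + M" if "3 * s = t + u - v" "cmod t \<le> 3" "cmod u \<le> M" "cmod v \<le> M" for s t u v
  proof -
    have "3 * cmod s = cmod (t + u - v)" using that(1) by (metis norm_mult norm_numeral)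
    also have "\<dots> \<le> cmod t + cmod u + cmod v" by (meson add_mono norm_triangle_ineq norm_triangle_ineq4 order_refl order_trans)
    finally have "3 * cmod s \<le> 3 + M + M" using that by linarith
    moreover have "M \<ge> 0" using that(3) norm_ge_zero order_trans by blast
    ultimately show ?thesis by linarith
  qed
  define L where "L = 1 + M"
  have b1: "cmod (emb (\<rho>$1) x) \<le> L" unfolding L_def
    by (rule tri[OF _ trb M'(1) M'(3)]) (simp add: tr_def sum_3)
  have b2: "cmod (emb (\<rho>$2) x) \<le> L" unfolding L_def
    by (rule tri[OF _ trb M'(2) M'(1)]) (simp add: tr_def sum_3)
  have b3: "cmod (emb (\<rho>$3) x) \<le> L" unfolding L_def
    by (rule tri[OF _ trb M'(3) M'(2)]) (simp add: tr_def sum_3)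
  have L0: "L \<ge> 0" using b1 norm_ge_zero order_trans by blast
  obtain e1 e2 e3 where e: "tr x = of_int e1" "tr2 x = of_int e2" "nrm x = of_int e3"
    "x^3 + of_int (- e1) * x^2 + of_int e2 * x + of_int (- e3) = 0"
    using char_poly_root[OF xO] by blast
  have p2: "cmod (s * t) \<le> L^2" if "cmod s \<le> L" "cmod t \<le> L" for s t
    unfolding norm_mult power2_eq_square using that L0 by (intro mult_mono) auto
  have "cmod (tr x) \<le> 3 * L" unfolding tr_def sum_3
    using b1 b2 b3 norm_triangle_ineq[of "emb (\<rho>$1) x + emb (\<rho>$2) x" "emb (\<rho>$3) x"] norm_triangle_ineq[of "emb (\<rho>$1) x" "emb (\<rho>$2) x"]
    by linarith
  moreover have "cmod (tr2 x) \<le> 3 * L^2" unfolding tr2_def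
    using p2[OF b1 b2] p2[OF b1 b3] p2[OF b2 b3]
      norm_triangle_ineq[of "emb (\<rho>$1) x * emb (\<rho>$2) x + emb (\<rho>$1) x * emb (\<rho>$3) x" "emb (\<rho>$2) x * emb (\<rho>$3) x"]
      norm_triangle_ineq[of "emb (\<rho>$1) x * emb (\<rho>$2) x" "emb (\<rho>$1) x * emb (\<rho>$3) x"]
    by linarith
  moreover have "cmod (nrm x) \<le> L^2 * L" unfolding nrm_def norm_mult[of "_ * _" "emb (\<rho>$3) x"]
    using p2[OF b1 b2] b3 L0 by (intro mult_mono) auto
  ultimately have "\<bar>of_int (- e1)\<bar> \<le> 3 * L \<and> \<bar>of_int e2\<bar> \<le> 3 * L^2 \<and> \<bar>of_int (- e3)\<bar> \<le> L^3"
    unfolding e norm_of_int by (simp add: power2_eq_square power3_eq_cube)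
  then show ?thesis using that[of x "- e1" e2 "- e3"] OD(1)[OF xO] xQ e(4) unfolding L_def M_def Let_def by blast
qed

end

section \<open>Cubic fields in general and their finite number\<close>

lemma complex_field_simps:
  "carrier complex_field = UNIV" "mult complex_field x y = x * y" "\<one>\<^bsub>complex_field\<^esub> = 1"
  "\<zero>\<^bsub>complex_field\<^esub> = 0" "add complex_field x y = x + y"
  by (simp_all add: ring_of_type_algebra_def)

lemma complex_field_minus: "\<ominus>\<^bsub>complex_field\<^esub> x = - x"
proof -
  interpret ring complex_field by (rule ring_from_type_algebra)
  have "- x \<oplus>\<^bsub>complex_field\<^esub> x = \<zero>\<^bsub>complex_field\<^esub>" by (simp add: complex_field_simps)
  then show ?thesis by (metis minus_equality UNIV_I complex_field_simps(1))
qed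

lemma complex_subfieldI:
  assumes "1 \<in> K" "\<And>x. x \<in> K \<Longrightarrow> - x \<in> K" "\<And>x y. x \<in> K \<Longrightarrow> y \<in> K \<Longrightarrow> x * y \<in> K"
    "\<And>x y. x \<in> K \<Longrightarrow> y \<in> K \<Longrightarrow> x + y \<in> K"
    and inv: "\<And>x. x \<in> K \<Longrightarrow> x \<noteq> 0 \<Longrightarrow> \<exists>y\<in>K. x * y = 1"
  shows "subfield K complex_field"
proof -
  interpret ring complex_field by (rule ring_from_type_algebra)
  have "subring K complex_field"
    by (rule subringI) (simp_all add: complex_field_simps complex_field_minus assms)
  then have 1: "subcring K complex_field" by (rule subcringI) (simp add: complex_field_simps)
  have "Units (complex_field\<lparr>carrier := K\<rparr>) = K - {\<zero>\<^bsub>complex_field\<^esub>}"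
    using inv by (auto simp: Units_def complex_field_simps mult.commute)
  with 1 show ?thesis by (rule subfieldI)
qed

lemma complex_subfieldD:
  assumes K: "subfield K complex_field"
  shows "1 \<in> K" "x \<in> K \<Longrightarrow> - x \<in> K" "x \<in> K \<Longrightarrow> y \<in> K \<Longrightarrow> x * y \<in> K"
    "x \<in> K \<Longrightarrow> y \<in> K \<Longrightarrow> x + y \<in> K" "x \<in> K \<Longrightarrow> inverse x \<in> K"
proof -
  note R = subringE[OF subfieldE(1)[OF K]]
  show "1 \<in> K" using R(3) by (simp add: complex_field_simps)
  show "- x \<in> K" if "x \<in> K" for x using R(5)[OF that] by (simp add: complex_field_minus)
  show "x * y \<in> K" if "x \<in> K" "y \<in> K" for x y using R(6)[OF that] by (simp add: complex_field_simps)
  show "x + y \<in> K" if "x \<in> K" "y \<in> K" for x y using R(7)[OF that] by (simp add: complex_field_simps)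
  show "inverse x \<in> K" if "x \<in> K" for x
  proof (cases "x = 0")
    case True
    then show ?thesis using that by simp
  next
    case False
    have "Units (complex_field\<lparr>carrier := K\<rparr>) = K - {\<zero>\<^bsub>complex_field\<^esub>}"
      using K by (simp add: subfield_def subfield_axioms_def)
    then have "x \<in> Units (complex_field\<lparr>carrier := K\<rparr>)" using that False by (simp add: complex_field_simps)
    then obtain y where "y \<in> K" "y * x = 1" by (auto simp: Units_def complex_field_simps)
    then show ?thesis by (metis inverse_unique mult.commute)
  qed
qed

lemma complex_subfield_of_rat:
  assumes K: "subfield K complex_field"
  shows "of_rat s \<in> K"
proof -
  note D = complex_subfieldD[OF K]
  have 0: "0 \<in> K" using D(4)[OF D(1) D(2)[OF D(1)]] by simp
  have n: "of_nat n \<in> K" for n by (induction n) (use 0 D in auto)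
  have z: "of_int z \<in> K" for z
    by (cases z rule: int_cases2) (use n D(2) in auto)
  show ?thesis by (cases s) (use z D in \<open>auto simp: of_rat_rat divide_inverse\<close>)
qed

lemma complex_subfield_subspace:
  assumes K: "subfield K complex_field"
  shows "ratvs.subspace K"
  using complex_subfieldD[OF K] complex_subfield_of_rat[OF K] complex_subfield_of_rat[OF K, of 0]
  by (auto simp: ratvs.subspace_def)

text \<open>
  The complex numbers have infinite dimension over the rationals, so this is stated relative to a finite spanning set.
\<close>

lemma spanning_if_card_dim:
  assumes B: "finite B" "ratvs.span B = V" and I: "ratvs.independent I" "I \<subseteq> V" "card I = card B"
  shows "ratvs.span I = V"
proof (rule ccontr)
  assume "ratvs.span I \<noteq> V"
  moreover have "ratvs.span I \<subseteq> V" using I(2) B(2) by (metis ratvs.span_minimal ratvs.subspace_span)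
  ultimately obtain x where x: "x \<in> V" "x \<notin> ratvs.span I" by blast
  have fI: "finite I" using ratvs.independent_span_bound[OF B(1) I(1)] I(2) B(2) by simp
  have "ratvs.independent (insert x I)" by (rule ratvs.independent_insertI[OF x(2) I(1)])
  then have "card (insert x I) \<le> card B"
    using ratvs.independent_span_bound[OF B(1)] I(2) B(2) x(1) by simp
  moreover have "x \<notin> I" using x(2) ratvs.span_base by blast
  ultimately show False using fI I(3) by simp
qed

text \<open>
  A field of degree 3 has no intermediate field, so every irrational element generates it: were
  \<open>\<alpha>\<close> quadratic, the field would be a vector space over \<open>\<rat>(\<alpha>)\<close> and hence of even degree.
\<close>

lemma cubic_field_generator:
  assumes K: "K \<in> cubic_fields" and \<alpha>: "\<alpha> \<in> K" "\<alpha> \<notin> \<rat>"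
  shows "K = qfield \<alpha>" "quad a b c \<alpha> = 0 \<Longrightarrow> a = 0 \<and> b = 0 \<and> c = 0"
proof -
  have sf: "subfield K complex_field" and dim: "ratvs.dim K = 3" using K by (auto simp: cubic_fields_def)
  note D = complex_subfieldD[OF sf]
  have sub: "ratvs.subspace K" by (rule complex_subfield_subspace[OF sf])
  obtain B where B: "B \<subseteq> K" "ratvs.independent B" "K \<subseteq> ratvs.span B" "card B = 3"
    using ratvs.basis_exists[of K] dim by metis
  have BK: "ratvs.span B = K" using B ratvs.span_minimal[OF B(1) sub] by auto
  have fB: "finite B" using B(4) card.infinite by fastforce
  note irr = irrational_linear_relation[OF \<alpha>(2)]
  have main: "a = 0 \<and> b = 0 \<and> c = 0" if q0: "quad a b c \<alpha> = 0" for a b c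
  proof (cases "c = 0")
    case True
    then show ?thesis using irr q0 by (simp add: quad_def)
  next
    case False
    define u v where "u = - a / c" and "v = - b / c"
    have a2: "\<alpha>^2 = of_rat u + of_rat v * \<alpha>"
      unfolding u_def v_def by (rule quad_0_square[OF q0 False])
    define S where "S = {1, \<alpha>}"
    have S: "ratvs.span S = {of_rat x + of_rat y * \<alpha> | x y. True}"
    proof (intro equalityI subsetI)
      fix y assume "y \<in> ratvs.span S"
      then obtain k where "y - of_rat k * 1 \<in> ratvs.span {\<alpha>}" unfolding S_def ratvs.span_insert[of 1] by blast
      then obtain m where "y - of_rat k * 1 = of_rat m * \<alpha>" by (auto simp: ratvs.span_singleton)
      then have "y = of_rat k + of_rat m * \<alpha>" by (simp add: diff_eq_eq add.commute)
      then show "y \<in> {of_rat x + of_rat y * \<alpha> | x y. True}" by blast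
    next
      fix y assume "y \<in> {of_rat x + of_rat y * \<alpha> | x y. True}"
      then obtain k m where "y = of_rat k * 1 + of_rat m * \<alpha>" by auto
      also have "\<dots> \<in> ratvs.span S" unfolding S_def
        by (intro ratvs.span_add ratvs.span_scale ratvs.span_base) auto
      finally show "y \<in> ratvs.span S" .
    qed
    have "1 \<noteq> \<alpha>" using \<alpha>(2) by auto
    then have cS: "card S = 2" by (simp add: S_def)
    have iS: "ratvs.independent S"
      unfolding S_def
    proof (rule ratvs.independent_insertI)
      show "1 \<notin> ratvs.span {\<alpha>}"
      proof
        assume "1 \<in> ratvs.span {\<alpha>}"
        then obtain y where "1 = of_rat y * \<alpha>" by (auto simp: ratvs.span_singleton)
        then have "of_rat 1 + of_rat (- y) * \<alpha> = 0" by (simp add: of_rat_minus)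
        from irr[OF this] show False by simp
      qed
      have "\<alpha> \<noteq> 0" using \<alpha>(2) by auto
      then show "ratvs.independent {\<alpha>}" by (simp add: ratvs.dependent_single)
    qed
    have "ratvs.span S \<noteq> K"
      using ratvs.dim_span_eq_card_independent[OF iS] cS dim by auto
    moreover have SK: "ratvs.span S \<subseteq> K"
      by (rule ratvs.span_minimal[OF _ sub]) (use D \<alpha> in \<open>auto simp: S_def\<close>)
    ultimately obtain \<gamma> where \<gamma>: "\<gamma> \<in> K" "\<gamma> \<notin> ratvs.span S" by blast
    define T where "T = insert \<gamma> S"
    have "ratvs.independent T" unfolding T_def by (rule ratvs.independent_insertI[OF \<gamma>(2) iS])
    moreover have "T \<subseteq> K" using \<gamma>(1) D \<alpha> by (auto simp: T_def S_def)
    moreover have "card T = card B"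
    proof -
      have "\<gamma> \<notin> S" "finite S" using \<gamma>(2) ratvs.span_base[of \<gamma> S] by (auto simp: S_def)
      then show ?thesis using cS B(4) by (simp add: T_def)
    qed
    ultimately have "ratvs.span T = K" by (rule spanning_if_card_dim[OF fB BK])
    then have "\<alpha> * \<gamma> \<in> ratvs.span T" using D \<alpha> \<gamma> by simp
    then obtain z where "\<alpha> * \<gamma> - of_rat z * \<gamma> \<in> ratvs.span S"
      unfolding T_def ratvs.span_insert by auto
    then obtain x y where xy: "\<alpha> * \<gamma> - of_rat z * \<gamma> = of_rat x + of_rat y * \<alpha>" unfolding S by auto
    \<comment> \<open>up to sign the norm of \<open>\<alpha> - z\<close> over the rationals, by which \<open>\<gamma>\<close> is expressed through \<open>\<alpha>\<close>\<close>
    define n where "n = u - z^2 + v * z"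
    have n: "(\<alpha> - of_rat z) * (\<alpha> + of_rat z - of_rat v) = of_rat n"
    proof -
      have "(\<alpha> - of_rat z) * (\<alpha> + of_rat z - of_rat v) = \<alpha>^2 - of_rat v * \<alpha> - of_rat z^2 + of_rat v * of_rat z"
        by (simp add: algebra_simps power2_eq_square)
      then show ?thesis unfolding a2 by (simp add: n_def of_rat_add of_rat_diff of_rat_mult of_rat_power)
    qed
    have n0: "n \<noteq> 0"
    proof
      assume "n = 0"
      then have "\<alpha> - of_rat z = 0 \<or> \<alpha> + of_rat z - of_rat v = 0" using n by simp
      then have "\<alpha> = of_rat z \<or> \<alpha> = of_rat (v - z)" by (auto simp: of_rat_diff algebra_simps)
      then show False using \<alpha>(2) by auto
    qed
    have "of_rat n * \<gamma> = (\<alpha> + of_rat z - of_rat v) * (\<alpha> * \<gamma> - of_rat z * \<gamma>)"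
      unfolding n[symmetric] by (simp add: algebra_simps)
    also have "\<dots> = of_rat (x * (z - v) + y * u) + of_rat (x + y * z) * \<alpha>"
    proof -
      have "(\<alpha> + of_rat z - of_rat v) * (\<alpha> * \<gamma> - of_rat z * \<gamma>) = of_rat x * \<alpha> + of_rat y * \<alpha>^2 + (of_rat z - of_rat v) * (of_rat x + of_rat y * \<alpha>)"
        unfolding xy by (simp add: algebra_simps power2_eq_square)
      then show ?thesis unfolding a2 by (simp add: of_rat_add of_rat_diff of_rat_mult algebra_simps)
    qed
    finally have "of_rat n * \<gamma> \<in> ratvs.span S" unfolding S by blast
    then have "of_rat (1 / n) * (of_rat n * \<gamma>) \<in> ratvs.span S" by (rule ratvs.span_scale)
    also have "of_rat (1 / n) * (of_rat n * \<gamma>) = \<gamma>" using n0 by (simp add: of_rat_divide)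
    finally show ?thesis using \<gamma>(2) by simp
  qed
  then show "quad a b c \<alpha> = 0 \<Longrightarrow> a = 0 \<and> b = 0 \<and> c = 0" .
  have d: "1 \<noteq> \<alpha>" "1 \<noteq> \<alpha>^2" "\<alpha> \<noteq> \<alpha>^2" and ind: "ratvs.independent {1, \<alpha>, \<alpha>^2}"
    by (rule powers_independent; erule main)+
  have sK: "{1, \<alpha>, \<alpha>^2} \<subseteq> K" using D \<alpha> by (simp add: power2_eq_square)
  have "ratvs.span {1, \<alpha>, \<alpha>^2} = K"
    by (rule spanning_if_card_dim[OF fB BK ind sK]) (simp add: d B(4))
  moreover have "qfield \<alpha> \<subseteq> ratvs.span {1, \<alpha>, \<alpha>^2}" by (auto simp: qfield_def quad_in_span)
  moreover have "ratvs.span {1, \<alpha>, \<alpha>^2} \<subseteq> qfield \<alpha>"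
    by (rule ratvs.span_minimal) (auto simp: ratvs.subspace_def qfield_1 qfield_gen qfield_0 qfield_add qfield_scale)
  ultimately show "K = qfield \<alpha>" by simp
qed

lemma cubic_splits:
  fixes p q r :: complex
  obtains \<rho> :: "complex^3" where "\<And>x. x^3 + p * x^2 + q * x + r = (x - \<rho>$1) * (x - \<rho>$2) * (x - \<rho>$3)"
proof -
  have "\<not> constant (poly [:r, q, p, 1:])" by (simp add: constant_degree)
  then obtain s where "poly [:r, q, p, 1:] s = 0" using Fundamental_Theorem_Algebra.fundamental_theorem_of_algebra by blast
  then have s: "s^3 + p * s^2 + q * s + r = 0" by (simp add: algebra_simps power2_eq_square power3_eq_cube)
  define b c where "b = p + s" and "c = q + s * (p + s)"
  define d where "d = csqrt (b^2 - 4 * c)"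
  have d: "d^2 = b^2 - 4 * c" by (simp add: d_def)
  define t u where "t = (- b + d) / 2" and "u = (- b - d) / 2"
  have tu: "t + u = - b" "t * u = c"
    using d by (simp_all add: t_def u_def field_simps power2_eq_square)
  have "x^3 + p * x^2 + q * x + r = (x - s) * (x - t) * (x - u)" for x
  proof -
    have r: "r = - (s^3 + p * s^2 + q * s)" using s by (simp only: eq_neg_iff_add_eq_0 add_ac)
    have "(x - s) * (x - t) * (x - u) = (x - s) * (x^2 - (t + u) * x + t * u)"
      by (simp add: algebra_simps power2_eq_square)
    also have "\<dots> = x^3 + p * x^2 + q * x + r"
      unfolding tu b_def c_def r by (simp add: algebra_simps power2_eq_square power3_eq_cube)
    finally show ?thesis by simp
  qed
  then show ?thesis by (intro that[of "vector [s, t, u]"]) simp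
qed

lemma rat_common_denominator:
  fixes A B C :: rat
  obtains n a b c :: int where "n > 0" "of_int n * A = of_int a" "of_int n * B = of_int b" "of_int n * C = of_int c"
proof -
  have ex: "\<exists>n a. n > 0 \<and> of_int n * x = of_int (a::int)" for x :: rat
  proof -
    obtain a n where "quotient_of x = (a, n)" by (cases "quotient_of x")
    then have "x = of_int a / of_int n" "n > 0" using quotient_of_div quotient_of_denom_pos by blast+
    then show ?thesis by (intro exI[of _ n] exI[of _ a]) simp
  qed
  obtain n1 a where 1: "n1 > 0" "of_int n1 * A = of_int a" using ex by blast
  obtain n2 b where 2: "n2 > 0" "of_int n2 * B = of_int b" using ex by blast
  obtain n3 c where 3: "n3 > 0" "of_int n3 * C = of_int c" using ex by blast
  show ?thesis
  proof (rule that[of "n1 * n2 * n3" "a * n2 * n3" "n1 * b * n3" "n1 * n2 * c"])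
    show "n1 * n2 * n3 > 0" using 1 2 3 by simp
    show "of_int (n1 * n2 * n3) * A = of_int (a * n2 * n3)" using 1(2) by (simp flip: 1(2))
    show "of_int (n1 * n2 * n3) * B = of_int (n1 * b * n3)" by (simp flip: 2(2))
    show "of_int (n1 * n2 * n3) * C = of_int (n1 * n2 * c)" by (simp flip: 3(2))
  qed
qed

text \<open>
  Multiplying a generator by a common denominator of the coefficients of its minimal polynomial makes
  it integral.
\<close>

lemma cubic_field_cubic_gen:
  assumes K: "K \<in> cubic_fields"
  obtains \<alpha> p q r \<rho> where "cubic_gen \<alpha> p q r \<rho>" "K = qfield \<alpha>"
proof -
  have sf: "subfield K complex_field" and dim: "ratvs.dim K = 3" using K by (auto simp: cubic_fields_def)
  note D = complex_subfieldD[OF sf]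
  have "\<not> K \<subseteq> \<rat>"
  proof
    assume "K \<subseteq> \<rat>"
    then have "K \<subseteq> ratvs.span {1}" by (force simp: ratvs.span_singleton elim!: Rats_cases)
    then show False using ratvs.dim_le_card[of K "{1}"] dim by simp
  qed
  then obtain \<beta> where \<beta>: "\<beta> \<in> K" "\<beta> \<notin> \<rat>" by blast
  note G = cubic_field_generator[OF K \<beta>]
  have "\<beta>^3 \<in> qfield \<beta>" using D(3)[OF D(3)[OF \<beta>(1) \<beta>(1)] \<beta>(1)] unfolding G(1)[symmetric] by (simp add: power3_eq_cube)
  then obtain A B C where ABC: "\<beta>^3 = quad A B C \<beta>" by (rule qfieldE)
  obtain n a b c :: int where n: "n > 0" "of_int n * A = of_int a" "of_int n * B = of_int b" "of_int n * C = of_int c"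
    by (rule rat_common_denominator)
  define \<alpha> where "\<alpha> = of_int n * \<beta>"
  have \<alpha>K: "\<alpha> \<in> K" using D(3)[OF complex_subfield_of_rat[OF sf, of "of_int n"] \<beta>(1)] by (simp add: \<alpha>_def)
  have \<beta>\<alpha>: "\<beta> = \<alpha> / of_int n" using n(1) by (simp add: \<alpha>_def)
  have \<alpha>Q: "\<alpha> \<notin> \<rat>" using \<beta>(2) unfolding \<beta>\<alpha> by (metis Rats_divide Rats_of_int)
  have cn: "of_int n * of_rat A = (of_int a :: complex)" "of_int n * of_rat B = (of_int b :: complex)"
    "of_int n * of_rat C = (of_int c :: complex)"
    using n(2-4) by (metis of_rat_mult of_rat_of_int_eq)+
  have "\<alpha>^3 = of_int n^3 * quad A B C \<beta>" unfolding ABC[symmetric] by (simp add: \<alpha>_def power_mult_distrib)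
  also have "\<dots> = of_int n^2 * (of_int n * of_rat A) + of_int n * (of_int n * of_rat B) * (of_int n * \<beta>)
      + (of_int n * of_rat C) * (of_int n * \<beta>)^2"
    by (simp add: quad_def algebra_simps power2_eq_square power3_eq_cube)
  finally have "\<alpha>^3 = of_int (n^2 * a) + of_int (n * b) * \<alpha> + of_int c * \<alpha>^2"
    unfolding cn \<alpha>_def[symmetric] by simp
  then have eq: "\<alpha>^3 + of_int (- c) * \<alpha>^2 + of_int (- (n * b)) * \<alpha> + of_int (- (n^2 * a)) = 0" by simp
  obtain \<rho> :: "complex^3" where \<rho>: "\<And>x. x^3 + of_int (- c) * x^2 + of_int (- (n * b)) * x + of_int (- (n^2 * a))
      = (x - \<rho>$1) * (x - \<rho>$2) * (x - \<rho>$3)"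
    using cubic_splits by blast
  have "cubic_gen \<alpha> (- c) (- (n * b)) (- (n^2 * a)) \<rho>"
    by unfold_locales (use eq \<rho> cubic_field_generator(2)[OF K \<alpha>K \<alpha>Q] in auto)
  then show ?thesis using that cubic_field_generator(1)[OF K \<alpha>K \<alpha>Q] by blast
qed

lemma finite_cubic_roots: "finite {x :: complex. x^3 + e1 * x^2 + e2 * x + e3 = 0}"
proof -
  have "{x. x^3 + e1 * x^2 + e2 * x + e3 = 0} = {x. poly [:e3, e2, e1, 1:] x = 0}"
    by (simp add: algebra_simps power2_eq_square power3_eq_cube)
  then show ?thesis using poly_roots_finite[of "[:e3, e2, e1, 1:]"] by simp
qed

text \<open>
  The field is determined by the element of \<open>bounded_element\<close>, for which the bounds leave finitely
  many possibilities.
\<close>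

theorem finite_cubic_fields_disc: "finite {K \<in> cubic_fields. cubic_disc K = d}"
proof -
  define L where "L = 1 + sqrt (5 * sqrt (3 * \<bar>real_of_int d\<bar>))"
  define N where "N = \<lceil>3 * L\<rceil> + \<lceil>3 * L^2\<rceil> + \<lceil>L^3\<rceil>"
  have L: "L \<ge> 0" by (simp add: L_def)
  define I where "I = {- N .. N}"
  define Z where "Z = (\<lambda>(e1 :: int, e2 :: int, e3 :: int). {x :: complex. x^3 + of_int e1 * x^2 + of_int e2 * x + of_int e3 = 0})"
  define S where "S = \<Union> (Z ` (I \<times> I \<times> I))"
  have "finite S" unfolding S_def I_def Z_def by (intro finite_Union finite_imageI) (auto simp: finite_cubic_roots)
  moreover have "{K \<in> cubic_fields. cubic_disc K = d} \<subseteq> qfield ` S"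
  proof
    fix K assume "K \<in> {K \<in> cubic_fields. cubic_disc K = d}"
    then have K: "K \<in> cubic_fields" "cubic_disc K = d" by auto
    obtain \<alpha> p q r \<rho> where g: "cubic_gen \<alpha> p q r \<rho>" and K\<alpha>: "K = qfield \<alpha>" using cubic_field_cubic_gen[OF K(1)] .
    interpret cubic_gen \<alpha> p q r \<rho> by (rule g)
    obtain x and e1 e2 e3 :: int where x: "x \<in> K" "x \<notin> \<rat>"
      "x^3 + of_int e1 * x^2 + of_int e2 * x + of_int e3 = 0"
      and e: "\<bar>of_int e1\<bar> \<le> 3 * L" "\<bar>of_int e2\<bar> \<le> 3 * L^2" "\<bar>of_int e3\<bar> \<le> L^3"
      using bounded_element K(2) unfolding K\<alpha>[symmetric] Let_def L_def by metis
    have "3 * L^2 \<ge> 0" "L^3 \<ge> 0" using L by simp_all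
    then have n0: "0 \<le> \<lceil>3 * L\<rceil>" "0 \<le> \<lceil>3 * L^2\<rceil>" "0 \<le> \<lceil>L^3\<rceil>" using L by linarith+
    have "\<bar>e1\<bar> \<le> \<lceil>3 * L\<rceil>" "\<bar>e2\<bar> \<le> \<lceil>3 * L^2\<rceil>" "\<bar>e3\<bar> \<le> \<lceil>L^3\<rceil>" using e by linarith+
    then have "e1 \<in> I" "e2 \<in> I" "e3 \<in> I" using n0 unfolding I_def N_def by auto
    then have "x \<in> S" using x(3) unfolding S_def Z_def by (intro UnionI[OF imageI[of "(e1, e2, e3)"]]) auto
    then show "K \<in> qfield ` S" using cubic_field_generator(1)[OF K(1) x(1,2)] by blast
  qed
  ultimately show ?thesis by (meson finite_imageI finite_subset)
qed

lemma num_cubic_fields_nonzero_iff: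
  "num_cubic_fields d \<noteq> 0 \<longleftrightarrow> (\<exists>K\<in>cubic_fields. cubic_disc K = d)"
proof -
  have "finite ({K \<in> cubic_fields. cubic_disc K = d} // cubic_field_iso)"
    unfolding quotient_def using finite_cubic_fields_disc by auto
  then show ?thesis unfolding num_cubic_fields_def by (auto simp: quotient_def)
qed

context cubic_gen
begin

text \<open>
  Multiplication by a non-zero element is injective, hence surjective on a space of finite
  dimension; this provides the inverses.
\<close>

lemma qfield_cubic_field: "K \<in> cubic_fields"
proof -
  have "subfield K complex_field"
  proof (rule complex_subfieldI)
    show "- x \<in> K" if "x \<in> K" for x using qfield_diff[OF qfield_0 that] by simp
    show "\<exists>y\<in>K. x * y = 1" if x: "x \<in> K" "x \<noteq> 0" for x
    proof -
      have cmb: "of_rat a * x + of_rat b * (x * \<alpha>) + of_rat c * (x * \<alpha>^2) = x * quad a b c \<alpha>" for a b c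
        by (simp add: quad_def algebra_simps)
      have d: "x \<noteq> x * \<alpha>" "x \<noteq> x * \<alpha>^2" "x * \<alpha> \<noteq> x * \<alpha>^2" using E_distinct x(2) by simp_all
      define I where "I = {x, x * \<alpha>, x * \<alpha>^2}"
      have "ratvs.independent I" unfolding I_def
      proof (rule ratvs.independent_if_scalars_zero)
        fix f y assume 0: "(\<Sum>y\<in>{x, x * \<alpha>, x * \<alpha>\<^sup>2}. of_rat (f y) * y) = 0" and y: "y \<in> {x, x * \<alpha>, x * \<alpha>\<^sup>2}"
        have "x * quad (f x) (f (x * \<alpha>)) (f (x * \<alpha>^2)) \<alpha> = 0"
          unfolding cmb[symmetric] using 0 d by (simp add: add.assoc)
        then show "f y = 0" using quad_0 x(2) y by auto
      qed simp
      moreover have "I \<subseteq> K" using x by (auto simp: I_def intro!: K_mult qfield_gen)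
      moreover have "card I = card {1, \<alpha>, \<alpha>^2}"
      proof -
        have "card I = 3" using d by (simp add: I_def)
        then show ?thesis using E_distinct by simp
      qed
      ultimately have "ratvs.span I = K"
        by (rule spanning_if_card_dim[OF _ span_E, rotated]) simp
      then have "1 \<in> ratvs.span I" using qfield_1 by simp
      then obtain f where "1 = (\<Sum>y\<in>I. of_rat (f y) * y)" unfolding I_def by (subst (asm) ratvs.span_finite) auto
      also have "\<dots> = x * quad (f x) (f (x * \<alpha>)) (f (x * \<alpha>^2)) \<alpha>"
        unfolding cmb[symmetric] I_def using d by (simp add: add.assoc)
      finally show ?thesis using qfieldI by metis
    qed
  qed (auto intro: K_mult qfield_add qfield_1)
  then show ?thesis by (simp add: cubic_fields_def dim_K)
qed

end

lemma cubic_gen_of_irreducible: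
  fixes a b :: int
  assumes irr: "\<And>t::int. t^3 + a * t + b \<noteq> 0"
  obtains \<alpha> \<rho> where "cubic_gen \<alpha> 0 a b \<rho>"
proof -
  obtain \<rho> :: "complex^3" where \<rho>: "\<And>x. x^3 + of_int 0 * x^2 + of_int a * x + of_int b
      = (x - \<rho>$1) * (x - \<rho>$2) * (x - \<rho>$3)"
    using cubic_splits by blast
  define \<alpha> where "\<alpha> = \<rho>$1"
  have eq: "\<alpha>^3 + of_int a * \<alpha> + of_int b = 0" using \<rho>[of \<alpha>] by (simp add: \<alpha>_def)
  have norat: "(of_rat s :: complex)^3 + of_int a * of_rat s + of_int b \<noteq> 0" for s
  proof
    assume 0: "(of_rat s :: complex)^3 + of_int a * of_rat s + of_int b = 0"
    then have "algebraic_int (of_rat s :: complex)" using algebraic_int_cubic[of "of_rat s" 0 a b] by simp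
    then obtain n where n: "s = of_int n" by (rule algebraic_int_of_rat)
    have "of_int (n^3 + a * n + b) = (0 :: complex)" using 0 by (simp add: n)
    then show False using irr[of n] by (simp only: of_int_eq_0_iff)
  qed
  have "\<alpha> \<notin> \<rat>" using norat eq by (auto elim: Rats_cases)
  then have irr1: "of_rat x + of_rat y * \<alpha> = 0 \<Longrightarrow> x = 0 \<and> y = 0" for x y
    by (rule irrational_linear_relation)
  have "x = 0 \<and> y = 0 \<and> z = 0" if q0: "quad x y z \<alpha> = 0" for x y z
  proof (cases "z = 0")
    case True
    then show ?thesis using irr1 q0 by (simp add: quad_def)
  next
    case False
    define u v where "u = - x / z" and "v = - y / z"
    have a2: "\<alpha>^2 = of_rat u + of_rat v * \<alpha>"
      unfolding u_def v_def by (rule quad_0_square[OF q0 False])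
    have "of_rat u * of_rat v + of_int b + (of_rat u + of_rat v^2 + of_int a) * \<alpha> = 0"
      using eq a2 by Groebner_Basis.algebra
    then have "of_rat (u * v + of_int b) + of_rat (u + v^2 + of_int a) * \<alpha> = 0"
      by (simp add: of_rat_add of_rat_mult of_rat_power)
    from irr1[OF this] have "u * v + of_int b = 0" "u + v^2 + of_int a = 0" by auto
    then have "(- v)^3 + of_int a * (- v) + of_int b = 0"
      by Groebner_Basis.algebra
    then have "of_rat ((- v)^3 + of_int a * (- v) + of_int b) = (0 :: complex)" by (simp only: of_rat_0)
    then show ?thesis using norat[of "- v"] by (simp only: of_rat_add of_rat_mult of_rat_power of_rat_of_int_eq)
  qed
  then have "cubic_gen \<alpha> 0 a b \<rho>" by unfold_locales (use eq \<rho> in auto)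
  then show ?thesis by (rule that)
qed

section \<open>Primes congruent to 3 modulo 4\<close>

text \<open>
  Otherwise \<open>x\<^sup>2 \<equiv> - y\<^sup>2\<close> could be raised to the odd power \<open>(q - 1)/2\<close>, which gives
  \<open>1 \<equiv> - 1\<close> by Fermat's theorem.
\<close>

lemma prime_3_mod_4_dvd_sum_squares:
  fixes x y :: int
  assumes q: "prime (q::nat)" "q mod 4 = 3" and dv: "int q dvd x^2 + y^2"
  shows "int q dvd x"
proof (rule ccontr)
  assume nx: "\<not> int q dvd x"
  have ny: "\<not> int q dvd y"
  proof
    assume "int q dvd y"
    then have "int q dvd (x^2 + y^2) - y^2" using dv by (intro dvd_diff) (auto simp: power2_eq_square)
    then show False using nx q prime_dvd_power[of "int q" x 2] by simp
  qed
  define h where "h = (q - 1) div 2"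
  have h: "odd h" "2 * h = q - 1" using q(2) unfolding h_def by presburger+
  have fer: "[z^(q-1) = 1] (mod int q)" if "\<not> int q dvd z" for z :: int
  proof -
    have "\<not> q dvd nat \<bar>z\<bar>" using that by (simp add: int_dvd_int_iff[symmetric])
    then have "[nat \<bar>z\<bar> ^ (q-1) = 1] (mod q)" by (rule fermat_theorem[OF q(1)])
    then have "[int (nat \<bar>z\<bar> ^ (q-1)) = int 1] (mod int q)" by (simp only: cong_int_iff)
    then have "[\<bar>z\<bar> ^ (q-1) = 1] (mod int q)" by simp
    moreover have "\<bar>z\<bar> ^ (q-1) = z ^ (q-1)" unfolding h(2)[symmetric] by (simp add: power_mult)
    ultimately show ?thesis by simp
  qed
  have "[x^2 = - (y^2)] (mod int q)" using dv by (simp add: cong_iff_dvd_diff)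
  then have "[(x^2)^h = (- (y^2))^h] (mod int q)" by (rule cong_pow)
  then have "[x^(q-1) = - (y^(q-1))] (mod int q)" using h by (simp add: power_mult[symmetric] power_minus_odd)
  then have "[1 = - 1] (mod int q)"
    using fer[OF nx] cong_uminus[OF fer[OF ny]] by (meson cong_sym cong_trans)
  then have "int q dvd 2" by (simp add: cong_iff_dvd_diff)
  then have "q dvd 2" by (metis int_dvd_int_iff of_nat_numeral)
  then have "q \<le> 2" by (rule dvd_imp_le) simp
  then show False using q(2) by linarith
qed

text \<open>
  Euclid's argument applies to \<open>4 T - 1\<close> with the product \<open>T\<close> of all such primes, because a number
  congruent to 3 modulo 4 has a prime factor congruent to 3.
\<close>

lemma infinite_primes_3_mod_4: "infinite {q::nat. prime q \<and> q mod 4 = 3}"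
proof
  assume fin: "finite {q::nat. prime q \<and> q mod 4 = 3}"
  define T where "T = \<Prod>{q::nat. prime q \<and> q mod 4 = 3}"
  define N where "N = 4 * T - 1"
  have pos: "T > 0" unfolding T_def by (rule prod_pos) (simp add: prime_gt_0_nat)
  obtain u where "T = Suc u" using pos by (cases T) auto
  then have N4: "N mod 4 = 3" unfolding N_def by simp
  have "\<exists>q. prime q \<and> q dvd n \<and> q mod 4 = 3" if "n mod 4 = 3" for n :: nat
    using that
  proof (induction n rule: less_induct)
    case (less n)
    have n1: "n \<noteq> 1" using less.prems by auto
    obtain q where q: "prime q" "q dvd n" using prime_factor_nat[OF n1] by blast
    show ?case
    proof (cases "q mod 4 = 3")
      case True
      then show ?thesis using q by blast
    next
      case False
      obtain m where m: "n = q * m" using q by (auto elim: dvdE)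
      have "odd n" using less.prems by presburger
      then have "odd q" using m by simp
      then have q1: "q mod 4 = 1" using False by presburger
      have "n mod 4 = ((q mod 4) * (m mod 4)) mod 4" unfolding m by (simp add: mod_mult_eq)
      then have "m mod 4 = 3" using less.prems q1 by simp
      moreover have "m > 0" using m less.prems by (cases m) auto
      then have "m < n" using m prime_gt_1_nat[OF q(1)] by simp
      ultimately obtain q' where "prime q'" "q' dvd m" "q' mod 4 = 3" using less.IH by blast
      then show ?thesis using m by auto
    qed
  qed
  then obtain q where q: "prime q" "q dvd N" "q mod 4 = 3" using N4 by blast
  have "q dvd T" unfolding T_def using fin q by (intro dvd_prodI) auto
  then have "q dvd 4 * T - N" using q(2) by (intro dvd_diff_nat) auto
  also have "4 * T - N = 1" using pos by (simp add: N_def)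
  finally show False using q(1) by simp
qed

lemma prime_sequence_3_mod_4:
  obtains q :: "nat \<Rightarrow> nat" where "inj q" "\<And>i. prime (q i)" "\<And>i. q i mod 4 = 3" "\<And>i. q i > 3"
proof -
  define S where "S = {q::nat. prime q \<and> q mod 4 = 3} - {3}"
  have inf: "infinite S" using infinite_primes_3_mod_4 by (simp add: S_def)
  have mem: "enumerate S i \<in> S" for i using enumerate_in_set[OF inf] .
  show ?thesis
  proof (rule that[of "enumerate S"])
    show "inj (enumerate S)" using strict_mono_enumerate[OF inf] by (rule strict_mono_imp_inj_on)
    show "prime (enumerate S i)" "enumerate S i mod 4 = 3" for i using mem[of i] by (auto simp: S_def)
    have "x > 3" if "x mod 4 = 3" "x \<noteq> 3" for x :: nat using that by presburger
    then show "enumerate S i > 3" for i using mem[of i] by (simp add: S_def)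
  qed
qed

lemma exists_power_2_gt: "\<exists>n. (2::int)^n > x"
proof -
  obtain n where "real_of_int x < 2 ^ n" using real_arch_pow[of 2 "real_of_int x"] by auto
  then have "real_of_int x < real_of_int (2 ^ n)" by simp
  then show ?thesis by (metis of_int_less_iff)
qed

section \<open>Fields with prescribed ramification\<close>

context cubic_gen
begin

lemma disc_E_depressed:
  assumes "p = 0"
  shows "disc E = of_int (- 4 * q^3 - 27 * r^2)"
proof -
  have 3: "\<rho>$3 = - \<rho>$1 - \<rho>$2" using vieta(1) assms by (simp add: add_eq_0_iff algebra_simps)
  have q: "of_int q = \<rho>$1 * \<rho>$2 + \<rho>$1 * \<rho>$3 + \<rho>$2 * \<rho>$3" using vieta(2) by simp
  have r: "of_int r = - (\<rho>$1 * \<rho>$2 * \<rho>$3)" using vieta(3) by simp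
  show ?thesis
    by (simp add: disc_def det_E q r) (simp add: 3 algebra_simps power2_eq_square power3_eq_cube)
qed

lemma gen_cube:
  assumes "p = 0"
  shows "\<alpha>^3 = - (of_int q * \<alpha> + of_int r)"
proof -
  have "\<alpha>^3 + (of_int q * \<alpha> + of_int r) = 0" using gen assms by (simp add: add.assoc)
  then show ?thesis by (simp only: eq_neg_iff_add_eq_0)
qed

text \<open>
  At a prime for which the defining polynomial is an Eisenstein polynomial, the powers of the
  generator are a basis of the ring of integers locally.
\<close>

definition divO :: "int \<Rightarrow> complex \<Rightarrow> bool" where
  "divO n x \<longleftrightarrow> (\<exists>y\<in>\<O>. x = of_int n * y)"

lemma divOI: "y \<in> \<O> \<Longrightarrow> divO n (of_int n * y)" by (auto simp: divO_def)

lemma divO_add: "divO n x \<Longrightarrow> divO n y \<Longrightarrow> divO n (x + y)"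
  by (auto simp: divO_def distrib_left[symmetric] intro: O_add)

lemma divO_diff: "divO n x \<Longrightarrow> divO n y \<Longrightarrow> divO n (x - y)"
  by (auto simp: divO_def right_diff_distrib[symmetric] intro: O_diff)

lemma divO_mult: "z \<in> \<O> \<Longrightarrow> divO n x \<Longrightarrow> divO n (z * x)"
  by (auto simp: divO_def mult.left_commute[of z] intro: O_mult)

lemma divO_mult_int: "z \<in> \<O> \<Longrightarrow> n dvd m \<Longrightarrow> divO n (of_int m * z)"
  by (auto simp: mult.assoc elim!: dvdE intro!: divOI O_mult O_of_int)

lemma divO_cancel:
  assumes "coprime n m" "z \<in> \<O>" "divO n (of_int m * z)"
  shows "divO n z"
proof -
  obtain u v where uv: "u * n + v * m = 1" using assms(1) by (metis bezout_int coprime_iff_gcd_eq_1)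
  have "divO n (of_int n * (of_int u * z) + of_int v * (of_int m * z))"
    by (intro divO_add divOI divO_mult O_mult O_of_int assms)
  also have "of_int n * (of_int u * z) + of_int v * (of_int m * z) = of_int (u * n + v * m) * z"
    by (simp add: algebra_simps)
  finally show ?thesis by (simp add: uv)
qed

text \<open>
  If \<open>\<alpha>\<^sup>2 = l y\<close> with an integer \<open>y\<close> of the field, then squaring \<open>\<alpha>\<^sup>3 = - (q \<alpha> + r)\<close> shows that
  \<open>(r/l)\<^sup>2\<close> is divisible by \<open>l\<close> among the integers of the field, and hence among the rational
  integers.
\<close>

lemma eisenstein_not_divO:
  assumes p: "p = 0" and l: "prime (l::int)" "l^2 dvd q" "l dvd r" "\<not> l^2 dvd r"
  shows "\<not> divO l (\<alpha>^2)"
proof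
  assume "divO l (\<alpha>^2)"
  then obtain y where y: "y \<in> \<O>" "\<alpha>^2 = of_int l * y" by (auto simp: divO_def)
  obtain q' r' where qr: "q = l^2 * q'" "r = l * r'" using l by (auto elim!: dvdE)
  have l0: "(of_int l :: complex) \<noteq> 0" using l(1) by auto
  note a3 = gen_cube[OF p]
  have "of_int l^3 * y^3 = (\<alpha>^3)^2" using y(2) by (metis power_mult_distrib power_mult mult.commute)
  also have "\<dots> = of_int l^2 * (of_int l^2 * of_int q'^2 * \<alpha>^2 + 2 * of_int l * of_int q' * of_int r' * \<alpha> + of_int r'^2)"
    unfolding a3 qr by (simp add: algebra_simps power2_eq_square)
  finally have "of_int l^2 * (of_int l * y^3 - (of_int l^2 * of_int q'^2 * \<alpha>^2 + 2 * of_int l * of_int q' * of_int r' * \<alpha> + of_int r'^2)) = 0"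
    by (simp add: algebra_simps power2_eq_square power3_eq_cube)
  then have "of_int l * y^3 = of_int l^2 * of_int q'^2 * \<alpha>^2 + 2 * of_int l * of_int q' * of_int r' * \<alpha> + of_int r'^2"
    using l0 by simp
  then have e: "of_int (r'^2) = of_int l * (y^3 - of_int (l * q'^2) * \<alpha>^2 - of_int (2 * q' * r') * \<alpha>)" (is "_ = _ * ?z")
    by (simp add: algebra_simps power2_eq_square)
  have "?z \<in> \<O>" by (intro O_diff O_mult O_power O_of_int y O_gen)
  moreover have "?z = of_rat (of_int (r'^2) / of_int l)"
    using e l0 by (simp add: of_rat_divide of_rat_power field_simps)
  ultimately have "algebraic_int (of_rat (of_int (r'^2) / of_int l) :: complex)" using OD(2) by metis
  then obtain n where "(of_int (r'^2) / of_int l :: rat) = of_int n" by (rule algebraic_int_of_rat)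
  then have "(of_int (r'^2) :: rat) = of_int (l * n)" using l0 by (simp add: field_simps)
  then have "r'^2 = l * n" by (simp only: of_int_eq_iff)
  then have "l dvd r'" using l(1) prime_dvd_power by (metis dvd_triv_left)
  then show False using l(4) qr(2) by (auto simp: power2_eq_square)
qed

text \<open>
  If \<open>l\<close> divides the index, then some combination of \<open>1, \<alpha>, \<alpha>\<^sup>2\<close> with integer coefficients not
  all divisible by \<open>l\<close> is divisible by \<open>l\<close>. Multiplied by a suitable power of \<open>\<alpha>\<close>, it becomes, up
  to multiples of \<open>l\<close>, a multiple of \<open>\<alpha>\<^sup>2\<close> by an integer prime to \<open>l\<close>.
\<close>

lemma eisenstein_index:
  assumes p: "p = 0" and l: "prime (l::int)" "l^2 dvd q" "l dvd r" "\<not> l^2 dvd r"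
    and W: "\<omega> \<in> \<O>" "\<theta> \<in> \<O>"
    and a1: "\<alpha> = of_int k1 + of_int l1 * \<omega> + of_int m1 * \<theta>"
    and a2: "\<alpha>^2 = of_int k2 + of_int l2 * \<omega> + of_int m2 * \<theta>"
  shows "\<not> l dvd l1 * m2 - l2 * m1"
proof
  assume dv: "l dvd l1 * m2 - l2 * m1"
  have copr: "coprime l n" if "\<not> l dvd n" for n using prime_imp_coprime l(1) that by blast
  note a3 = gen_cube[OF p]
  have lq: "l dvd q" using l(2) by (auto simp: power2_eq_square elim: dvd_mult_left)
  have d3: "divO l (of_int n * \<alpha>^3)" for n
  proof -
    have "divO l (of_int (- n * q) * \<alpha> + of_int (- n * r) * 1)"
      by (intro divO_add divO_mult_int O_gen O_1) (use lq l(3) in auto)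
    also have "of_int (- n * q) * \<alpha> + of_int (- n * r) * 1 = of_int n * \<alpha>^3"
      unfolding a3 by (simp add: algebra_simps)
    finally show ?thesis .
  qed
  have nd: "\<not> divO l (of_int n * \<alpha>^2)" if "\<not> l dvd n" for n
    using divO_cancel[OF copr[OF that]] eisenstein_not_divO[OF p l] O_power[OF O_gen] by blast
  have no: "l dvd x \<and> l dvd y \<and> l dvd z"
    if d: "divO l (of_int x + of_int y * \<alpha> + of_int z * \<alpha>^2)" for x y z
  proof -
    have "divO l (\<alpha>^2 * (of_int x + of_int y * \<alpha> + of_int z * \<alpha>^2) - of_int y * \<alpha>^3 - \<alpha> * (of_int z * \<alpha>^3))"
      by (intro divO_diff divO_mult d d3 O_gen O_power)
    also have "\<alpha>^2 * (of_int x + of_int y * \<alpha> + of_int z * \<alpha>^2) - of_int y * \<alpha>^3 - \<alpha> * (of_int z * \<alpha>^3) = of_int x * \<alpha>^2"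
      by (simp add: algebra_simps power2_eq_square power3_eq_cube)
    finally have x: "l dvd x" using nd by blast
    have "divO l (\<alpha> * ((of_int x + of_int y * \<alpha> + of_int z * \<alpha>^2) - of_int x * 1) - of_int z * \<alpha>^3)"
      by (intro divO_diff divO_mult divO_mult_int d d3 O_gen O_1 x)
    also have "\<alpha> * ((of_int x + of_int y * \<alpha> + of_int z * \<alpha>^2) - of_int x * 1) - of_int z * \<alpha>^3 = of_int y * \<alpha>^2"
      by (simp add: algebra_simps power2_eq_square power3_eq_cube)
    finally have y: "l dvd y" using nd by blast
    have "divO l ((of_int x + of_int y * \<alpha> + of_int z * \<alpha>^2) - of_int x * 1 - of_int y * \<alpha>)"
      by (intro divO_diff divO_mult_int d O_gen O_1 x y)
    also have "(of_int x + of_int y * \<alpha> + of_int z * \<alpha>^2) - of_int x * 1 - of_int y * \<alpha> = of_int z * \<alpha>^2" by simp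
    finally have "l dvd z" using nd by blast
    with x y show ?thesis by simp
  qed
  have yz: "l dvd y \<and> l dvd z" if "l dvd y * l1 + z * l2" "l dvd y * m1 + z * m2" for y z
  proof -
    have "divO l (of_int (y * l1 + z * l2) * \<omega> + of_int (y * m1 + z * m2) * \<theta>)"
      by (intro divO_add divO_mult_int W that)
    also have "of_int (y * l1 + z * l2) * \<omega> + of_int (y * m1 + z * m2) * \<theta>
        = of_int (- y * k1 - z * k2) + of_int y * \<alpha> + of_int z * \<alpha>^2"
      unfolding a2 by (subst a1) (simp add: algebra_simps)
    finally show ?thesis using no by blast
  qed
  have "l dvd l2 * m1 - l1 * m2" using dv by (metis dvd_minus_iff minus_diff_eq)
  then have 1: "l dvd l1" "l dvd l2" using yz[of l2 "- l1"] by (simp_all add: mult.commute)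
  have 2: "l dvd m1" "l dvd m2" using yz[of m2 "- m1"] dv by (simp_all add: mult.commute)
  have "l dvd 1" using yz[of 1 0] 1 2 by simp
  then show False using l(1) by auto
qed

lemma disc_E_index:
  assumes p: "p = 0"
  obtains m where "- 4 * q^3 - 27 * r^2 = m^2 * cubic_disc K"
    "\<And>l::int. prime l \<Longrightarrow> l^2 dvd q \<Longrightarrow> l dvd r \<Longrightarrow> \<not> l^2 dvd r \<Longrightarrow> \<not> l dvd m"
proof -
  obtain \<omega> \<theta> a b c d where F: "form_basis \<omega> \<theta> a b c d" using form_basis_exists by blast
  note D = form_basisD[OF F]
  obtain k1 l1 m1 where a1: "\<alpha> = of_int k1 + of_int l1 * \<omega> + of_int m1 * \<theta>" using D(6)[OF O_gen] by blast
  obtain k2 l2 m2 where a2: "\<alpha>^2 = of_int k2 + of_int l2 * \<omega> + of_int m2 * \<theta>" using D(6)[OF O_power[OF O_gen]] by blast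
  \<comment> \<open>the determinant of this matrix is the index of the order generated by \<open>\<alpha>\<close>, up to sign\<close>
  define A :: "rat^3^3" where
    "A = vector [vector [1,0,0], vector [of_int k1, of_int l1, of_int m1], vector [of_int k2, of_int l2, of_int m2]]"
  define m where "m = l1 * m2 - l2 * m1"
  have "E = combm A (bas \<omega> \<theta>)"
    by (simp add: Finite_Cartesian_Product.vec_eq_iff forall_3 combm_def comb_def sum_3 A_def bas_def E_def a2)
      (rule a1)
  then have "disc E = of_rat (det A)^2 * disc (bas \<omega> \<theta>)" using disc_combm[OF inK_bas[OF D(3,4)]] by simp
  also have "det A = of_int m" by (simp add: det_3 A_def m_def)
  finally have "of_int (- 4 * q^3 - 27 * r^2) = (of_int (m^2 * cubic_disc K) :: complex)"
    by (simp only: disc_E_depressed[OF p] form_basis_disc[OF F] cubic_disc_form_basis[OF F] of_rat_of_int_eq of_int_mult of_int_power)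
  then have 1: "- 4 * q^3 - 27 * r^2 = m^2 * cubic_disc K" by (simp only: of_int_eq_iff)
  show ?thesis
  proof (rule that[OF 1])
    fix l :: int assume "prime l" "l^2 dvd q" "l dvd r" "\<not> l^2 dvd r"
    from eisenstein_index[OF p this D(1,2) a1 a2] show "\<not> l dvd m" unfolding m_def .
  qed
qed

end

lemma eisenstein_cubic_field:
  fixes a b :: int
  assumes l0: "prime (l0::int)" "l0^2 dvd a" "l0 dvd b" "\<not> l0^2 dvd b"
  obtains K m where "K \<in> cubic_fields" "- 4 * a^3 - 27 * b^2 = m^2 * cubic_disc K"
    "\<And>l::int. prime l \<Longrightarrow> l^2 dvd a \<Longrightarrow> l dvd b \<Longrightarrow> \<not> l^2 dvd b \<Longrightarrow> \<not> l dvd m"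
proof -
  have irr: "t^3 + a * t + b \<noteq> 0" for t
  proof
    assume 0: "t^3 + a * t + b = 0"
    have la: "l0 dvd a" using l0(2) by (auto simp: power2_eq_square elim: dvd_mult_left)
    have "t^3 = - (a * t + b)" using 0 by simp
    also have "l0 dvd \<dots>" using la l0(3) by simp
    finally have "l0 dvd t" using l0(1) prime_dvd_power by blast
    then have "l0^2 dvd t^2" by simp
    then have "l0^2 dvd t^2 * t + a * t" using l0(2) by (intro dvd_add dvd_mult2)
    also have "t^2 * t + a * t = - b" using 0 by (simp add: power2_eq_square power3_eq_cube)
    finally show False using l0(4) by simp
  qed
  obtain \<alpha> \<rho> where g: "cubic_gen \<alpha> 0 a b \<rho>" using cubic_gen_of_irreducible[OF irr] by blast
  interpret cubic_gen \<alpha> 0 a b \<rho> by (rule g)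
  obtain m where "- 4 * a^3 - 27 * b^2 = m^2 * cubic_disc K"
    "\<And>l::int. prime l \<Longrightarrow> l^2 dvd a \<Longrightarrow> l dvd b \<Longrightarrow> \<not> l^2 dvd b \<Longrightarrow> \<not> l dvd m"
    using disc_E_index by blast
  then show ?thesis using that qfield_cubic_field by blast
qed

lemma cubic_fields_disc_square:
  assumes "K \<in> cubic_fields" "prime q" "q > 3" "cubic_disc K = q^2 * e"
  shows "\<exists>t. q dvd 3 * e + t^2"
proof -
  obtain \<alpha> p c r \<rho> where g: "cubic_gen \<alpha> p c r \<rho>" and K: "K = qfield \<alpha>"
    using cubic_field_cubic_gen[OF assms(1)] .
  show ?thesis using cubic_gen.cubic_disc_square_factor[OF g assms(2,3)] assms(4) K by simp
qed

text \<open>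
  The field is generated by a root of \<open>x\<^sup>3 + a x + b\<close>. The choice of \<open>a\<close> as \<open>- 3\<close> times a square makes
  the discriminant of the polynomial \<open>108\<close> times a square modulo the divisors of \<open>b\<close>, so that \<open>- 3\<close> times it is
  \<open>- 1\<close> times a square, and it also makes it 27 times a difference of two squares, whose sign the powers of 2 control.
\<close>

lemma cubic_field_prescribed:
  fixes q :: "nat \<Rightarrow> nat" and s :: int
  assumes inj: "inj q" and pr: "\<And>i. prime (q i)" and q4: "\<And>i. q i mod 4 = 3" and q3: "\<And>i. q i > 3"
    and s: "s = 1 \<or> s = -1" and i: "0 < i" "i < n"
  obtains D where "s * D > 0" "\<And>l. l < n \<Longrightarrow> \<not> int (q l) dvd D" "\<And>t. \<not> int (q i) dvd 3 * D + t^2"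
    "\<exists>K\<in>cubic_fields. cubic_disc K = D * (\<Prod>l<i. int (q l))^2"
proof -
  define P where "P = (\<Prod>l<i. int (q l))"
  define Q where "Q = (\<Prod>l<n. int (q l))"
  have pri: "prime (int (q l))" for l using pr by simp
  have small: "\<not> int (q l) dvd 2" "\<not> int (q l) dvd 3" for l
    using prime_not_dvd_small[of "int (q l)"] q3[of l] by simp_all
  have pow2: "\<not> int (q l) dvd 2^x" for l x using small(1)[of l] pri prime_dvd_power by blast
  have pos: "P > 0" "Q > 0" unfolding P_def Q_def using pri by (auto intro!: prod_pos prime_gt_0_nat pr)
  have dvd_iff: "q l dvd q j \<longleftrightarrow> l = j" for l j
    using primes_dvd_imp_eq[OF pr pr] inj by (auto simp: inj_def)
  have prod_dvd: "int (q l) dvd (\<Prod>j\<in>J. int (q j)) \<longleftrightarrow> l \<in> J" if "finite J" for l J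
    using that pri[of l] by (auto simp: prime_dvd_prod_iff dvd_iff)
  have Pdvd: "int (q l) dvd P \<longleftrightarrow> l < i" for l unfolding P_def by (simp add: prod_dvd)
  obtain x y where xy: "s * (2 * P^3 * (2^x)^3 - Q * 2^y) > 0"
  proof (cases "s = 1")
    case True
    obtain x where x: "(2::int)^x > Q" using exists_power_2_gt by blast
    have "Q < 2^x" by (rule x)
    also have "(2::int)^x \<le> (2^x)^3" by (rule self_le_power) auto
    also have "\<dots> \<le> 2 * P^3 * (2^x)^3" using pos by (simp add: int_one_le_iff_zero_less mult_le_cancel_right1)
    finally have "s * (2 * P^3 * (2^x)^3 - Q * 2^0) > 0" using True by simp
    then show ?thesis by (rule that)
  next
    case False
    obtain y where y: "(2::int)^y > 2 * P^3" using exists_power_2_gt by blast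
    have "2 * P^3 < 2^y" by (rule y)
    also have "(2::int)^y \<le> Q * 2^y" using pos by (simp add: int_one_le_iff_zero_less mult_le_cancel_right1)
    finally have "s * (2 * P^3 * (2^0)^3 - Q * 2^y) > 0" using False s by simp
    then show ?thesis by (rule that)
  qed
  define M N where "M = (2::int)^x" and "N = (2::int)^y"
  define a b where "a = - 3 * P^2 * M^2" and "b = Q * N"
  have MN: "\<not> int (q l) dvd M" "\<not> int (q l) dvd N" for l using pow2 by (auto simp: M_def N_def)
  have df: "- 4 * a^3 - 27 * b^2 = 27 * (4 * P^6 * M^6 - Q^2 * N^2)"
    by (simp add: a_def b_def power_mult_distrib power_mult[symmetric])
  have b_rest: "\<exists>Q'. Q = int (q l) * Q' \<and> \<not> int (q l) dvd Q'" if "l < n" for l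
  proof (intro exI conjI)
    show "Q = int (q l) * (\<Prod>j\<in>{..<n} - {l}. int (q j))" unfolding Q_def using that by (simp add: prod.remove)
    show "\<not> int (q l) dvd (\<Prod>j\<in>{..<n} - {l}. int (q j))" by (simp add: prod_dvd)
  qed
  have eis: "int (q l)^2 dvd a" "int (q l) dvd b" "\<not> int (q l)^2 dvd b" if l: "l < i" for l
  proof -
    have "int (q l) dvd P" using Pdvd l by simp
    then have "int (q l)^2 dvd P^2" by simp
    then have "int (q l)^2 dvd P^2 * (- 3 * M^2)" by (rule dvd_mult2)
    then show "int (q l)^2 dvd a" by (simp add: a_def mult_ac)
    obtain Q' where Q': "Q = int (q l) * Q'" "\<not> int (q l) dvd Q'" using b_rest[of l] l i by auto
    show "int (q l) dvd b" by (simp add: b_def Q')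
    show "\<not> int (q l)^2 dvd b"
    proof
      assume "int (q l)^2 dvd b"
      then have "int (q l) dvd Q' * N" using prime_gt_0_nat[OF pr, of l] by (simp add: b_def Q'(1) power2_eq_square mult.assoc)
      then show False using pri Q'(2) MN by (simp add: prime_dvd_mult_iff)
    qed
  qed
  obtain K m where K: "K \<in> cubic_fields" "- 4 * a^3 - 27 * b^2 = m^2 * cubic_disc K"
    and m: "\<And>l::int. prime l \<Longrightarrow> l^2 dvd a \<Longrightarrow> l dvd b \<Longrightarrow> \<not> l^2 dvd b \<Longrightarrow> \<not> l dvd m"
    using eisenstein_cubic_field[OF pri eis[OF i(1)]] by blast
  have "coprime P m" unfolding P_def
    by (intro prod_coprime_left prime_imp_coprime pri m eis) auto
  then have cop: "coprime (P^2) (m^2)" by simp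
  have "P dvd Q" unfolding P_def Q_def using i by (intro prod_dvd_prod_subset) auto
  then obtain Q1 where Q1: "Q = P * Q1" by (auto elim: dvdE)
  have "m^2 * cubic_disc K = P^2 * (27 * (4 * P^4 * M^6 - Q1^2 * N^2))"
    unfolding K(2)[symmetric] df Q1 by (simp add: algebra_simps power_numeral_reduce)
  then have "P^2 dvd m^2 * cubic_disc K" by simp
  then have "P^2 dvd cubic_disc K" using cop by (simp only: coprime_dvd_mult_right_iff)
  then obtain D where D: "cubic_disc K = P^2 * D" by (auto elim: dvdE)
  have dD: "27 * (4 * P^6 * M^6 - Q^2 * N^2) = m^2 * (P^2 * D)" using K(2) unfolding df D .
  show ?thesis
  proof (rule that[of D])
    show "\<exists>K\<in>cubic_fields. cubic_disc K = D * (\<Prod>l<i. int (q l))^2"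
      using K(1) D by (auto simp: P_def mult.commute)
    have "s * (27 * (4 * P^6 * M^6 - Q^2 * N^2)) = 27 * ((s * (2 * P^3 * M^3 - Q * N)) * (2 * P^3 * M^3 + Q * N))"
      by (simp add: algebra_simps power_numeral_reduce)
    also have "\<dots> > 0"
    proof -
      have "2 * P^3 * M^3 + Q * N > 0" using pos by (intro add_pos_pos mult_pos_pos) (auto simp: M_def N_def)
      then show ?thesis using xy by (simp add: M_def N_def)
    qed
    finally have "0 < (m * P)^2 * (s * D)" unfolding dD by (simp add: power_mult_distrib mult_ac)
    then show "s * D > 0" by (metis zero_less_mult_pos zero_le_power2 order_le_less mult_zero_left less_irrefl)
    show "\<not> int (q l) dvd D" if l: "l < n" for l
    proof
      assume lD: "int (q l) dvd D"
      obtain Q' where Q': "Q = int (q l) * Q'" "\<not> int (q l) dvd Q'" using b_rest l by blast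
      show False
      proof (cases "l < i")
        case True
        then obtain P' where P': "P = int (q l) * P'" using Pdvd by (auto elim: dvdE)
        have "int (q l)^2 * (27 * (4 * int (q l)^4 * P'^6 * M^6 - Q'^2 * N^2)) = int (q l)^2 * (m^2 * (P'^2 * D))"
          using dD unfolding P' Q'(1) by (simp add: algebra_simps power_numeral_reduce)
        then have "27 * (4 * int (q l)^4 * P'^6 * M^6 - Q'^2 * N^2) = m^2 * (P'^2 * D)"
          using prime_gt_0_nat[OF pr, of l] by simp
        then have "3 * (3 * (3 * (Q'^2 * N^2))) = int (q l) * (108 * int (q l)^3 * P'^6 * M^6) - m^2 * (P'^2 * D)"
          by (simp add: algebra_simps power_numeral_reduce)
        also have "int (q l) dvd \<dots>" using lD by simp
        finally show False using pri small Q'(2) MN by (simp only: prime_dvd_mult_iff) (auto dest: prime_dvd_power[OF pri])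
      next
        case False
        have "2 * (2 * (3 * (3 * (3 * (P^6 * M^6))))) = m^2 * (P^2 * D) + 27 * Q^2 * N^2" using dD by simp
        also have "int (q l) dvd \<dots>" using lD Q'(1) by (simp add: power2_eq_square)
        finally show False using pri small False Pdvd MN by (simp only: prime_dvd_mult_iff) (auto dest: prime_dvd_power[OF pri])
      qed
    qed
    show "\<not> int (q i) dvd 3 * D + t^2" for t
    proof
      assume "int (q i) dvd 3 * D + t^2"
      then have "int (q i) dvd (3 * D + t^2) * (m * P)^2" by (rule dvd_mult2)
      also have "(3 * D + t^2) * (m * P)^2 = 3 * (m^2 * (P^2 * D)) + (m * P * t)^2"
        by (simp add: algebra_simps power2_eq_square)
      also have "\<dots> = ((18 * P^3 * M^3)^2 + (m * P * t)^2) - 81 * Q^2 * N^2"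
        unfolding dD[symmetric] by (simp add: power_mult_distrib power_mult[symmetric])
      finally have 1: "int (q i) dvd ((18 * P^3 * M^3)^2 + (m * P * t)^2) - 81 * Q^2 * N^2" .
      have "int (q i) dvd Q" unfolding Q_def using i by (simp add: prod_dvd)
      then have "int (q i) dvd 81 * Q^2 * N^2" by (simp add: power2_eq_square)
      with 1 have "int (q i) dvd (18 * P^3 * M^3)^2 + (m * P * t)^2" by (metis dvd_add diff_add_cancel)
      then have "int (q i) dvd 18 * P^3 * M^3" by (rule prime_3_mod_4_dvd_sum_squares[OF pr q4])
      then have "int (q i) dvd 2 * (3 * (3 * (P^3 * M^3)))" by (simp add: mult.assoc)
      then show False using pri small Pdvd MN by (simp only: prime_dvd_mult_iff) (auto dest: prime_dvd_power[OF pri])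
    qed
  qed
qed

section \<open>The rank argument\<close>

text \<open>
  A homogeneous linear system with fewer equations than unknowns has a non-trivial solution, by
  elimination of one unknown and one equation.
\<close>

lemma nontrivial_linear_relation:
  fixes v :: "'a \<Rightarrow> 'b \<Rightarrow> complex"
  assumes "finite L" "finite I" "card L < card I"
  shows "\<exists>u. (\<exists>i\<in>I. u i \<noteq> 0) \<and> (\<forall>l\<in>L. (\<Sum>i\<in>I. u i * v i l) = 0)"
  using assms
proof (induction L arbitrary: I v rule: finite_induct)
  case empty
  then have "I \<noteq> {}" by auto
  then show ?case by (intro exI[of _ "\<lambda>_. 1"]) auto
next
  case (insert l0 L)
  show ?case
  proof (cases "\<forall>i\<in>I. v i l0 = 0")
    case True
    have "card L < card I" using insert by simp
    then obtain u where "\<exists>i\<in>I. u i \<noteq> 0" "\<forall>l\<in>L. (\<Sum>i\<in>I. u i * v i l) = 0"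
      using insert.IH[OF insert.prems(1)] by blast
    then show ?thesis using True by (intro exI[of _ u]) auto
  next
    case False
    then obtain i0 where i0: "i0 \<in> I" "v i0 l0 \<noteq> 0" by blast
    define J where "J = I - {i0}"
    define w where "w i l = v i l - v i l0 / v i0 l0 * v i0 l" for i l
    have fJ: "finite J" using insert.prems by (simp add: J_def)
    have "card L < card J" using insert i0 by (simp add: J_def)
    then obtain u where u: "\<exists>i\<in>J. u i \<noteq> 0" "\<forall>l\<in>L. (\<Sum>i\<in>J. u i * w i l) = 0"
      using insert.IH[OF fJ, of w] by blast
    define c where "c = - (\<Sum>i\<in>J. u i * v i l0) / v i0 l0"
    define u' where "u' = u(i0 := c)"
    have sum: "(\<Sum>i\<in>I. u' i * v i l) = c * v i0 l + (\<Sum>i\<in>J. u i * v i l)" for l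
    proof -
      have "(\<Sum>i\<in>I. u' i * v i l) = u' i0 * v i0 l + (\<Sum>i\<in>J. u' i * v i l)"
        unfolding J_def by (rule sum.remove[OF insert.prems(1) i0(1)])
      also have "(\<Sum>i\<in>J. u' i * v i l) = (\<Sum>i\<in>J. u i * v i l)"
        by (rule sum.cong) (auto simp: u'_def J_def)
      finally show ?thesis by (simp add: u'_def)
    qed
    have "(\<Sum>i\<in>I. u' i * v i l) = 0" if "l \<in> L" for l
    proof -
      have "0 = (\<Sum>i\<in>J. u i * w i l)" using u(2) that by simp
      also have "\<dots> = (\<Sum>i\<in>J. u i * v i l) - (\<Sum>i\<in>J. u i * v i l0) / v i0 l0 * v i0 l"
        by (simp add: w_def right_diff_distrib sum_subtractf sum_divide_distrib sum_distrib_left sum_distrib_right mult_ac)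
      finally show ?thesis unfolding sum by (simp add: c_def)
    qed
    moreover have "(\<Sum>i\<in>I. u' i * v i l0) = 0" unfolding sum using i0(2) by (simp add: c_def)
    moreover have "\<exists>i\<in>I. u' i \<noteq> 0" using u(1) by (auto simp: u'_def J_def)
    ultimately show ?thesis by blast
  qed
qed

text \<open>
  A matrix of rank at most \<open>k\<close> is not triangular of size \<open>k + 1\<close> with non-zero diagonal.
\<close>

lemma triangular_rank:
  fixes A :: "nat \<Rightarrow> nat \<Rightarrow> complex"
  assumes "\<And>i j. i \<in> {1..k+1} \<Longrightarrow> j \<in> {1..k+1} \<Longrightarrow> A i j = (\<Sum>l=1..k. x i l * y l j)"
    and zero: "\<And>i j. i \<in> {1..k+1} \<Longrightarrow> j \<in> {1..k+1} \<Longrightarrow> i < j \<Longrightarrow> A i j = 0"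
  shows "\<exists>i\<in>{1..k+1}. A i i = 0"
proof -
  obtain u where u: "\<exists>i\<in>{1..k+1}. u i \<noteq> 0" "\<forall>l\<in>{1..k}. (\<Sum>i\<in>{1..k+1}. u i * x i l) = 0"
    using nontrivial_linear_relation[of "{1..k}" "{1..k+1}" x] by auto
  \<comment> \<open>Only the diagonal entry survives in column \<open>j\<close> of the relation between the rows.\<close>
  define j where "j = Max {i\<in>{1..k+1}. u i \<noteq> 0}"
  have "j \<in> {i\<in>{1..k+1}. u i \<noteq> 0}" unfolding j_def by (rule Max_in) (use u(1) in auto)
  then have j: "j \<in> {1..k+1}" "u j \<noteq> 0" by auto
  have above: "u i = 0" if "i \<in> {1..k+1}" "i > j" for i
  proof (rule ccontr)
    assume "u i \<noteq> 0"
    then have "i \<le> j" unfolding j_def using that by (intro Max_ge) auto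
    then show False using that by simp
  qed
  have "(\<Sum>i\<in>{1..k+1}. u i * A i j) = (\<Sum>i\<in>{1..k+1}. \<Sum>l=1..k. u i * x i l * y l j)"
    using assms(1) j by (intro sum.cong) (auto simp: sum_distrib_left mult.assoc)
  also have "\<dots> = (\<Sum>l=1..k. \<Sum>i\<in>{1..k+1}. u i * x i l * y l j)" by (rule sum.swap)
  also have "\<dots> = (\<Sum>l=1..k. (\<Sum>i\<in>{1..k+1}. u i * x i l) * y l j)" by (simp only: sum_distrib_right)
  also have "\<dots> = 0" using u(2) by simp
  finally have "0 = (\<Sum>i\<in>{1..k+1}. u i * A i j)" by simp
  also have "\<dots> = (\<Sum>i\<in>{1..k+1}. if i = j then u j * A j j else 0)"
  proof (intro sum.cong refl)
    fix i assume "i \<in> {1..k+1}"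
    then show "u i * A i j = (if i = j then u j * A j j else 0)"
      using zero[of i j] above[of i] j by (cases i j rule: linorder_cases) auto
  qed
  also have "\<dots> = u j * A j j" using j by simp
  finally show ?thesis using j by auto
qed

text \<open>
  By the residue condition for discriminants divisible by \<open>q\<^sup>2\<close>, where the square of \<open>g\<close> does not
  matter for being a residue.
\<close>

lemma num_cubic_fields_eq_0:
  fixes q g D :: int
  assumes q: "prime q" "q > 3" and D: "\<And>t. \<not> q dvd 3 * D + t^2" and g: "coprime q g"
  shows "num_cubic_fields (D * (q * g)^2) = 0"
proof (rule ccontr)
  assume "num_cubic_fields (D * (q * g)^2) \<noteq> 0"
  then obtain K where K: "K \<in> cubic_fields" "cubic_disc K = D * (q * g)^2"
    unfolding num_cubic_fields_nonzero_iff by blast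
  have "cubic_disc K = q^2 * (D * g^2)" using K(2) by (simp add: power_mult_distrib)
  then obtain t where t: "q dvd 3 * (D * g^2) + t^2" using cubic_fields_disc_square[OF K(1) q] by blast
  have "\<not> q dvd g" using g q(1) by (metis coprime_absorb_left not_prime_unit)
  then obtain h where h: "q dvd g * h + (- 1)" using linear_congruence_solvable[OF q(1)] by blast
  have "q dvd (3 * (D * g^2) + t^2) * h^2 - (g * h + (- 1)) * (3 * D * (g * h + 1))"
    using t h by (intro dvd_diff dvd_mult2)
  also have "(3 * (D * g^2) + t^2) * h^2 - (g * h + (- 1)) * (3 * D * (g * h + 1)) = 3 * D + (t * h)^2"
    by (simp add: algebra_simps power2_eq_square)
  finally show False using D by blast
qed

theorem mainTheorem2:
  fixes s :: int
  assumes "s = 1 \<or> s = -1"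
  shows "\<not> (\<exists>(k::nat) (c :: nat \<Rightarrow> real) (b :: nat \<Rightarrow> nat \<Rightarrow> complex).
           k \<ge> 1 \<and> (\<forall>i\<in>{1..k}. multiplicative (b i)) \<and>
           (\<forall>n\<ge>1. of_nat (num_cubic_fields (s * int n)) = (\<Sum>i=1..k. of_real (c i) * b i n)))"
proof
  assume "\<exists>(k::nat) (c :: nat \<Rightarrow> real) (b :: nat \<Rightarrow> nat \<Rightarrow> complex).
           k \<ge> 1 \<and> (\<forall>i\<in>{1..k}. multiplicative (b i)) \<and>
           (\<forall>n\<ge>1. of_nat (num_cubic_fields (s * int n)) = (\<Sum>i=1..k. of_real (c i) * b i n))"
  then obtain k and c :: "nat \<Rightarrow> real" and b :: "nat \<Rightarrow> nat \<Rightarrow> complex" where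
    mult: "\<And>l. l \<in> {1..k} \<Longrightarrow> multiplicative (b l)" and
    rep: "\<And>n. n \<ge> 1 \<Longrightarrow> of_nat (num_cubic_fields (s * int n)) = (\<Sum>l=1..k. of_real (c l) * b l n)"
    by blast
  obtain q :: "nat \<Rightarrow> nat" where q: "inj q" "\<And>i. prime (q i)" "\<And>i. q i mod 4 = 3" "\<And>i. q i > 3"
    using prime_sequence_3_mod_4 by blast
  define f where "f j = (\<Prod>l<j. q l)" for j
  have intf: "int (f j) = (\<Prod>l<j. int (q l))" for j by (simp add: f_def)
  have "\<exists>D. s * D > 0 \<and> (\<forall>l<k+2. \<not> int (q l) dvd D) \<and> (\<forall>t. \<not> int (q i) dvd 3 * D + t^2)
      \<and> (\<exists>K\<in>cubic_fields. cubic_disc K = D * int (f i)^2)" if "i \<in> {1..k+1}" for i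
  proof -
    obtain D where "s * D > 0" "\<And>l. l < k+2 \<Longrightarrow> \<not> int (q l) dvd D" "\<And>t. \<not> int (q i) dvd 3 * D + t^2"
      "\<exists>K\<in>cubic_fields. cubic_disc K = D * (\<Prod>l<i. int (q l))^2"
      using cubic_field_prescribed[OF q assms, of i "k+2"] \<open>i \<in> {1..k+1}\<close> by auto
    then show ?thesis unfolding intf by blast
  qed
  then obtain D where D: "\<And>i. i \<in> {1..k+1} \<Longrightarrow> s * D i > 0"
    "\<And>i l. i \<in> {1..k+1} \<Longrightarrow> l < k+2 \<Longrightarrow> \<not> int (q l) dvd D i"
    "\<And>i t. i \<in> {1..k+1} \<Longrightarrow> \<not> int (q i) dvd 3 * D i + t^2"
    "\<And>i. i \<in> {1..k+1} \<Longrightarrow> \<exists>K\<in>cubic_fields. cubic_disc K = D i * int (f i)^2"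
    by metis
  define A where "A i j = (of_nat (num_cubic_fields (D i * int (f j)^2)) :: complex)" for i j
  define d where "d i = nat \<bar>D i\<bar>" for i
  have sd: "s * int (d i) = D i" if "i \<in> {1..k+1}" for i
    using D(1)[OF that] assms by (auto simp: d_def)
  have fpos: "f j > 0" for j using q(2) by (auto simp: f_def intro!: prod_pos prime_gt_0_nat)
  have "A i j = (\<Sum>l=1..k. (of_real (c l) * b l (d i)) * b l (f j^2))"
    if i: "i \<in> {1..k+1}" and j: "j \<in> {1..k+1}" for i j
  proof -
    have dpos: "d i > 0" using D(1)[OF i] by (auto simp: d_def)
    have "coprime (int (d i)) (int (f j))" unfolding intf
    proof (rule prod_coprime_right)
      fix l assume "l \<in> {..<j}"
      then have "\<not> int (q l) dvd int (d i)" using D(2)[OF i, of l] j by (simp add: d_def)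
      then have "coprime (int (q l)) (int (d i))" using q(2) by (intro prime_imp_coprime) auto
      then show "coprime (int (d i)) (int (q l))" by (simp only: coprime_commute)
    qed
    then have "coprime (d i) (f j)" by (simp only: coprime_int_iff)
    then have cop: "coprime (d i) (f j^2)" by simp
    have "D i * int (f j)^2 = s * int (d i * f j^2)" using sd[OF i] by (simp flip: mult.assoc)
    then have "A i j = of_nat (num_cubic_fields (s * int (d i * f j^2)))" by (simp only: A_def)
    also have "\<dots> = (\<Sum>l=1..k. of_real (c l) * b l (d i * f j^2))"
      using dpos fpos[of j] by (intro rep) (simp add: Suc_le_eq)
    also have "\<dots> = (\<Sum>l=1..k. (of_real (c l) * b l (d i)) * b l (f j^2))"
    proof (intro sum.cong refl)
      fix l assume "l \<in> {1..k}"
      then have "b l (d i * f j^2) = b l (d i) * b l (f j^2)"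
        using mult cop dpos fpos[of j] by (simp add: multiplicative_def)
      then show "of_real (c l) * b l (d i * f j^2) = (of_real (c l) * b l (d i)) * b l (f j^2)" by simp
    qed
    finally show ?thesis .
  qed
  moreover have "A i j = 0" if i: "i \<in> {1..k+1}" and j: "j \<in> {1..k+1}" and ij: "i < j" for i j
  proof -
    define g where "g = (\<Prod>l\<in>{..<j} - {i}. int (q l))"
    have "int (f j) = int (q i) * g" unfolding intf g_def using ij by (simp add: prod.remove)
    moreover have "coprime (int (q i)) g" unfolding g_def
    proof (rule prod_coprime_right)
      fix l assume "l \<in> {..<j} - {i}"
      then have "q i \<noteq> q l" using q(1) by (auto simp: inj_def)
      then have "coprime (q i) (q l)" using q(2) by (intro primes_coprime) auto
      then show "coprime (int (q i)) (int (q l))" by simp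
    qed
    ultimately show ?thesis
      using num_cubic_fields_eq_0[of "int (q i)" "D i" g] D(3)[OF i] q(2,4)[of i] by (simp add: A_def)
  qed
  ultimately obtain i where i: "i \<in> {1..k+1}" "A i i = 0"
    using triangular_rank[of k A "\<lambda>i l. of_real (c l) * b l (d i)" "\<lambda>l j. b l (f j^2)"] by blast
  then have "num_cubic_fields (D i * int (f i)^2) = 0" by (simp add: A_def)
  then show False using num_cubic_fields_nonzero_iff D(4)[OF i(1)] by blast
qed

end
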